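(* Let $X$ be a Banach space, let $A:D(A)\subset X\to X$ be a sectorial operator such that $(\lambda+A)^{-1}$ is compact for all $\lambda\in\rho(-A)$, and let $\{T(t):t\ge0\}$ be the analytic semigroup generated by $-A$, which is assumed to be exponentially decaying. Let $\sigma\in\mathbb{R}$, $T>0$, $0\le\alpha\le 1$, $0<\beta<1-\alpha$, and let $f:[\sigma,\sigma+T)\times X^\alpha\times C([\sigma,\sigma+T],X^\alpha)\to X$ be continuous and such that, for every $u\in C([\sigma,\sigma+T],X^\alpha)$ and all $t,s\in[\sigma,\sigma+T)$, $$\|f(t,u^t(t),u^t(\cdot))-f(s,u^s(s),u^s(\cdot))\|_X\le w(\|u(t)-u(s)\|_\alpha)+w(|t-s|^\beta),$$ where $w:[0,\infty)\to[0,\infty)$ is an increasing continuous function such that $w(0)=0$ and $$\int_0^t r^{-1}w(r^\beta)\,dr<\infty\qquad\text{for } t>0 .$$ Let $w_0\in X^\alpha$ and $t_1\in(0,T)$. If $u:[\sigma,\sigma+t_1]\to X^\alpha$ is a continuous function and $$u(t)=T(t-\sigma)w_0+\int_\sigma^t T(t-s)f(s,u^s(s),u^s(\cdot))\,ds,\qquad \sigma\le t\le\sigma+t_1,$$ then $u$ is a strong solution, on $[\sigma,\sigma+t_1)$, of $$\frac{du(t)}{dt}+Au(t)=f(t,u^t(t),u^t(\cdot)),\quad t>\sigma,\qquad u(\sigma)=w_0 .$$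
   Context: A linear operator $A:D(A)\subset X\to X$ is sectorial if it is closed, densely defined and, for some $\phi\in(0,\pi/2)$, $M\ge 1$ and $a\in\mathbb{R}$, the sector $\Sigma_{a,\phi}=\{\lambda\in\mathbb{C}:\phi\le|\arg(\lambda-a)|\le\pi,\ \lambda\ne a\}$ is contained in the resolvent set of $A$ and $\|(\lambda-A)^{-1}\|\le M/|\lambda-a|$ for all $\lambda\in\Sigma_{a,\phi}$. Then $-A$ generates an analytic semigroup $T(t)=e^{-At}$; exponentially decaying means $\|T(t)\|\le Ce^{-\omega t}$ for some $C,\omega>0$. $X^\alpha=D(A^\alpha)$ is the fractional power space of $A$ with norm $\|x\|_\alpha=\|A^\alpha x\|_X$ ($X^0=X$). For a continuous function $u$ with values in $X^\alpha$, $u^t(\cdot)$ denotes the restriction of $u$ to $[\sigma,t]$, and $u^t(t)=u(t)$. When inserted as the third argument of $f$, $u^t$ is regarded as an element of $C([\sigma,\sigma+T],X^\alpha)$ by extending it by the constant value $u(t)$ on $[t,\sigma+T]$. A function $u:[\sigma,\sigma+t_1)\to X$ is a strong solution of the initial value problem on $[\sigma,\sigma+t_1)$ if $u$ is continuous on $[\sigma,\sigma+t_1)$, continuously differentiable on $(\sigma,\sigma+t_1)$, $u(t)\in D(A)$ for $\sigma<t<\sigma+t_1$, $u(\sigma)=w_0$, and the differential equation holds for $\sigma<t<\sigma+t_1$. *)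

theory Defs
  imports "HOL-Analysis.Analysis"
begin

section \<open>Complex Banach spaces\<close>

text \<open>Sectors, resolvent sets and analytic semigroups need complex scalars. The analysis library only
  has real Banach spaces, so complex multiplication is added on top of the class \<^class>\<open>banach\<close>.\<close>

class complex_banach = banach +
  fixes scaleC :: "complex \<Rightarrow> 'a \<Rightarrow> 'a"  (infixr \<open>*\<^sub>C\<close> 75)
  assumes scaleC_add_right: "c *\<^sub>C (x + y) = c *\<^sub>C x + c *\<^sub>C y"
    and scaleC_add_left: "(c + d) *\<^sub>C x = c *\<^sub>C x + d *\<^sub>C x"
    and scaleC_scaleC: "c *\<^sub>C (d *\<^sub>C x) = (c * d) *\<^sub>C x"
    and scaleC_of_real: "complex_of_real r *\<^sub>C x = r *\<^sub>R x"
    and norm_scaleC: "norm (c *\<^sub>C x) = cmod c * norm x"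

instantiation complex :: complex_banach
begin
definition scaleC_complex :: "complex \<Rightarrow> complex \<Rightarrow> complex"
  where "scaleC_complex c x = c * x"
instance
  by standard (auto simp: scaleC_complex_def algebra_simps norm_mult scaleR_conv_of_real)
end

definition bounded_clinear :: "('a::complex_banach \<Rightarrow> 'a) \<Rightarrow> bool" where
  "bounded_clinear S \<longleftrightarrow> bounded_linear S \<and> (\<forall>c x. S (c *\<^sub>C x) = c *\<^sub>C S x)"

definition compact_operator :: "('a::complex_banach \<Rightarrow> 'a) \<Rightarrow> bool" where
  "compact_operator S \<longleftrightarrow>
     bounded_clinear S \<and> (\<forall>B. bounded B \<longrightarrow> compact (closure (S ` B)))"

section \<open>Unbounded operators and sectoriality\<close>

text \<open>An operator in \<open>X\<close> is a pair of a domain \<open>D\<close> and a function \<open>A\<close> whose values outside \<open>D\<close>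
  are irrelevant.\<close>

definition linear_operator :: "'a::complex_banach set \<Rightarrow> ('a \<Rightarrow> 'a) \<Rightarrow> bool" where
  "linear_operator D A \<longleftrightarrow>
     0 \<in> D \<and>
     (\<forall>x\<in>D. \<forall>y\<in>D. x + y \<in> D \<and> A (x + y) = A x + A y) \<and>
     (\<forall>c. \<forall>x\<in>D. c *\<^sub>C x \<in> D \<and> A (c *\<^sub>C x) = c *\<^sub>C A x)"

definition closed_operator :: "'a::complex_banach set \<Rightarrow> ('a \<Rightarrow> 'a) \<Rightarrow> bool" where
  "closed_operator D A \<longleftrightarrow> closed {(x, A x) |x. x \<in> D}"

definition densely_defined :: "'a::complex_banach set \<Rightarrow> bool" where
  "densely_defined D \<longleftrightarrow> closure D = UNIV"

text \<open>\<open>resolvent D A c\<close> is \<open>(c - A)\<^sup>-\<^sup>1\<close>.\<close>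

definition resolvent :: "'a::complex_banach set \<Rightarrow> ('a \<Rightarrow> 'a) \<Rightarrow> complex \<Rightarrow> 'a \<Rightarrow> 'a" where
  "resolvent D A c = inv_into D (\<lambda>x. c *\<^sub>C x - A x)"

definition resolvent_set :: "'a::complex_banach set \<Rightarrow> ('a \<Rightarrow> 'a) \<Rightarrow> complex set" where
  "resolvent_set D A =
     {c. bij_betw (\<lambda>x. c *\<^sub>C x - A x) D UNIV \<and> bounded_clinear (resolvent D A c)}"

definition sector :: "real \<Rightarrow> real \<Rightarrow> complex set" where
  "sector a \<phi> = {c. \<phi> \<le> \<bar>Arg (c - of_real a)\<bar> \<and> \<bar>Arg (c - of_real a)\<bar> \<le> pi \<and> c \<noteq> of_real a}"

definition sectorial :: "'a::complex_banach set \<Rightarrow> ('a \<Rightarrow> 'a) \<Rightarrow> bool" where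
  "sectorial D A \<longleftrightarrow>
     linear_operator D A \<and> closed_operator D A \<and> densely_defined D \<and>
     (\<exists>\<phi> M a. 0 < \<phi> \<and> \<phi> < pi / 2 \<and> 1 \<le> M \<and> sector a \<phi> \<subseteq> resolvent_set D A \<and>
        (\<forall>c\<in>sector a \<phi>. onorm (resolvent D A c) \<le> M / cmod (c - of_real a)))"

section \<open>Analytic semigroups\<close>

text \<open>A semigroup is a function on \<^typ>\<open>real\<close> of which only the values at \<open>t \<ge> 0\<close> matter.\<close>

definition C0_semigroup :: "(real \<Rightarrow> 'a::complex_banach \<Rightarrow> 'a) \<Rightarrow> bool" where
  "C0_semigroup T \<longleftrightarrow>
     (\<forall>t\<ge>0. bounded_clinear (T t)) \<and>
     (\<forall>x. T 0 x = x) \<and>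
     (\<forall>s\<ge>0. \<forall>t\<ge>0. \<forall>x. T (s + t) x = T s (T t x)) \<and>
     (\<forall>x. ((\<lambda>t. T t x) \<longlongrightarrow> x) (at_right 0))"

text \<open>\<open>(D, B)\<close> is exactly the infinitesimal generator of \<open>T\<close>, domain included.\<close>

definition generator :: "'a::complex_banach set \<Rightarrow> ('a \<Rightarrow> 'a) \<Rightarrow> (real \<Rightarrow> 'a \<Rightarrow> 'a) \<Rightarrow> bool" where
  "generator D B T \<longleftrightarrow>
     (\<forall>x y. ((\<lambda>h. (1 / h) *\<^sub>R (T h x - x)) \<longlongrightarrow> y) (at_right 0) \<longleftrightarrow> x \<in> D \<and> y = B x)"

definition open_sector :: "real \<Rightarrow> complex set" where
  "open_sector \<theta> = {z. z \<noteq> 0 \<and> \<bar>Arg z\<bar> < \<theta>}"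

definition analytic_semigroup :: "(real \<Rightarrow> 'a::complex_banach \<Rightarrow> 'a) \<Rightarrow> bool" where
  "analytic_semigroup T \<longleftrightarrow>
     C0_semigroup T \<and>
     (\<exists>\<theta> S. 0 < \<theta> \<and> \<theta> \<le> pi / 2 \<and>
        (\<forall>t\<ge>0. S (complex_of_real t) = T t) \<and>
        (\<forall>z\<in>open_sector \<theta>. bounded_clinear (S z)) \<and>
        (\<forall>z\<in>open_sector \<theta>. \<forall>z'\<in>open_sector \<theta>. \<forall>x. S (z + z') x = S z (S z' x)) \<and>
        (\<forall>x. \<forall>z\<in>open_sector \<theta>. \<exists>d. ((\<lambda>\<zeta>. S \<zeta> x) has_derivative (\<lambda>h. h *\<^sub>C d)) (at z)) \<and>
        (\<forall>x. ((\<lambda>z. S z x) \<longlongrightarrow> x) (at 0 within open_sector \<theta>)))"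

definition exponentially_decaying :: "(real \<Rightarrow> 'a::complex_banach \<Rightarrow> 'a) \<Rightarrow> bool" where
  "exponentially_decaying T \<longleftrightarrow>
     (\<exists>C \<omega>. 0 < C \<and> 0 < \<omega> \<and> (\<forall>t\<ge>0. onorm (T t) \<le> C * exp (- \<omega> * t)))"

section \<open>Fractional powers\<close>

text \<open>For \<open>T t = e\<^sup>-\<^sup>A\<^sup>t\<close> exponentially decaying, \<open>A\<^sup>-\<^sup>\<alpha> = \<Gamma>(\<alpha>)\<^sup>-\<^sup>1 \<integral>\<^sub>0\<^sup>\<infinity> t\<^sup>\<alpha>\<^sup>-\<^sup>1 e\<^sup>-\<^sup>A\<^sup>t dt\<close> if \<open>\<alpha> > 0\<close>, and
  \<open>A\<^sup>0 = I\<close>. The operator \<open>A\<close> enters only through its semigroup, which it determines. As \<open>A\<^sup>-\<^sup>\<alpha>\<close> is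
  injective, \<open>A\<^sup>\<alpha>\<close> is its inverse, with domain the range of \<open>A\<^sup>-\<^sup>\<alpha>\<close>.\<close>

definition neg_frac_power :: "(real \<Rightarrow> 'a::complex_banach \<Rightarrow> 'a) \<Rightarrow> real \<Rightarrow> 'a \<Rightarrow> 'a" where
  "neg_frac_power T \<alpha> x =
     (if \<alpha> = 0 then x
      else (1 / Gamma \<alpha>) *\<^sub>R integral {0<..} (\<lambda>t. (t powr (\<alpha> - 1)) *\<^sub>R T t x))"

definition frac_dom :: "(real \<Rightarrow> 'a::complex_banach \<Rightarrow> 'a) \<Rightarrow> real \<Rightarrow> 'a set" where
  "frac_dom T \<alpha> = range (neg_frac_power T \<alpha>)"

definition frac_power :: "(real \<Rightarrow> 'a::complex_banach \<Rightarrow> 'a) \<Rightarrow> real \<Rightarrow> 'a \<Rightarrow> 'a" where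
  "frac_power T \<alpha> = inv (neg_frac_power T \<alpha>)"

definition frac_norm :: "(real \<Rightarrow> 'a::complex_banach \<Rightarrow> 'a) \<Rightarrow> real \<Rightarrow> 'a \<Rightarrow> real" where
  "frac_norm T \<alpha> x = norm (frac_power T \<alpha> x)"

definition frac_space :: "(real \<Rightarrow> 'a::complex_banach \<Rightarrow> 'a) \<Rightarrow> real \<Rightarrow> 'a metric" where
  "frac_space T \<alpha> = metric (frac_dom T \<alpha>, \<lambda>x y. frac_norm T \<alpha> (x - y))"

section \<open>Histories and strong solutions\<close>

text \<open>\<open>C([\<sigma>, \<sigma> + \<tau>], X\<^sup>\<alpha>)\<close> with the supremum metric. Its elements are
  \<^const>\<open>extensional\<close> functions, i.e. they take the fixed value \<^const>\<open>undefined\<close> off the interval.\<close>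

definition path_space ::
  "(real \<Rightarrow> 'a::complex_banach \<Rightarrow> 'a) \<Rightarrow> real \<Rightarrow> real \<Rightarrow> real \<Rightarrow> (real \<Rightarrow> 'a) metric" where
  "path_space T \<alpha> \<sigma> \<tau> = cfunspace (top_of_set {\<sigma>..\<sigma> + \<tau>}) (frac_space T \<alpha>)"

text \<open>\<open>u\<^sup>t\<close>: the restriction of \<open>u\<close> to \<open>[\<sigma>, t]\<close>, extended by the constant \<open>u t\<close> to \<open>[t, \<sigma> + \<tau>]\<close>.\<close>

definition history :: "real \<Rightarrow> real \<Rightarrow> (real \<Rightarrow> 'a) \<Rightarrow> real \<Rightarrow> (real \<Rightarrow> 'a)" where
  "history \<sigma> \<tau> u t = restrict (\<lambda>r. u (min r t)) {\<sigma>..\<sigma> + \<tau>}"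

text \<open>\<open>u\<close> solves \<open>u' + A u = f(t, u\<^sup>t(t), u\<^sup>t)\<close>, \<open>u \<sigma> = w\<^sub>0\<close>, on \<open>[\<sigma>, \<sigma> + t\<^sub>1)\<close>. Continuity and
  differentiability refer to the norm of \<open>X\<close>.\<close>

definition strong_solution ::
  "'a::complex_banach set \<Rightarrow> ('a \<Rightarrow> 'a) \<Rightarrow> (real \<Rightarrow> 'a \<Rightarrow> (real \<Rightarrow> 'a) \<Rightarrow> 'a) \<Rightarrow>
   real \<Rightarrow> real \<Rightarrow> 'a \<Rightarrow> real \<Rightarrow> (real \<Rightarrow> 'a) \<Rightarrow> bool" where
  "strong_solution D A f \<sigma> \<tau> w\<^sub>0 t\<^sub>1 u \<longleftrightarrow>
     continuous_on {\<sigma>..<\<sigma> + t\<^sub>1} u \<and>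
     u C1_differentiable_on {\<sigma><..<\<sigma> + t\<^sub>1} \<and>
     (\<forall>t\<in>{\<sigma><..<\<sigma> + t\<^sub>1}. u t \<in> D) \<and>
     u \<sigma> = w\<^sub>0 \<and>
     (\<forall>t\<in>{\<sigma><..<\<sigma> + t\<^sub>1}.
        vector_derivative u (at t) + A (u t) = f t (u t) (history \<sigma> \<tau> u t))"

end

theory Submission
  imports Defs
begin

text \<open>Write \<open>E(t) = A T(t) = - T'(t)\<close>. Uniform boundedness of the semigroup in the sector near \<open>0\<close> and
  Cauchy's estimate give \<open>\<parallel>E(t)\<parallel> \<le> C/t\<close>, hence \<open>\<parallel>A\<^sup>\<alpha> T(t)\<parallel> \<le> M t\<^sup>-\<^sup>\<alpha>\<close>, and the variation of constants
  formula shows that \<open>u\<close> is \<open>\<beta>\<close>-Hoelder with values in \<open>X\<^sup>\<alpha>\<close> away from \<open>\<sigma>\<close>. So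
  \<open>g(t) = f(t, u(t), u\<^sup>t)\<close> has modulus of continuity \<open>r \<mapsto> 2 w(L r\<^sup>\<beta>)\<close>, which satisfies Dini's condition,
  and \<open>\<integral> E(t - s) (g(s) - g(t)) ds\<close> converges absolutely and uniformly in \<open>t\<close>. As \<open>A\<close> is closed,
  \<open>u(t) \<in> D(A)\<close> with \<open>A u\<close> continuous; then
  \<open>u(t) - u(s) = \<integral>\<^sub>s\<^sup>t T(t - r) (g(r) - A u(s)) dr\<close> yields \<open>u' = g - A u\<close>.\<close>

section \<open>Cauchy's estimate and uniform boundedness\<close>

text \<open>Fractional powers are given only through the semigroup integral, so neither the
  injectivity of A^-a nor a usable A^a T(r) comes for free. Both come from one family S(r), a
  multiple of the integral of s^-a A T(r + s) over s > 0, and from S(r) A^-a = T(r). With p =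
  A^\<alpha> u this gives T(e) p = S(e) u: Hoelder bounds are proved for T(e) p with constants
  independent of e and survive e -> 0, and A^\<alpha> is never applied to an integral. Hoelder order
  \<beta> in time costs a stronger singularity: S(x + h) - S(x) has size h^\<beta>
  x^-(\<alpha>+\<beta>), integrable because \<alpha> + \<beta> < 1.

  Subtracting g(t) is forced by the bound C/t on E, which just fails to be integrable: the integral
  of E(t - s) g(t) is explicit, and the rest is at most C m(r)/r, where m is the modulus of g. In
  the last formula A u(s) does not depend on r, so its integral is explicit as well: T(t - r) A u(s)
  integrates to u(s) - T(t - s) u(s), and u(t) - u(s) becomes the integral of a continuous
  quantity.\<close>

lemma bounded_bilinear_scaleC:
  "bounded_bilinear (scaleC :: complex \<Rightarrow> 'a::complex_banach \<Rightarrow> 'a)"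
proof
  fix a b :: complex and x y :: 'a and r :: real
  show "(a + b) *\<^sub>C x = a *\<^sub>C x + b *\<^sub>C x" by (rule scaleC_add_left)
  show "a *\<^sub>C (x + y) = a *\<^sub>C x + a *\<^sub>C y" by (rule scaleC_add_right)
  show "(r *\<^sub>R a) *\<^sub>C x = r *\<^sub>R (a *\<^sub>C x)"
    by (simp add: scaleR_conv_of_real scaleC_scaleC flip: scaleC_of_real)
  show "a *\<^sub>C (r *\<^sub>R x) = r *\<^sub>R (a *\<^sub>C x)"
    by (simp add: scaleC_scaleC mult.commute flip: scaleC_of_real)
  show "\<exists>K. \<forall>a (x::'a). norm (a *\<^sub>C x) \<le> norm a * norm x * K"
    by (rule exI[of _ 1]) (simp add: norm_scaleC)
qed

lemma scaleC_one: "1 *\<^sub>C x = (x::'a::complex_banach)"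
  using scaleC_of_real[of 1 x] by simp

text \<open>Cauchy's formula for the derivative, in polar coordinates. \<open>\<phi>\<close> is an
  unnormalised Fourier coefficient of \<open>F\<close> on the circle of radius
  \<open>\<rho>\<close>, and \<open>\<psi>\<close> integrates \<open>F'\<close> over it.
  Differentiation in \<open>\<rho>\<close> gives \<open>\<phi>\<close>' = \<open>\<psi>\<close>,
  integration by parts in the angle gives \<open>\<phi> \<rho>\<close> = \<rho>
  \<open>\<psi> \<rho>\<close>. So the quotient of \<open>\<phi> \<rho>\<close> by \<rho> is
  constant, and its value at 0 is 2 pi \<open>F' c\<close>.\<close>

lemma cauchy_estimate_scaleC:
  fixes F F' :: "complex \<Rightarrow> 'a::complex_banach"
  assumes R: "0 < R"
    and der: "\<And>z. z \<in> ball c R \<Longrightarrow> (F has_derivative (\<lambda>h. h *\<^sub>C F' z)) (at z)"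
    and cont: "continuous_on (ball c R) F'"
    and bd: "\<And>z. z \<in> ball c R \<Longrightarrow> norm (F z) \<le> M"
  shows "norm (F' c) \<le> M / R"
proof -
  note [continuous_intros] = bounded_bilinear.continuous_on[OF bounded_bilinear_scaleC]
  have contF: "continuous_on (ball c R) F"
    using der by (meson continuous_at_imp_continuous_on has_derivative_continuous)
  have M0: "0 \<le> M" using bd[of c] R by (smt (verit) centre_in_ball norm_ge_zero)
  have main: "r * norm (F' c) \<le> M" if r: "0 < r" "r < R" for r
  proof -
    have inb: "c + of_real \<rho> * cis \<eta> \<in> ball c R" if "\<rho> \<in> {0..r}" for \<rho> \<eta>
      using that r by (auto simp: dist_norm norm_mult)
    define \<phi> where "\<phi> \<rho> = integral {0..2*pi} (\<lambda>\<eta>. cis (-\<eta>) *\<^sub>C F (c + of_real \<rho> * cis \<eta>))" for \<rho>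
    define \<psi> where "\<psi> \<rho> = integral {0..2*pi} (\<lambda>\<eta>. F' (c + of_real \<rho> * cis \<eta>))" for \<rho>
    have path: "((\<lambda>\<eta>. F (c + of_real \<rho> * cis \<eta>)) has_vector_derivative
        (\<i> * of_real \<rho> * cis \<eta>) *\<^sub>C F' (c + of_real \<rho> * cis \<eta>)) (at \<eta> within S)"
      if "\<rho> \<in> {0..r}" for \<rho> \<eta> S
    proof -
      have "((\<lambda>\<eta>. c + of_real \<rho> * cis \<eta>) has_derivative (\<lambda>h. h *\<^sub>R (\<i> * of_real \<rho> * cis \<eta>)))
              (at \<eta> within S)"
        by (auto intro!: derivative_eq_intros simp: scaleR_conv_of_real algebra_simps)
      from has_derivative_compose[OF this der[OF inb[OF that]]] show ?thesis
        by (simp add: has_vector_derivative_def bounded_bilinear.scaleR_left[OF bounded_bilinear_scaleC])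
    qed
    have radial: "((\<lambda>\<rho>. F (c + of_real \<rho> * cis \<eta>)) has_vector_derivative
        cis \<eta> *\<^sub>C F' (c + of_real \<rho> * cis \<eta>)) (at \<rho> within S)"
      if "\<rho> \<in> {0..r}" for \<rho> \<eta> S
    proof -
      have "((\<lambda>\<rho>. c + of_real \<rho> * cis \<eta>) has_derivative (\<lambda>h. h *\<^sub>R cis \<eta>)) (at \<rho> within S)"
        by (auto intro!: derivative_eq_intros simp: scaleR_conv_of_real)
      from has_derivative_compose[OF this der[OF inb[OF that]]] show ?thesis
        by (simp add: has_vector_derivative_def bounded_bilinear.scaleR_left[OF bounded_bilinear_scaleC])
    qed
    have contC: "continuous_on ({0..r} \<times> cbox 0 (2*pi)) (\<lambda>(\<rho>, \<eta>). G (c + of_real \<rho> * cis \<eta>))"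
      if "continuous_on (ball c R) G" for G :: "complex \<Rightarrow> 'a"
      unfolding split_def
      by (rule continuous_on_compose2[OF that])
         (use inb in \<open>auto intro!: continuous_intros\<close>)
    have cont1: "continuous_on {0..2*pi} (\<lambda>\<eta>. G (c + of_real \<rho> * cis \<eta>))"
      if "continuous_on (ball c R) G" "\<rho> \<in> {0..r}" for G :: "complex \<Rightarrow> 'a" and \<rho>
      by (rule continuous_on_compose2[OF that(1)])
         (use inb that(2) in \<open>auto intro!: continuous_intros\<close>)
    have i1: "(\<lambda>\<eta>. cis (-\<eta>) *\<^sub>C F (c + of_real \<rho> * cis \<eta>)) integrable_on {0..2*pi}"
      if "\<rho> \<in> {0..r}" for \<rho>
      by (rule integrable_continuous_interval) (intro continuous_intros cont1 contF that)
    have i2: "(\<lambda>\<eta>. F' (c + of_real \<rho> * cis \<eta>)) integrable_on {0..2*pi}" if "\<rho> \<in> {0..r}" for \<rho>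
      by (rule integrable_continuous_interval) (intro cont1 cont that)
    have d\<phi>: "(\<phi> has_vector_derivative \<psi> \<rho>) (at \<rho> within {0..r})" if "\<rho> \<in> {0..r}" for \<rho>
    proof -
      have "((\<lambda>\<rho>. integral (cbox 0 (2*pi)) (\<lambda>\<eta>. cis (-\<eta>) *\<^sub>C F (c + of_real \<rho> * cis \<eta>)))
          has_vector_derivative integral (cbox 0 (2*pi)) (\<lambda>\<eta>. F' (c + of_real \<rho> * cis \<eta>)))
          (at \<rho> within {0..r})"
      proof (rule leibniz_rule_vector_derivative)
        fix x t assume x: "x \<in> {0..r}"
        have "((\<lambda>x. cis (-t) *\<^sub>C F (c + of_real x * cis t)) has_vector_derivative
            cis (-t) *\<^sub>C (cis t *\<^sub>C F' (c + of_real x * cis t))) (at x within {0..r})"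
          by (rule bounded_linear.has_vector_derivative[OF
                bounded_bilinear.bounded_linear_right[OF bounded_bilinear_scaleC] radial[OF x]])
        then show "((\<lambda>x. cis (-t) *\<^sub>C F (c + of_real x * cis t)) has_vector_derivative
            F' (c + of_real x * cis t)) (at x within {0..r})"
          by (simp add: scaleC_scaleC cis_mult scaleC_one)
      qed (use i1 contC[OF cont] that in auto)
      then show ?thesis by (simp add: \<phi>_def[abs_def] \<psi>_def)
    qed
    have \<phi>\<psi>: "\<phi> \<rho> = \<rho> *\<^sub>R \<psi> \<rho>" if "\<rho> \<in> {0..r}" for \<rho>
    proof -
      \<comment> \<open>\<open>?G\<close> is 2 pi-periodic, so the boundary terms cancel; its
        derivative is the difference of the two integrands to be compared.\<close>
      let ?G = "\<lambda>\<eta>. (\<i> * cis (-\<eta>)) *\<^sub>C F (c + of_real \<rho> * cis \<eta>)"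
      have "((\<lambda>\<eta>. cis (-\<eta>) *\<^sub>C F (c + of_real \<rho> * cis \<eta>) - \<rho> *\<^sub>R F' (c + of_real \<rho> * cis \<eta>))
          has_integral ?G (2*pi) - ?G 0) {0..2*pi}"
      proof (rule fundamental_theorem_of_calculus)
        fix \<eta> :: real
        have "((\<lambda>\<eta>. \<i> * cis (-\<eta>)) has_vector_derivative cis (-\<eta>)) (at \<eta> within {0..2*pi})"
          unfolding has_vector_derivative_def
          by (auto intro!: derivative_eq_intros simp: scaleR_conv_of_real fun_eq_iff complex_eq_iff)
        from bounded_bilinear.has_vector_derivative[OF bounded_bilinear_scaleC this path[OF that]]
        show "(?G has_vector_derivative cis (-\<eta>) *\<^sub>C F (c + of_real \<rho> * cis \<eta>)
            - \<rho> *\<^sub>R F' (c + of_real \<rho> * cis \<eta>)) (at \<eta> within {0..2*pi})"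
        proof (rule back_subst)
          have "\<i> * cis (- \<eta>) * (\<i> * of_real \<rho> * cis \<eta>) = - of_real \<rho> * (cis (-\<eta>) * cis \<eta>)"
            by (simp add: algebra_simps del: cis_mult)
          also have "\<dots> = of_real (-\<rho>)" by (simp add: cis_mult)
          finally have eq: "\<i> * cis (- \<eta>) * (\<i> * of_real \<rho> * cis \<eta>) = of_real (-\<rho>)" .
          show "(?G has_vector_derivative
            (\<i> * cis (- \<eta>)) *\<^sub>C (\<i> * complex_of_real \<rho> * cis \<eta>) *\<^sub>C F' (c + complex_of_real \<rho> * cis \<eta>) +
             cis (- \<eta>) *\<^sub>C F (c + complex_of_real \<rho> * cis \<eta>)) (at \<eta> within {0..2*pi}) =
            (?G has_vector_derivative cis (-\<eta>) *\<^sub>C F (c + of_real \<rho> * cis \<eta>)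
            - \<rho> *\<^sub>R F' (c + of_real \<rho> * cis \<eta>)) (at \<eta> within {0..2*pi})"
            unfolding scaleC_scaleC eq scaleC_of_real by (simp add: algebra_simps)
        qed
      qed simp
      then have "((\<lambda>\<eta>. cis (-\<eta>) *\<^sub>C F (c + of_real \<rho> * cis \<eta>) - \<rho> *\<^sub>R F' (c + of_real \<rho> * cis \<eta>))
          has_integral 0) {0..2*pi}"
        using cis_2pi cis_inverse[of "2*pi"] by simp
      then have "\<phi> \<rho> - \<rho> *\<^sub>R \<psi> \<rho> = 0"
        unfolding \<phi>_def \<psi>_def
        by (rule has_integral_unique[OF has_integral_diff[OF integrable_integral[OF i1[OF that]]
              has_integral_cmul[OF integrable_integral[OF i2[OF that]]]]])
      then show ?thesis by simp
    qed
    have const: "\<phi> \<rho> = \<rho> *\<^sub>R ((1/r) *\<^sub>R \<phi> r)" if "\<rho> \<in> {0..r}" for \<rho>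
    proof (cases "\<rho> = 0")
      case True then show ?thesis using \<phi>\<psi>[of 0] r by simp
    next
      case False
      have d0: "((\<lambda>x. (1/x) *\<^sub>R \<phi> x) has_derivative (\<lambda>h. 0)) (at x within {\<rho>..r})" if x: "x \<in> {\<rho>..r}" for x
      proof -
        have x0: "x > 0" "x \<in> {0..r}" using x False \<open>\<rho> \<in> {0..r}\<close> by auto
        have a: "((\<lambda>x. 1/x) has_vector_derivative - (1/x^2)) (at x within {\<rho>..r})"
          unfolding has_real_derivative_iff_has_vector_derivative[symmetric]
          using x0 by (auto intro!: derivative_eq_intros simp: power2_eq_square field_simps)
        have b: "(\<phi> has_vector_derivative \<psi> x) (at x within {\<rho>..r})"
          by (rule has_vector_derivative_within_subset[OF d\<phi>[OF x0(2)]]) (use \<open>\<rho> \<in> {0..r}\<close> in auto)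
        have "((\<lambda>x. (1/x) *\<^sub>R \<phi> x) has_vector_derivative (1/x) *\<^sub>R \<psi> x + (- (1/x^2)) *\<^sub>R \<phi> x)
            (at x within {\<rho>..r})"
          by (rule bounded_bilinear.has_vector_derivative[OF bounded_bilinear_scaleR a b])
        moreover have "(1/x) *\<^sub>R \<psi> x + (- (1/x^2)) *\<^sub>R \<phi> x = 0"
          using x0 by (simp add: \<phi>\<psi>[OF x0(2)] power2_eq_square)
        ultimately show ?thesis by (simp add: has_vector_derivative_def)
      qed
      have "\<exists>k. \<forall>x\<in>{\<rho>..r}. (1/x) *\<^sub>R \<phi> x = k"
        by (rule has_derivative_zero_constant[OF _ d0]) auto
      then have "(1/\<rho>) *\<^sub>R \<phi> \<rho> = (1/r) *\<^sub>R \<phi> r" using that by auto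
      then show ?thesis using False by (metis (no_types) divide_inverse mult_1 scaleR_one scaleR_scaleR right_inverse)
    qed
    \<comment> \<open>By \<open>const\<close>, \<open>\<phi>\<close> is linear on [0, r], with slope
      \<open>\<phi> r\<close> divided by r. Its one-sided derivative at 0 is also
      \<open>\<psi> 0\<close> by \<open>d\<phi>\<close>, which identifies the slope.\<close>
    have "((\<lambda>\<rho>. \<rho> *\<^sub>R v) has_vector_derivative v) (at 0 within {0..r})" for v :: 'a
      by (auto intro!: derivative_eq_intros simp: has_vector_derivative_def)
    then have "(\<phi> has_vector_derivative (1/r) *\<^sub>R \<phi> r) (at 0 within {0..r})"
      by (rule has_vector_derivative_transform[rotated 2]) (use r in simp, rule const)
    moreover have "(\<phi> has_vector_derivative \<psi> 0) (at 0 within {0..r})" using d\<phi>[of 0] r by auto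
    ultimately have "(1/r) *\<^sub>R \<phi> r = \<psi> 0"
      using r by (metis atLeastAtMost_iff less_eq_real_def vector_derivative_unique_within_closed_interval box_real(2))
    moreover have "\<psi> 0 = (2*pi) *\<^sub>R F' c" by (simp add: \<psi>_def)
    moreover have "\<phi> r = r *\<^sub>R ((1/r) *\<^sub>R \<phi> r)" using r by simp
    ultimately have e1: "\<phi> r = r *\<^sub>R ((2*pi) *\<^sub>R F' c)" by metis
    have "norm (\<phi> r) \<le> integral {0..2*pi} (\<lambda>_. M)"
      unfolding \<phi>_def
      by (rule integral_norm_bound_integral) (use i1[of r] r bd inb[of r] in \<open>auto simp: norm_scaleC\<close>)
    then have "r * (2 * pi * norm (F' c)) \<le> 2*pi * M" using r e1 by simp
    then have "(2*pi) * (r * norm (F' c)) \<le> (2*pi) * M" by (simp add: mult_ac)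
    then show ?thesis using mult_le_cancel_left_pos[of "2*pi"] pi_gt_zero by simp
  qed
  have "R * norm (F' c) \<le> M"
  proof (rule tendsto_upperbound)
    show "((\<lambda>r. r * norm (F' c)) \<longlongrightarrow> R * norm (F' c)) (at_left R)"
      by (intro tendsto_intros)
    show "\<forall>\<^sub>F r in at_left R. r * norm (F' c) \<le> M"
      using eventually_at_left_field[of _ R] main R by (auto intro!: exI[of _ 0])
  qed auto
  then show ?thesis using R by (simp add: field_simps)
qed

text \<open>Index set and bound share the same n because strong convergence S(z) x -> x at 0 bounds
  S(z) x only on a neighbourhood that depends on x. Baire's theorem finds one n that serves all x at
  once.\<close>

lemma uniform_boundedness_decreasing:
  fixes L :: "'i \<Rightarrow> 'a::banach \<Rightarrow> 'b::real_normed_vector" and I :: "nat \<Rightarrow> 'i set"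
  assumes lin: "\<And>n i. i \<in> I n \<Longrightarrow> bounded_linear (L i)"
    and bd: "\<And>x. \<exists>n. \<forall>i\<in>I n. norm (L i x) \<le> real n"
  shows "\<exists>n C. \<forall>i\<in>I n. \<forall>x. norm (L i x) \<le> C * norm x"
proof -
  define F where "F n = {x. \<forall>i\<in>I n. norm (L i x) \<le> real n}" for n
  have cl: "closed (F n)" for n
  proof -
    have "F n = (\<Inter>i\<in>I n. {x. norm (L i x) \<le> real n})" by (auto simp: F_def)
    moreover have "closed {x. norm (L i x) \<le> real n}" if "i \<in> I n" for i
      by (intro closed_Collect_le continuous_intros continuous_on_norm
            linear_continuous_on lin[OF that])
    ultimately show ?thesis by auto
  qed
  have "\<Union>(range F) = UNIV" using bd by (auto simp: F_def)
  then have "interior (\<Union>(range F)) \<noteq> {}" by simp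
  moreover have "euclidean interior_of \<Union>(range F) = {}" if "\<And>n. interior (F n) = {}"
    by (rule Baire_category_alt) (use that cl in \<open>auto simp: completely_metrizable_space_euclidean\<close>)
  ultimately obtain n where "interior (F n) \<noteq> {}" by fastforce
  then obtain x0 e where e: "e > 0" "cball x0 e \<subseteq> F n"
    by (meson equals0I mem_interior_cball)
  have "norm (L i x) \<le> (2 * real n / e) * norm x" if i: "i \<in> I n" for i x
  proof (cases "x = 0")
    case True then show ?thesis using lin[OF i] by (simp add: linear_simps)
  next
    case False
    define y where "y = (e / norm x) *\<^sub>R x"
    have "norm y = e" using False e by (simp add: y_def)
    then have "x0 + y \<in> F n" "x0 \<in> F n" using e by (auto simp: dist_norm subset_iff)
    then have "norm (L i (x0 + y)) \<le> n" "norm (L i x0) \<le> n" using i by (auto simp: F_def)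
    moreover have "L i (x0 + y) = L i x0 + L i y" using lin[OF i] by (simp add: linear_simps)
    ultimately have "norm (L i y) \<le> 2 * real n"
      using norm_triangle_ineq4[of "L i x0 + L i y" "L i x0"] by simp
    moreover have "L i y = (e / norm x) *\<^sub>R L i x" using lin[OF i] by (simp add: y_def linear_simps)
    ultimately show ?thesis using False e by (simp add: field_simps)
  qed
  then show ?thesis by blast
qed

section \<open>Improper vector-valued integrals\<close>

text \<open>The Henstock-Kurzweil integral contains the improper one: limits of a primitive at both
  ends suffice, without absolute convergence.\<close>

lemma has_integral_improper:
  fixes f F :: "real \<Rightarrow> 'a::banach"
  assumes der: "\<And>x. x > 0 \<Longrightarrow> (F has_vector_derivative f x) (at x)"
    and lim0: "(F \<longlongrightarrow> F0) (at_right 0)"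
    and lim1: "(F \<longlongrightarrow> F1) at_top"
  shows "(f has_integral (F1 - F0)) {0<..}"
proof -
  \<comment> \<open>The values of \<open>F\<close> at and below 0 are arbitrary; \<open>G\<close> is
    its continuous extension.\<close>
  define G where "G x = (if x \<le> 0 then F0 else F x)" for x
  have G: "G 0 = F0" "\<And>x. x > 0 \<Longrightarrow> G x = F x" by (auto simp: G_def)
  have derG: "(G has_vector_derivative f x) (at x)" if "x > 0" for x
    by (rule has_vector_derivative_transform_within_open[OF der[OF that], of "{0<..}"])
       (use that G in auto)
  have fin: "(f has_integral F b - F0) {0..b}" if "b > 0" for b
  proof -
    have "(f has_integral G b - G 0) {0..b}"
    proof (rule fundamental_theorem_of_calculus_interior)
      show "continuous_on {0..b} G"
        unfolding continuous_on_eq_continuous_within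
      proof
        fix x assume x: "x \<in> {0..b}"
        show "continuous (at x within {0..b}) G"
        proof (cases "x = 0")
          case True
          have "(G \<longlongrightarrow> F0) (at_right 0)"
            by (rule tendsto_cong[THEN iffD1, OF _ lim0])
               (auto simp: eventually_at_right_field G intro!: exI[of _ 1])
          then show ?thesis using that True by (simp add: continuous_within G at_within_Icc_at_right)
        next
          case False
          then show ?thesis
            using derG[of x] x by (auto intro: continuous_at_imp_continuous_within has_vector_derivative_continuous)
        qed
      qed
    qed (use that derG in auto)
    then show ?thesis using that G by simp
  qed
  let ?g = "\<lambda>x. if x \<in> {0<..} then f x else 0"
  have box: "(?g has_integral F b - F0) {a..b}" if "a \<le> 0" "b > 0" for a b
  proof -
    have "(?g has_integral F b - F0) {0..b}"
      by (rule has_integral_spike_finite[OF _ _ fin[OF that(2)], of "{0}"]) auto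
    moreover have "(?g has_integral 0) {a..0}"
      by (rule has_integral_is_0) auto
    ultimately show ?thesis
      using has_integral_combine[of a 0 b ?g 0 "F b - F0"] that by simp
  qed
  show ?thesis
    unfolding has_integral_alt'[of f]
  proof (intro conjI allI impI)
    fix a b :: real
    have "?g integrable_on {min a 0..max b 1}" by (rule has_integral_integrable[OF box]) auto
    then show "?g integrable_on cbox a b"
      using integrable_on_subinterval[of ?g "{min a 0..max b 1}" a b] by simp
  next
    fix e :: real assume e: "e > 0"
    then obtain N where N: "\<And>x. x \<ge> N \<Longrightarrow> dist (F x) F1 < e"
      using tendstoD[OF lim1 e] by (auto simp: eventually_at_top_linorder)
    show "\<exists>B>0. \<forall>a b. ball 0 B \<subseteq> cbox a b \<longrightarrow> norm (integral (cbox a b) ?g - (F1 - F0)) < e"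
    proof (intro exI[of _ "max N 1"] conjI allI impI)
      fix a b :: real assume s: "ball 0 (max N 1) \<subseteq> cbox a b"
      then have "{- max N 1<..<max N 1} \<subseteq> {a..b}" by (simp add: ball_eq_greaterThanLessThan)
      then have "a \<le> - max N 1" "max N 1 \<le> b"
        by (auto simp: greaterThanLessThan_subseteq_atLeastAtMost_iff)
      then have "integral (cbox a b) ?g = F b - F0" "norm (F b - F1) < e"
        using box[of a b] N[of b] by (auto simp: dist_norm)
      then show "norm (integral (cbox a b) ?g - (F1 - F0)) < e" by simp
    qed auto
  qed
qed

lemma antiderivative_on_pos:
  fixes f :: "real \<Rightarrow> 'a::banach"
  assumes "continuous_on {0<..} f"
  shows "\<exists>F. \<forall>x>0. (F has_vector_derivative f x) (at x)"
proof -
  \<comment> \<open>A signed integral based at 1: the interval with reversed ends is empty or a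
    point and contributes 0.\<close>
  define F where "F x = integral {1..x} f - integral {x..1} f" for x
  have "(F has_vector_derivative f x) (at x)" if x: "x > 0" for x
  proof -
    define c d where "c = min (x/2) (1/2)" and "d = x + 1"
    have c: "0 < c" "c < x" "x < d" "c < 1" "1 < d" using x by (auto simp: c_def d_def)
    have cont: "continuous_on {c..d} f"
      by (rule continuous_on_subset[OF assms]) (use c in auto)
    have int: "f integrable_on {s..t}" if "c \<le> s" "t \<le> d" for s t
      by (rule integrable_continuous_interval, rule continuous_on_subset[OF cont]) (use that in auto)
    have eq: "F y = integral {c..y} f - integral {c..1} f" if "y \<in> {c<..<d}" for y
    proof (cases "y \<le> 1")
      case True
      have "integral {1..y} f = 0" using True by (cases "y = 1") auto
      moreover have "integral {c..y} f + integral {y..1} f = integral {c..1} f"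
        by (rule Henstock_Kurzweil_Integration.integral_combine) (use True that c int in auto)
      ultimately show ?thesis by (simp add: F_def algebra_simps)
    next
      case False
      then have "integral {y..1} f = 0" by auto
      moreover have "integral {c..1} f + integral {1..y} f = integral {c..y} f"
        by (rule Henstock_Kurzweil_Integration.integral_combine) (use False that c int in auto)
      ultimately show ?thesis by (simp add: F_def algebra_simps)
    qed
    have "((\<lambda>y. integral {c..y} f - integral {c..1} f) has_vector_derivative f x) (at x)"
    proof -
      have "((\<lambda>y. integral {c..y} f) has_vector_derivative f x) (at x within {c..d})"
        by (rule integral_has_vector_derivative[OF cont]) (use c in auto)
      then have "((\<lambda>y. integral {c..y} f) has_vector_derivative f x) (at x)"
        using c by (simp add: at_within_Icc_at)
      then show ?thesis by (auto intro!: derivative_eq_intros)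
    qed
    then show ?thesis
      by (rule has_vector_derivative_transform_within_open[where S = "{c<..<d}"]) (use c eq in auto)
  qed
  then show ?thesis by blast
qed

text \<open>The Bochner integral of the library needs a separable range, so the Henstock-Kurzweil integral is
  used; the domination below replaces absolute integrability.\<close>

definition powr_dominated :: "real \<Rightarrow> real \<Rightarrow> real \<Rightarrow> (real \<Rightarrow> 'a::real_normed_vector) \<Rightarrow> bool" where
  "powr_dominated a b C f \<longleftrightarrow> -1 < a \<and> b < -1 \<and> continuous_on {0<..} f \<and>
     (\<forall>t\<in>{0<..1}. norm (f t) \<le> C * t powr a) \<and> (\<forall>t\<ge>1. norm (f t) \<le> C * t powr b)"

text \<open>Increments of a primitive of \<open>f\<close> are dominated by those of the primitive of
  C t^a on (0, 1] and of C t^b on [1, \<infinity>), so it is Cauchy at both ends. The bound adds the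
  two masses of the majorant. Besides the integral, the primitive itself is exported, since
  substitutions are carried out on it.\<close>

lemma powr_dominated_primitive:
  fixes f :: "real \<Rightarrow> 'a::banach"
  assumes "powr_dominated a b C f"
  shows "\<exists>F F1. (\<forall>x>0. (F has_vector_derivative f x) (at x)) \<and>
    (F \<longlongrightarrow> 0) (at_right 0) \<and> (F \<longlongrightarrow> F1) at_top \<and> (f has_integral F1) {0<..} \<and>
    norm F1 \<le> C * (1 / (a+1) + 1 / (-b-1))"
proof -
  have a: "a > -1" and b: "b < -1" and cont: "continuous_on {0<..} f"
    and n0: "\<And>t. 0 < t \<Longrightarrow> t \<le> 1 \<Longrightarrow> norm (f t) \<le> C * t powr a"
    and n1: "\<And>t. t \<ge> 1 \<Longrightarrow> norm (f t) \<le> C * t powr b"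
    using assms by (auto simp: powr_dominated_def)
  obtain G where G: "\<And>x. x > 0 \<Longrightarrow> (G has_vector_derivative f x) (at x)"
    using antiderivative_on_pos[OF cont] by blast
  have contG: "continuous_on {x..y} G" if "0 < x" for x y
    using G that by (meson atLeastAtMost_iff continuous_at_imp_continuous_on has_vector_derivative_continuous less_le_trans)
  have C0: "C \<ge> 0" using n1[of 1] by (simp, smt (verit) norm_ge_zero)
  have inc: "norm (G y - G x) \<le> C * y powr (e+1) / (e+1) - C * x powr (e+1) / (e+1)"
    if "0 < x" "x \<le> y" "e \<noteq> -1" "\<And>t. t \<in> {x..y} \<Longrightarrow> norm (f t) \<le> C * t powr e" for x y e
  proof (cases "x = y")
    case True then show ?thesis by simp
  next
    case False
    show ?thesis
    proof (rule differentiable_bound_general)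
      show "continuous_on {x..y} (\<lambda>t. C * t powr (e+1) / (e+1))"
        using that by (intro continuous_intros) auto
      fix t assume t: "x < t" "t < y"
      show "(G has_vector_derivative f t) (at t)" using G that t by auto
      show "norm (f t) \<le> C * t powr e" using that t by auto
      have "((\<lambda>t. C * t powr (e+1) / (e+1)) has_real_derivative C * t powr e) (at t)"
        using DERIV_cmult[OF has_real_derivative_powr[of t "e+1"], of "C / (e+1)"] that t by simp
      then show "((\<lambda>t. C * t powr (e+1) / (e+1)) has_vector_derivative C * t powr e) (at t)"
        by (simp add: has_real_derivative_iff_has_vector_derivative)
    qed (use that False contG in auto)
  qed
  have inc0: "norm (G y - G x) \<le> C / (a+1) * (y powr (a+1) - x powr (a+1))" if "0 < x" "x \<le> y" "y \<le> 1" for x y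
    using inc[of x y a] n0 that a by (simp add: right_diff_distrib)
  have inc1: "norm (G y - G x) \<le> C / (-b-1) * (x powr (b+1) - y powr (b+1))" if "1 \<le> x" "x \<le> y" for x y
  proof -
    have "norm (G y - G x) \<le> C * y powr (b+1) / (b+1) - C * x powr (b+1) / (b+1)"
      using inc[of x y b] n1 that b by auto
    also have "\<dots> = C / (-b-1) * (x powr (b+1) - y powr (b+1))"
    proof -
      have "C / (-b-1) = - (C / (b+1))" by (simp add: minus_divide_right)
      then show ?thesis by (simp only:) (simp add: right_diff_distrib)
    qed
    finally show ?thesis .
  qed
  \<comment> \<open>One criterion for both ends. \<open>h\<close> is the absolute value of the
    primitive of the majorant that vanishes at the end in question; the symmetric bound avoids
    ordering x and y.\<close>
  have cauchy: "\<exists>l. (G \<longlongrightarrow> l) Fl"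
    if Fl: "Fl \<noteq> bot" and "eventually P Fl" and h: "(h \<longlongrightarrow> 0) Fl"
      and bd: "\<And>x y. P x \<Longrightarrow> P y \<Longrightarrow> norm (G y - G x) \<le> h x + h y" for Fl P and h :: "real \<Rightarrow> real"
  proof -
    have "cauchy_filter (filtermap G Fl)"
      unfolding cauchy_filter_metric_filtermap
    proof (intro allI impI)
      fix e :: real assume "e > 0"
      then have "eventually (\<lambda>x. h x < e/2) Fl" by (intro order_tendstoD(2)[OF h]) simp
      then show "\<exists>Q. eventually Q Fl \<and> (\<forall>x y. Q x \<and> Q y \<longrightarrow> dist (G x) (G y) < e)"
        using \<open>eventually P Fl\<close> bd
      proof (intro exI[of _ "\<lambda>x. P x \<and> h x < e/2"] conjI allI impI)
        fix x y assume "(P x \<and> h x < e/2) \<and> (P y \<and> h y < e/2)"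
        then show "dist (G x) (G y) < e" using bd[of y x] by (simp add: dist_norm)
      qed (auto intro: eventually_conj)
    qed
    then show ?thesis
      using cauchy_filter_convergent[of "filtermap G Fl"] Fl
      by (auto simp: convergent_filter_iff filterlim_def filtermap_bot_iff)
  qed
  have "\<exists>l. (G \<longlongrightarrow> l) (at_right 0)"
  proof (rule cauchy[where P = "\<lambda>x. 0 < x \<and> x \<le> 1" and h = "\<lambda>x. C / (a+1) * x powr (a+1)"])
    show "\<forall>\<^sub>F x::real in at_right 0. 0 < x \<and> x \<le> 1"
      by (auto simp: eventually_at_right_field intro!: exI[of _ 1])
    have "((\<lambda>x. C / (a+1) * x powr (a+1)) \<longlongrightarrow> C / (a+1) * 0 powr (a+1)) (at_right 0)"
      using a by (intro tendsto_intros) (auto simp: eventually_at_right_field intro!: exI[of _ 1])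
    then show "((\<lambda>x. C / (a+1) * x powr (a+1)) \<longlongrightarrow> 0) (at_right 0)" by simp
    fix x y :: real assume xy: "0 < x \<and> x \<le> 1" "0 < y \<and> y \<le> 1"
    have "C / (a+1) * x powr (a+1) \<ge> 0" "C / (a+1) * y powr (a+1) \<ge> 0" using C0 a by auto
    then show "norm (G y - G x) \<le> C / (a+1) * x powr (a+1) + C / (a+1) * y powr (a+1)"
      using inc0[of x y] inc0[of y x] xy
      by (cases "x \<le> y") (auto simp: norm_minus_commute right_diff_distrib)
  qed auto
  then obtain l0 where l0: "(G \<longlongrightarrow> l0) (at_right 0)" by blast
  have pz: "((\<lambda>x. C / (-b-1) * x powr (b+1)) \<longlongrightarrow> 0) at_top"
    by (rule tendsto_mult_right_zero[OF tendsto_neg_powr]) (use b in \<open>auto intro: filterlim_ident\<close>)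
  have "\<exists>l. (G \<longlongrightarrow> l) at_top"
  proof (rule cauchy[where P = "\<lambda>x. 1 \<le> x" and h = "\<lambda>x. C / (-b-1) * x powr (b+1)"])
    fix x y :: real assume xy: "1 \<le> x" "1 \<le> y"
    have "C / (-b-1) * x powr (b+1) \<ge> 0" "C / (-b-1) * y powr (b+1) \<ge> 0" using C0 b by auto
    then show "norm (G y - G x) \<le> C / (-b-1) * x powr (b+1) + C / (-b-1) * y powr (b+1)"
      using inc1[of x y] inc1[of y x] xy
      by (cases "x \<le> y") (auto simp: norm_minus_commute right_diff_distrib)
  qed (use pz in \<open>simp_all add: eventually_ge_at_top del: times_divide_eq_left\<close>)
  then obtain l1 where l1: "(G \<longlongrightarrow> l1) at_top" by blast
  define F where "F x = G x - l0" for x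
  have dF: "(F has_vector_derivative f x) (at x)" if "x > 0" for x
    unfolding F_def using G[OF that] by (auto intro!: derivative_eq_intros)
  have F0: "(F \<longlongrightarrow> 0) (at_right 0)" unfolding F_def using tendsto_diff[OF l0 tendsto_const[of l0]] by simp
  have F1: "(F \<longlongrightarrow> l1 - l0) at_top" unfolding F_def by (intro tendsto_intros l1)
  have "norm (G 1 - l0) \<le> C / (a+1)"
  proof (rule tendsto_upperbound)
    show "((\<lambda>x. norm (G 1 - G x)) \<longlongrightarrow> norm (G 1 - l0)) (at_right 0)" by (intro tendsto_intros l0)
    have "norm (G 1 - G x) \<le> C / (a+1)" if "0 < x" "x \<le> 1" for x
    proof -
      have "C / (a+1) * (1 - x powr (a+1)) \<le> C / (a+1) * 1" using C0 a by (intro mult_left_mono) auto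
      then show ?thesis using inc0[of x 1] that by simp
    qed
    then show "\<forall>\<^sub>F x in at_right 0. norm (G 1 - G x) \<le> C / (a+1)"
      by (auto simp: eventually_at_right_field intro!: exI[of _ 1])
  qed auto
  moreover have "norm (l1 - G 1) \<le> C / (-b-1)"
  proof (rule tendsto_upperbound)
    show "((\<lambda>x. norm (G x - G 1)) \<longlongrightarrow> norm (l1 - G 1)) at_top" by (intro tendsto_intros l1)
    have "norm (G x - G 1) \<le> C / (-b-1)" if "1 \<le> x" for x
    proof -
      have "C / (-b-1) * (1 - x powr (b+1)) \<le> C / (-b-1) * 1" using C0 b by (intro mult_left_mono) auto
      then show ?thesis using inc1[of 1 x] that by simp
    qed
    then show "\<forall>\<^sub>F x in at_top. norm (G x - G 1) \<le> C / (-b-1)"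
      by (auto intro: eventually_mono[OF eventually_ge_at_top[of 1]])
  qed auto
  ultimately have bound: "norm (l1 - l0) \<le> C * (1 / (a+1) + 1 / (-b-1))"
    using norm_triangle_ineq[of "l1 - G 1" "G 1 - l0"] by (simp add: algebra_simps)
  have "(f has_integral (l1 - l0)) {0<..}" using has_integral_improper[OF dF F0 F1] by simp
  with F0 F1 bound show ?thesis using dF by (intro exI[of _ F] exI[of _ "l1 - l0"] conjI allI impI)
qed

lemma powr_dominated_integrable:
  fixes f :: "real \<Rightarrow> 'a::banach"
  assumes "powr_dominated a b C f"
  shows "f integrable_on {0<..}"
  using powr_dominated_primitive[OF assms] by (elim exE conjE) (erule has_integral_integrable)

lemma powr_dominated_norm_integral:
  fixes f :: "real \<Rightarrow> 'a::banach"
  assumes "powr_dominated a b C f"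
  shows "norm (integral {0<..} f) \<le> C * (1 / (a+1) + 1 / (-b-1))"
proof -
  obtain F1 where "(f has_integral F1) {0<..}" "norm F1 \<le> C * (1 / (a+1) + 1 / (-b-1))"
    using powr_dominated_primitive[OF assms] by (elim exE conjE)
  then show ?thesis by (simp only: integral_unique[of f F1])
qed

text \<open>Substitution at the level of primitives: \<open>F (c * t)\<close> divided by c is a
  primitive of \<open>f (c * t)\<close> with limits at both ends.\<close>

lemma powr_dominated_integral_scale:
  fixes f :: "real \<Rightarrow> 'a::banach"
  assumes "powr_dominated a b C f" and c: "c > 0"
  shows "integral {0<..} f = c *\<^sub>R integral {0<..} (\<lambda>t. f (c * t))"
proof -
  obtain F F1 where F: "\<And>x. x > 0 \<Longrightarrow> (F has_vector_derivative f x) (at x)"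
    "(F \<longlongrightarrow> 0) (at_right 0)" "(F \<longlongrightarrow> F1) at_top" "(f has_integral F1) {0<..}"
    using powr_dominated_primitive[OF assms(1)] by (elim exE conjE) (rule that; simp)
  have "((\<lambda>t. f (c * t)) has_integral ((1/c) *\<^sub>R F1 - (1/c) *\<^sub>R 0)) {0<..}"
  proof (rule has_integral_improper)
    fix x :: real assume x: "x > 0"
    have "(F has_vector_derivative f (c * x)) (at (c * x))" using F(1) x c by simp
    moreover have "((\<lambda>x. c * x) has_vector_derivative c) (at x)"
      by (auto intro!: derivative_eq_intros)
    ultimately have "((F \<circ> (\<lambda>x. c * x)) has_vector_derivative c *\<^sub>R f (c * x)) (at x)"
      by (intro vector_diff_chain_at) 
    then have "((\<lambda>x. (1/c) *\<^sub>R F (c * x)) has_vector_derivative (1/c) *\<^sub>R c *\<^sub>R f (c * x)) (at x)"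
      unfolding o_def by (rule bounded_linear.has_vector_derivative[OF bounded_linear_scaleR_right])
    then show "((\<lambda>x. (1/c) *\<^sub>R F (c * x)) has_vector_derivative f (c * x)) (at x)" using c by simp
  next
    have "filterlim (\<lambda>x. c * x) (at_right 0) (at_right 0)"
      unfolding filterlim_at using c
      by (auto intro!: tendsto_eq_intros simp: eventually_at_right_field intro!: exI[of _ 1])
    then show "((\<lambda>x. (1/c) *\<^sub>R F (c * x)) \<longlongrightarrow> (1/c) *\<^sub>R 0) (at_right 0)"
      by (intro tendsto_intros filterlim_compose[OF F(2)])
    have "filterlim (\<lambda>x. c * x) at_top at_top"
      using c by (intro filterlim_tendsto_pos_mult_at_top[OF tendsto_const]) (auto intro: filterlim_ident)
    then show "((\<lambda>x. (1/c) *\<^sub>R F (c * x)) \<longlongrightarrow> (1/c) *\<^sub>R F1) at_top"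
      by (intro tendsto_intros filterlim_compose[OF F(3)])
  qed
  from integral_unique[OF this] integral_unique[OF F(4)] c show ?thesis by simp
qed

section \<open>Decaying analytic semigroups\<close>

lemma vector_derivative_norm_bound:
  fixes f :: "real \<Rightarrow> 'a::real_normed_vector"
  assumes "convex S" "\<And>x. x \<in> S \<Longrightarrow> (f has_vector_derivative f' x) (at x)"
    and "\<And>x. x \<in> S \<Longrightarrow> norm (f' x) \<le> B" and "x \<in> S" "y \<in> S"
  shows "norm (f y - f x) \<le> B * \<bar>y - x\<bar>"
proof -
  have "norm (f y - f x) \<le> B * norm (y - x)"
  proof (rule differentiable_bound[OF assms(1)])
    fix z assume z: "z \<in> S"
    show "(f has_derivative (\<lambda>h. h *\<^sub>R f' z)) (at z within S)"
      using assms(2)[OF z] unfolding has_vector_derivative_def by (rule has_derivative_at_withinI)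
    show "onorm (\<lambda>h. h *\<^sub>R f' z) \<le> B"
    proof (rule onorm_le)
      fix h :: real
      show "norm (h *\<^sub>R f' z) \<le> B * norm h"
        using mult_right_mono[OF assms(3)[OF z] abs_ge_zero[of h]] by (simp add: mult.commute)
    qed
  qed (use assms in auto)
  then show ?thesis by simp
qed

text \<open>A quadratic remainder bound survives integration against a weight; this is how an
  improper integral is differentiated with respect to a parameter.\<close>

lemma has_vector_derivative_quadratic:
  fixes f :: "real \<Rightarrow> 'a::real_normed_vector"
  assumes "d > 0" and bd: "\<And>h. \<bar>h\<bar> < d \<Longrightarrow> norm (f (x + h) - f x - h *\<^sub>R f') \<le> M * h\<^sup>2"
  shows "(f has_vector_derivative f') (at x)"
  unfolding has_vector_derivative_def has_derivative_at
proof (intro conjI bounded_linear_scaleR_left)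
  show "(\<lambda>h. norm (f (x + h) - f x - h *\<^sub>R f') / norm h) \<midarrow>0\<rightarrow> 0"
  proof (rule Lim_null_comparison)
    have "norm (norm (f (x + h) - f x - h *\<^sub>R f') / norm h) \<le> \<bar>M\<bar> * \<bar>h\<bar>" if "\<bar>h\<bar> < d" for h
    proof (cases "h = 0")
      case False
      have "norm (f (x + h) - f x - h *\<^sub>R f') \<le> \<bar>M\<bar> * h\<^sup>2"
        using bd[OF that] by (smt (verit) mult_right_mono zero_le_power2)
      also have "\<dots> = \<bar>M\<bar> * \<bar>h\<bar> * \<bar>h\<bar>" by (simp add: power2_eq_square)
      finally show ?thesis using False by (simp add: field_simps)
    qed simp
    then show "\<forall>\<^sub>F h in at 0. norm (norm (f (x + h) - f x - h *\<^sub>R f') / norm h) \<le> \<bar>M\<bar> * \<bar>h\<bar>"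
      unfolding eventually_at using \<open>d > 0\<close> by (auto simp: dist_real_def)
    show "((\<lambda>h. \<bar>M\<bar> * \<bar>h\<bar>) \<longlongrightarrow> 0) (at 0)"
      by (auto intro!: tendsto_eq_intros)
  qed
qed

lemma has_vector_derivative_shift:
  fixes f :: "real \<Rightarrow> 'a::real_normed_vector"
  assumes "(f has_vector_derivative f') (at (x + c))"
  shows "((\<lambda>r. f (r + c)) has_vector_derivative f') (at x)"
proof -
  have "((\<lambda>r. r + c) has_vector_derivative 1) (at x)"
    by (auto intro!: derivative_eq_intros)
  from vector_diff_chain_at[OF this assms] show ?thesis by (simp add: o_def)
qed

text \<open>\<open>E t\<close> plays the role of A T(t). Exponential decay is recorded as C/t^2:
  powers fit \<open>powr_dominated\<close>, and t^(a-1) t^-2 is integrable at infinity for every a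
  \<le> 1.\<close>

locale decaying_analytic =
  fixes T E :: "real \<Rightarrow> 'a::complex_banach \<Rightarrow> 'a" and C :: real
  assumes T_bounded_linear: "\<And>t. t \<ge> 0 \<Longrightarrow> bounded_linear (T t)"
    and T_0: "\<And>x. T 0 x = x"
    and T_add: "\<And>s t x. s \<ge> 0 \<Longrightarrow> t \<ge> 0 \<Longrightarrow> T (s + t) x = T s (T t x)"
    and T_tendsto: "\<And>x. ((\<lambda>t. T t x) \<longlongrightarrow> x) (at_right 0)"
    and C_pos: "C > 0"
    and T_bound: "\<And>t x. t \<ge> 0 \<Longrightarrow> norm (T t x) \<le> C * norm x"
    and T_decay: "\<And>t x. t > 0 \<Longrightarrow> norm (T t x) \<le> C / t\<^sup>2 * norm x"
    and T_deriv: "\<And>t x. t > 0 \<Longrightarrow> ((\<lambda>s. T s x) has_vector_derivative - E t x) (at t)"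
    and E_bound: "\<And>t x. t > 0 \<Longrightarrow> norm (E t x) \<le> C / t * norm x"
begin

text \<open>\<open>E\<close> is known only as a derivative of \<open>T\<close>, so its algebra
  (here, in \<open>T_E\<close> and in \<open>E_bounded_linear\<close>) comes from differentiating
  identities for \<open>T\<close> and from uniqueness of derivatives.\<close>

lemma E_T: "E (t + s) x = E t (T s x)" if "t > 0" "s \<ge> 0"
proof -
  have "((\<lambda>r. T (r + s) x) has_vector_derivative - E (t + s) x) (at t)"
    by (rule has_vector_derivative_shift, rule T_deriv) (use that in simp)
  then have "((\<lambda>r. T r (T s x)) has_vector_derivative - E (t + s) x) (at t)"
    by (rule has_vector_derivative_transform_within_open[where S = "{0<..}"])
       (use that T_add in auto)
  then show ?thesis using T_deriv[OF that(1)] vector_derivative_unique_at by fastforce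
qed

lemma T_E: "E (s + t) x = T s (E t x)" if "t > 0" "s \<ge> 0"
proof -
  have "((\<lambda>r. T (r + s) x) has_vector_derivative - E (t + s) x) (at t)"
    by (rule has_vector_derivative_shift, rule T_deriv) (use that in simp)
  then have "((\<lambda>r. T s (T r x)) has_vector_derivative - E (t + s) x) (at t)"
    by (rule has_vector_derivative_transform_within_open[where S = "{0<..}"])
       (use that T_add[of s _ x] in \<open>auto simp: add.commute\<close>)
  moreover have "((\<lambda>r. T s (T r x)) has_vector_derivative T s (- E t x)) (at t)"
    by (rule bounded_linear.has_vector_derivative[OF T_bounded_linear T_deriv]) (use that in auto)
  ultimately have "- E (t + s) x = T s (- E t x)" by (rule vector_derivative_unique_at)
  then show ?thesis using T_bounded_linear[OF that(2)] by (simp add: linear_simps add.commute)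
qed

lemma E_bounded_linear: "bounded_linear (E t)" if "t > 0"
proof (rule bounded_linear_intro)
  fix x y :: 'a and r :: real
  have "((\<lambda>s. T s x + T s y) has_vector_derivative - E t x + - E t y) (at t)"
    by (intro derivative_intros T_deriv that)
  then have "((\<lambda>s. T s (x + y)) has_vector_derivative - E t x + - E t y) (at t)"
    by (rule has_vector_derivative_transform_within_open[where S = "{0<..}"])
       (use that in \<open>auto simp: linear_simps(1)[OF T_bounded_linear]\<close>)
  from vector_derivative_unique_at[OF this T_deriv[OF that]]
  show "E t (x + y) = E t x + E t y" by (simp add: algebra_simps)
  have "((\<lambda>s. r *\<^sub>R T s x) has_vector_derivative r *\<^sub>R - E t x) (at t)"
    by (rule bounded_linear.has_vector_derivative[OF bounded_linear_scaleR_right T_deriv[OF that]])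
  then have "((\<lambda>s. T s (r *\<^sub>R x)) has_vector_derivative r *\<^sub>R - E t x) (at t)"
    by (rule has_vector_derivative_transform_within_open[where S = "{0<..}"])
       (use that in \<open>auto simp: linear_simps(5)[OF T_bounded_linear]\<close>)
  from vector_derivative_unique_at[OF this T_deriv[OF that]]
  show "E t (r *\<^sub>R x) = r *\<^sub>R E t x" by simp
  show "norm (E t x) \<le> norm x * (C / t)" using E_bound[OF that, of x] by (simp add: mult.commute)
qed

lemma T_continuous_on: "continuous_on {0..} (\<lambda>t. T t x)"
  unfolding continuous_on_eq_continuous_within
proof
  fix t :: real assume t: "t \<in> {0..}"
  show "continuous (at t within {0..}) (\<lambda>t. T t x)"
  proof (cases "t = 0")
    case True
    then show ?thesis using T_tendsto[of x] by (simp add: continuous_within T_0 at_within_Ici_at_right)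
  next
    case False
    then show ?thesis using T_deriv[of t x] t
      by (auto intro: continuous_at_imp_continuous_within has_vector_derivative_continuous)
  qed
qed

text \<open>Splitting t into two halves writes the second derivative of T as a square, so that the
  first-order bound applies twice; hence the constants (2 C / m)^2 below.\<close>

lemma E_deriv: "((\<lambda>s. E s x) has_vector_derivative - E (t/2) (E (t/2) x)) (at t)" if "t > 0"
proof -
  have "((\<lambda>r. T (r - t/2) (E (t/2) x)) has_vector_derivative - E (t/2) (E (t/2) x)) (at t)"
    using has_vector_derivative_shift[of "\<lambda>r. T r (E (t/2) x)" _ t "- t/2"]
      T_deriv[of "t/2" "E (t/2) x"] that by simp
  then show ?thesis
  proof (rule has_vector_derivative_transform_within_open[where S = "{t/2<..}"])
    fix r assume "r \<in> {t/2<..}"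
    then show "T (r - t/2) (E (t/2) x) = E r x" using T_E[of "t/2" "r - t/2" x] that by simp
  qed (use that in auto)
qed

lemma E_continuous_on: "continuous_on {0<..} (\<lambda>t. E t x)"
  using E_deriv by (meson continuous_at_imp_continuous_on greaterThan_iff has_vector_derivative_continuous)

lemma T_lipschitz: "norm (T t x - T s x) \<le> C / m * \<bar>t - s\<bar> * norm x"
  if "m > 0" "s \<ge> m" "t \<ge> m"
proof -
  have "norm (T t x - T s x) \<le> (C / m * norm x) * \<bar>t - s\<bar>"
  proof (rule vector_derivative_norm_bound[where S = "{m..}" and f' = "\<lambda>s. - E s x"])
    fix r assume r: "r \<in> {m..}"
    then have "C / r \<le> C / m" using that C_pos by (auto intro!: divide_left_mono)
    then have "C / r * norm x \<le> C / m * norm x" by (rule mult_right_mono) simp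
    then show "norm (- E r x) \<le> C / m * norm x" using E_bound[of r x] r that by auto
  qed (use that T_deriv in auto)
  then show ?thesis by (simp add: mult_ac)
qed

lemma E_lipschitz: "norm (E t x - E s x) \<le> (2 * C / m)\<^sup>2 * norm x * \<bar>t - s\<bar>"
  if "m > 0" "s \<ge> m" "t \<ge> m"
proof (rule vector_derivative_norm_bound[where S = "{m..}" and f' = "\<lambda>s. - E (s/2) (E (s/2) x)"])
  fix r assume r: "r \<in> {m..}"
  have le: "C / (r/2) \<le> 2 * C / m" using frac_le[of "2 * C" "2 * C" m r] that C_pos r by (simp add: mult.commute)
  have p: "C / (r/2) \<ge> 0" using that C_pos r by auto
  have "norm (E (r/2) (E (r/2) x)) \<le> C / (r/2) * norm (E (r/2) x)"
    using E_bound[of "r/2"] r that by auto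
  also have "\<dots> \<le> C / (r/2) * (C / (r/2) * norm x)"
    by (rule mult_left_mono[OF _ p]) (use E_bound[of "r/2"] r that in auto)
  also have "\<dots> = (C / (r/2))\<^sup>2 * norm x" by (simp add: power2_eq_square)
  also have "\<dots> \<le> (2 * C / m)\<^sup>2 * norm x" by (intro mult_right_mono power_mono le p) simp
  finally show "norm (- E (r/2) (E (r/2) x)) \<le> (2 * C / m)\<^sup>2 * norm x" by simp
qed (use that E_deriv in auto)

text \<open>The mean value inequality for r |-> T(r) x + r E(s) x, whose derivative is controlled by
  \<open>E_lipschitz\<close>. The usual factor 1/2 is given up.\<close>

lemma T_taylor: "norm (T t x - T s x + (t - s) *\<^sub>R E s x) \<le> (2 * C / m)\<^sup>2 * norm x * (t - s)\<^sup>2"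
  if "m > 0" "s \<ge> m" "t \<ge> m"
proof -
  let ?f = "\<lambda>r. T r x + r *\<^sub>R E s x"
  let ?S = "{min s t..max s t}"
  have "norm (?f t - ?f s) \<le> ((2 * C / m)\<^sup>2 * norm x * \<bar>t - s\<bar>) * \<bar>t - s\<bar>"
  proof (rule vector_derivative_norm_bound[where S = ?S and f' = "\<lambda>r. - E r x + E s x"])
    fix r assume r: "r \<in> ?S"
    show "(?f has_vector_derivative - E r x + E s x) (at r)"
      by (intro derivative_intros T_deriv bounded_linear.has_vector_derivative[OF bounded_linear_scaleR_left, of _ 1, simplified])
         (use r that in \<open>auto simp: has_vector_derivative_def intro!: derivative_eq_intros\<close>)
    have "norm (- E r x + E s x) = norm (E r x - E s x)" by (simp add: norm_minus_commute)
    also have "\<dots> \<le> (2 * C / m)\<^sup>2 * norm x * \<bar>r - s\<bar>"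
      by (rule E_lipschitz) (use r that in auto)
    also have "\<dots> \<le> (2 * C / m)\<^sup>2 * norm x * \<bar>t - s\<bar>"
      using r by (intro mult_left_mono) auto
    finally show "norm (- E r x + E s x) \<le> (2 * C / m)\<^sup>2 * norm x * \<bar>t - s\<bar>" .
  qed auto
  moreover have "?f t - ?f s = T t x - T s x + (t - s) *\<^sub>R E s x" by (simp add: algebra_simps)
  moreover have "((2 * C / m)\<^sup>2 * norm x * \<bar>t - s\<bar>) * \<bar>t - s\<bar> = (2 * C / m)\<^sup>2 * norm x * (t - s)\<^sup>2"
    by (simp add: power2_eq_square mult.assoc)
  ultimately show ?thesis by metis
qed

end

section \<open>Fractional powers\<close>

context decaying_analytic
begin

text \<open>Interpolation between the Lipschitz bound C h / x, used for h \<le> x, and the trivial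
  bound 2 C, used for h > x.\<close>

lemma T_hoelder:
  assumes "x > 0" "h \<ge> 0" "0 \<le> \<gamma>" "\<gamma> \<le> 1"
  shows "norm (T (x + h) y - T x y) \<le> 2 * C * (h / x) powr \<gamma> * norm y"
proof (cases "h \<le> x")
  case True
  have "norm (T (x + h) y - T x y) \<le> C / x * \<bar>x + h - x\<bar> * norm y"
    by (rule T_lipschitz) (use assms in auto)
  also have "\<dots> = C * (h / x) * norm y" using assms by simp
  also have "\<dots> \<le> 2 * C * (h / x) powr \<gamma> * norm y"
  proof (intro mult_right_mono mult_mono)
    show "h / x \<le> (h / x) powr \<gamma>"
      using powr_mono'[of \<gamma> 1 "h / x"] assms True by (cases "h = 0") auto
  qed (use assms C_pos in auto)
  finally show ?thesis .
next
  case False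
  have "norm (T (x + h) y - T x y) \<le> norm (T (x + h) y) + norm (T x y)" by (rule norm_triangle_ineq4)
  also have "\<dots> \<le> C * norm y + C * norm y" using assms by (intro add_mono T_bound) auto
  also have "\<dots> = 2 * C * 1 * norm y" by simp
  also have "\<dots> \<le> 2 * C * (h / x) powr \<gamma> * norm y"
    using assms False C_pos by (intro mult_right_mono mult_left_mono ge_one_powr_ge_zero) auto
  finally show ?thesis .
qed

lemma neg_frac_power_dominated:
  assumes "0 < a" "a \<le> 1"
  shows "powr_dominated (a - 1) (-2) (C * norm x) (\<lambda>t. t powr (a - 1) *\<^sub>R T t x)"
  unfolding powr_dominated_def
proof (intro conjI ballI allI impI)
  show "continuous_on {0<..} (\<lambda>t. t powr (a - 1) *\<^sub>R T t x)"
    by (intro continuous_intros continuous_on_subset[OF T_continuous_on]) auto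
  fix t :: real
  {
    assume "t \<in> {0<..1}"
    then show "norm (t powr (a - 1) *\<^sub>R T t x) \<le> C * norm x * t powr (a - 1)"
      using mult_left_mono[OF T_bound[of t x], of "t powr (a-1)"] by (simp add: mult_ac)
  next
    assume t: "t \<ge> 1"
    have "t powr (a - 1) \<le> 1" using powr_mono2'[of "a - 1" 1 t] t assms by simp
    then have "t powr (a - 1) * norm (T t x) \<le> 1 * (C / t\<^sup>2 * norm x)"
      using T_decay[of t x] t by (intro mult_mono) auto
    moreover have "t powr -2 = 1 / t\<^sup>2" using t by (simp add: powr_minus_divide)
    ultimately show "norm (t powr (a - 1) *\<^sub>R T t x) \<le> C * norm x * t powr -2" by simp
  }
qed (use assms in auto)

lemma neg_frac_power_bounded_linear:
  assumes "0 \<le> a" "a \<le> 1"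
  shows "bounded_linear (neg_frac_power T a)"
proof (cases "a = 0")
  case True
  then show ?thesis by (simp add: neg_frac_power_def[abs_def] bounded_linear_ident)
next
  case False
  then have a: "0 < a" "a \<le> 1" using assms by auto
  let ?f = "\<lambda>x t. t powr (a - 1) *\<^sub>R T t x"
  have int: "?f x integrable_on {0<..}" for x
    by (rule powr_dominated_integrable[OF neg_frac_power_dominated[OF a]])
  have "bounded_linear (\<lambda>x. integral {0<..} (?f x))"
  proof (rule bounded_linear_intro)
    fix x y :: 'a and r :: real
    have "integral {0<..} (?f (x + y)) = integral {0<..} (\<lambda>t. ?f x t + ?f y t)"
      by (rule integral_cong) (simp add: linear_simps(1)[OF T_bounded_linear] scaleR_add_right)
    then show "integral {0<..} (?f (x + y)) = integral {0<..} (?f x) + integral {0<..} (?f y)"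
      by (simp add: integral_add int)
    have "integral {0<..} (?f (r *\<^sub>R x)) = integral {0<..} (\<lambda>t. r *\<^sub>R ?f x t)"
      by (rule integral_cong) (simp add: linear_simps(5)[OF T_bounded_linear] mult.commute)
    then show "integral {0<..} (?f (r *\<^sub>R x)) = r *\<^sub>R integral {0<..} (?f x)" by (simp only: integral_cmul)
    show "norm (integral {0<..} (?f x)) \<le> norm x * (C * (1 / (a-1+1) + 1 / (-(-2)-1)))"
      using powr_dominated_norm_integral[OF neg_frac_power_dominated[OF a, of x]] by (simp add: mult_ac)
  qed
  from bounded_linear_compose[OF bounded_linear_scaleR_right this]
  show ?thesis using False by (simp add: neg_frac_power_def[abs_def])
qed

section \<open>The operators A^a T(r) for 0 < a < 1\<close>

context
  fixes a :: real
  assumes a: "0 < a" "a < 1"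
begin

text \<open>This is Gamma(1 - a) A^a T(r): formally A^a = A A^-(1-a), and A^-(1-a) is the integral
  of s^-a T(s) divided by Gamma(1 - a). The factor T(r) moves the singularity of \<open>E\<close>
  away from s = 0.\<close>

definition smoothed_frac :: "real \<Rightarrow> 'a \<Rightarrow> 'a" where
  "smoothed_frac r y = integral {0<..} (\<lambda>s. s powr (-a) *\<^sub>R E (r + s) y)"

lemma weight_le:
  assumes "t > 0"
  shows "t powr (-a) / (1 + t) \<le> t powr (-a)" and "t powr (-a) / (1 + t) \<le> t powr (-1-a)"
proof -
  show "t powr (-a) / (1 + t) \<le> t powr (-a)" using assms by (simp add: divide_le_eq)
  have "t powr (-a) / (1 + t) \<le> t powr (-a) / t" using assms by (intro divide_left_mono) auto
  also have "\<dots> = t powr (-a - 1)" using assms powr_diff[of t "-a" 1] by simp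
  also have "-a - 1 = -1 - a" by simp
  finally show "t powr (-a) / (1 + t) \<le> t powr (-1-a)" .
qed

text \<open>The weight t^-a / (1 + t) is what s^-a / (r + s) becomes under s = r t. It behaves like
  t^-a at 0 and t^(-1-a) at infinity, both integrable exactly for 0 < a < 1.\<close>

lemma weight_dominated:
  fixes f :: "real \<Rightarrow> 'a"
  assumes "continuous_on {0<..} f"
    and bd: "\<And>t. t > 0 \<Longrightarrow> norm (f t) \<le> M * (t powr (-a) / (1 + t))"
  shows "powr_dominated (-a) (-1-a) M f"
  unfolding powr_dominated_def
proof (intro conjI ballI allI impI)
  have M: "M \<ge> 0" using order_trans[OF norm_ge_zero bd[of 1]] by (simp add: zero_le_mult_iff)
  fix t :: real
  show "norm (f t) \<le> M * t powr (-a)" if "t \<in> {0<..1}"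
    using order_trans[OF bd mult_left_mono[OF weight_le(1) M]] that by auto
  show "norm (f t) \<le> M * t powr (-1-a)" if "t \<ge> 1"
    using order_trans[OF bd mult_left_mono[OF weight_le(2) M]] that by auto
qed (use assms a in auto)

text \<open>Crude in r, since it only secures convergence; the sharp power r^-a comes from rescaling
  in \<open>smoothed_frac_bound\<close>.\<close>

lemma smoothed_frac_dominated:
  assumes r: "r > 0"
  shows "powr_dominated (-a) (-1-a) (C * (1 + 1/r) * norm y) (\<lambda>s. s powr (-a) *\<^sub>R E (r + s) y)"
proof (rule weight_dominated)
  show "continuous_on {0<..} (\<lambda>s. s powr (-a) *\<^sub>R E (r + s) y)"
    by (intro continuous_intros continuous_on_compose2[OF E_continuous_on]) (use r in auto)
  fix t :: real assume t: "t > 0"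
  have "1 + t \<le> (1 + 1/r) * (r + t)" using r t by (simp add: field_simps)
  then have "1 / (r + t) \<le> (1 + 1/r) / (1 + t)" using r t by (simp add: divide_le_eq pos_le_divide_eq)
  then have "C / (r + t) * norm y \<le> C * ((1 + 1/r) / (1 + t)) * norm y"
    using C_pos by (intro mult_right_mono) (auto simp: divide_inverse intro!: mult_left_mono)
  then have "norm (E (r + t) y) \<le> C * ((1 + 1/r) / (1 + t)) * norm y"
    using E_bound[of "r + t" y] r t by simp
  then have "t powr (-a) * norm (E (r + t) y) \<le> t powr (-a) * (C * ((1 + 1/r) / (1 + t)) * norm y)"
    by (rule mult_left_mono) simp
  then show "norm (t powr (-a) *\<^sub>R E (r + t) y) \<le> C * (1 + 1/r) * norm y * (t powr (-a) / (1 + t))"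
    by (simp add: mult_ac)
qed

text \<open>After the substitution s = r \<theta> the bound on \<open>E\<close> contributes C/r
  times the fixed weight, and the Jacobian with the power contributes r^(1-a); together
  r^-a.\<close>

lemma smoothed_frac_bound: "norm (smoothed_frac r y) \<le> C * (1/(1-a) + 1/a) * r powr (-a) * norm y"
  and smoothed_frac_scaled_shift: "R > 0 \<Longrightarrow> smoothed_frac (r + R) y = R powr (1 - a) *\<^sub>R
      integral {0<..} (\<lambda>\<theta>. \<theta> powr (-a) *\<^sub>R E (r + R * (1 + \<theta>)) y)"
  if r: "r > 0"
proof -
  \<comment> \<open>Here r is a fresh variable that may be 0: base 0 with R the actual radius yields
    the norm bound, a positive base yields the shifted formula.\<close>
  have scale: "smoothed_frac (r + R) y = R powr (1 - a) *\<^sub>R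
      integral {0<..} (\<lambda>\<theta>. \<theta> powr (-a) *\<^sub>R E (r + R * (1 + \<theta>)) y)"
    if "R > 0" "r \<ge> 0" for r R
  proof -
    have "smoothed_frac (r + R) y = R *\<^sub>R integral {0<..} (\<lambda>\<theta>. (R * \<theta>) powr (-a) *\<^sub>R E (r + R + R * \<theta>) y)"
      unfolding smoothed_frac_def by (rule powr_dominated_integral_scale[OF smoothed_frac_dominated]) (use that in auto)
    also have "\<dots> = R *\<^sub>R integral {0<..} (\<lambda>\<theta>. R powr (-a) *\<^sub>R (\<theta> powr (-a) *\<^sub>R E (r + R * (1 + \<theta>)) y))"
      by (intro arg_cong[of _ _ "scaleR R"] integral_cong) (use that in \<open>simp add: powr_mult algebra_simps\<close>)
    also have "\<dots> = (R * R powr (-a)) *\<^sub>R integral {0<..} (\<lambda>\<theta>. \<theta> powr (-a) *\<^sub>R E (r + R * (1 + \<theta>)) y)"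
      by (subst integral_cmul) simp
    also have "R * R powr (-a) = R powr (1 - a)" using that powr_add[of R 1 "-a"] by simp
    finally show ?thesis .
  qed
  show "R > 0 \<Longrightarrow> smoothed_frac (r + R) y = R powr (1 - a) *\<^sub>R
      integral {0<..} (\<lambda>\<theta>. \<theta> powr (-a) *\<^sub>R E (r + R * (1 + \<theta>)) y)"
    using scale[of R r] r by simp
  have sc: "smoothed_frac r y = r powr (1 - a) *\<^sub>R integral {0<..} (\<lambda>\<theta>. \<theta> powr (-a) *\<^sub>R E (r * (1 + \<theta>)) y)"
    using scale[of r 0] r by simp
  have "powr_dominated (-a) (-1-a) (C / r * norm y) (\<lambda>\<theta>. \<theta> powr (-a) *\<^sub>R E (r * (1 + \<theta>)) y)"
  proof (rule weight_dominated)
    show "continuous_on {0<..} (\<lambda>\<theta>. \<theta> powr (-a) *\<^sub>R E (r * (1 + \<theta>)) y)"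
      by (intro continuous_intros continuous_on_compose2[OF E_continuous_on]) (use r in auto)
    fix t :: real assume t: "t > 0"
    then have "norm (E (r * (1 + t)) y) \<le> C / (r * (1 + t)) * norm y" using r by (intro E_bound) auto
    from mult_left_mono[OF this, of "t powr (-a)"]
    show "norm (t powr (-a) *\<^sub>R E (r * (1 + t)) y) \<le> C / r * norm y * (t powr (-a) / (1 + t))"
      by (simp add: mult_ac)
  qed
  from powr_dominated_norm_integral[OF this]
  have "r powr (1 - a) * norm (integral {0<..} (\<lambda>\<theta>. \<theta> powr (-a) *\<^sub>R E (r * (1 + \<theta>)) y)) \<le>
      r powr (1 - a) * (C / r * norm y * (1 / (- a + 1) + 1 / (- (- 1 - a) - 1)))"
    by (rule mult_left_mono) simp
  also have "\<dots> = (r powr (1 - a) / r) * (C * norm y * (1 / (1 - a) + 1 / a))"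
    by (simp add: mult_ac)
  also have "r powr (1 - a) / r = r powr (-a)" using powr_diff[of r "1-a" 1] r by simp
  finally show "norm (smoothed_frac r y) \<le> C * (1/(1-a) + 1/a) * r powr (-a) * norm y"
    unfolding sc by (simp add: mult_ac)
qed

lemma smoothed_frac_bounded_linear: "bounded_linear (smoothed_frac r)" if r: "r > 0"
proof (rule bounded_linear_intro)
  let ?f = "\<lambda>y s. s powr (-a) *\<^sub>R E (r + s) y"
  have int: "?f y integrable_on {0<..}" for y
    by (rule powr_dominated_integrable[OF smoothed_frac_dominated[OF r]])
  fix x y :: 'a and c :: real
  have "smoothed_frac r (x + y) = integral {0<..} (\<lambda>t. ?f x t + ?f y t)"
    unfolding smoothed_frac_def by (rule integral_cong) (use r in \<open>simp add: linear_simps(1)[OF E_bounded_linear] scaleR_add_right\<close>)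
  then show "smoothed_frac r (x + y) = smoothed_frac r x + smoothed_frac r y" by (simp add: integral_add int smoothed_frac_def)
  have "smoothed_frac r (c *\<^sub>R x) = integral {0<..} (\<lambda>t. c *\<^sub>R ?f x t)"
    unfolding smoothed_frac_def by (rule integral_cong) (use r in \<open>simp add: linear_simps(5)[OF E_bounded_linear] mult.commute\<close>)
  then show "smoothed_frac r (c *\<^sub>R x) = c *\<^sub>R smoothed_frac r x" by (simp only: integral_cmul smoothed_frac_def)
  show "norm (smoothed_frac r x) \<le> norm x * (C * (1/(1-a) + 1/a) * r powr (-a))"
    using smoothed_frac_bound[OF r, of x] by (simp add: mult_ac)
qed

lemma smoothed_frac_T: "smoothed_frac r (T s y) = smoothed_frac (r + s) y" if "r > 0" "s \<ge> 0"
  unfolding smoothed_frac_def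
proof (rule integral_cong)
  fix \<sigma> :: real assume "\<sigma> \<in> {0<..}"
  then have "E (r + \<sigma>) (T s y) = E (r + s + \<sigma>) y" using E_T[of "r + \<sigma>" s y] that by (simp add: add_ac)
  then show "\<sigma> powr (-a) *\<^sub>R E (r + \<sigma>) (T s y) = \<sigma> powr (-a) *\<^sub>R E (r + s + \<sigma>) y" by simp
qed

text \<open>The Beta integral pi / sin(pi a) = Gamma(a) Gamma(1 - a). It serves as a normalising
  factor, for which positivity suffices.\<close>

definition weight_mass :: real where "weight_mass = integral {0<..} (\<lambda>\<theta>. \<theta> powr (-a) / (1 + \<theta>))"

lemma weight_integrable: "(\<lambda>\<theta>. \<theta> powr (-a) / (1 + \<theta>)) integrable_on {0<..}"
proof (rule powr_dominated_integrable)
  show "powr_dominated (-a) (-1-a) 1 (\<lambda>\<theta>. \<theta> powr (-a) / (1 + \<theta>))"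
    unfolding powr_dominated_def using a weight_le
    by (auto intro!: continuous_intros)
qed

lemma weight_mass_pos: "weight_mass > 0"
proof -
  let ?g = "\<lambda>\<theta>::real. \<theta> powr (-a) / (1 + \<theta>)"
  have "integral {1..2::real} (\<lambda>_. 2 powr (-a) / 3) \<le> integral {1..2} ?g"
  proof (rule integral_le)
    show "?g integrable_on {1..2}"
      by (intro integrable_continuous_interval continuous_intros) auto
    fix x :: real assume x: "x \<in> {1..2}"
    then have "2 powr (-a) \<le> x powr (-a)" using a by (intro powr_mono2') auto
    then show "2 powr (-a) / 3 \<le> x powr (-a) / (1 + x)" using x by (intro frac_le) auto
  qed auto
  also have "\<dots> \<le> weight_mass" unfolding weight_mass_def
    by (rule integral_subset_le[OF _ _ weight_integrable])
       (auto intro!: integrable_continuous_interval continuous_intros)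
  finally have "2 powr (-a) / 3 \<le> weight_mass" by simp
  moreover have "0 < (2::real) powr (-a) / 3" by simp
  ultimately show ?thesis by linarith
qed

text \<open>With \<open>J(R)\<close> the integral below, \<open>J'(R) = - R\<^sup>a\<^sup>-\<^sup>1 A\<^sup>a T(r + R) p\<close> up to a constant factor, so that
  integrating over \<open>R\<close> evaluates \<open>A\<^sup>a T(r) A\<^sup>-\<^sup>a p\<close> without Fubini's theorem for improper vector
  integrals.\<close>

definition weighted_orbit :: "real \<Rightarrow> 'a \<Rightarrow> real \<Rightarrow> 'a" where
  "weighted_orbit r p R = integral {0<..} (\<lambda>\<theta>. (\<theta> powr (-a) / (1 + \<theta>)) *\<^sub>R T (r + R * (1 + \<theta>)) p)"

lemma weighted_orbit_dominated:
  assumes "r > 0" "R \<ge> 0" and M: "\<And>\<theta>. \<theta> > 0 \<Longrightarrow> norm (T (r + R * (1 + \<theta>)) p) \<le> M"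
  shows "powr_dominated (-a) (-1-a) M (\<lambda>\<theta>. (\<theta> powr (-a) / (1 + \<theta>)) *\<^sub>R T (r + R * (1 + \<theta>)) p)"
proof (rule weight_dominated)
  show "continuous_on {0<..} (\<lambda>\<theta>. (\<theta> powr (-a) / (1 + \<theta>)) *\<^sub>R T (r + R * (1 + \<theta>)) p)"
    by (intro continuous_intros continuous_on_compose2[OF T_continuous_on]) (use assms in auto)
  fix t :: real assume "t > 0"
  from mult_left_mono[OF M[OF this], of "t powr (-a) / (1 + t)"] this
  show "norm ((t powr (-a) / (1 + t)) *\<^sub>R T (r + R * (1 + t)) p) \<le> M * (t powr (-a) / (1 + t))"
    by (simp add: mult_ac)
qed

lemma weighted_orbit_integrable:
  assumes "r > 0" "R \<ge> 0"
  shows "(\<lambda>\<theta>. (\<theta> powr (-a) / (1 + \<theta>)) *\<^sub>R T (r + R * (1 + \<theta>)) p) integrable_on {0<..}"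
  by (rule powr_dominated_integrable[OF weighted_orbit_dominated[OF assms, where M = "C * norm p"]])
     (use assms in \<open>auto intro!: T_bound\<close>)

lemma weighted_orbit_0: "weighted_orbit r p 0 = weight_mass *\<^sub>R T r p"
proof -
  have "((\<lambda>\<theta>. (\<theta> powr (-a) / (1 + \<theta>)) *\<^sub>R T r p) has_integral weight_mass *\<^sub>R T r p) {0<..}"
    unfolding weight_mass_def by (intro has_integral_scaleR_left integrable_integral weight_integrable)
  then show ?thesis by (simp add: weighted_orbit_def integral_unique)
qed

text \<open>The inner derivative of r + R (1 + \<theta>) is 1 + \<theta>, which cancels the
  denominator of the weight and leaves the integrand of \<open>smoothed_frac\<close>. Rescaling back
  by R produces the power R^(a-1).\<close>

lemma weighted_orbit_deriv:
  assumes r: "r > 0" and R: "R > 0"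
  shows "(weighted_orbit r p has_vector_derivative - (R powr (a - 1) *\<^sub>R smoothed_frac (r + R) p)) (at R)"
proof (rule has_vector_derivative_quadratic)
  let ?w = "\<lambda>\<theta>. \<theta> powr (-a) / (1 + \<theta>)"
  let ?D = "integral {0<..} (\<lambda>\<theta>. \<theta> powr (-a) *\<^sub>R E (r + R * (1 + \<theta>)) p)"
  let ?c = "1 / (1-a) + 1 / a"
  let ?M = "(2 * C / (R/2))\<^sup>2 * norm p"
  show "R / 2 > 0" using R by simp
  fix h :: real assume h: "\<bar>h\<bar> < R / 2"
  have D: "R powr (a - 1) *\<^sub>R smoothed_frac (r + R) p = ?D"
    using R by (simp add: smoothed_frac_scaled_shift[OF r R] flip: powr_add)
  have intD: "(\<lambda>\<theta>. \<theta> powr (-a) *\<^sub>R E (r + R * (1 + \<theta>)) p) integrable_on {0<..}"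
  proof (rule powr_dominated_integrable, rule weight_dominated)
    show "continuous_on {0<..} (\<lambda>\<theta>. \<theta> powr (-a) *\<^sub>R E (r + R * (1 + \<theta>)) p)"
      by (intro continuous_intros continuous_on_compose2[OF E_continuous_on])
         (use r R in \<open>auto intro!: add_pos_pos mult_pos_pos\<close>)
    fix t :: real assume t: "t > 0"
    have "norm (E (r + R * (1 + t)) p) \<le> C / (r + R * (1 + t)) * norm p"
      using r R t by (intro E_bound) (auto intro!: add_pos_pos)
    also have "\<dots> \<le> C / (R * (1 + t)) * norm p"
      using r R t C_pos by (intro mult_right_mono divide_left_mono mult_pos_pos add_pos_pos) auto
    finally show "norm (t powr (-a) *\<^sub>R E (r + R * (1 + t)) p) \<le> (C / R * norm p) * (t powr (-a) / (1 + t))"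
      using mult_left_mono[of "norm (E (r + R * (1 + t)) p)" "C / (R * (1 + t)) * norm p" "t powr (-a)"]
      by (simp add: mult_ac)
  qed
  let ?f = "\<lambda>\<theta>. ?w \<theta> *\<^sub>R T (r + (R + h) * (1 + \<theta>)) p - ?w \<theta> *\<^sub>R T (r + R * (1 + \<theta>)) p
     + h *\<^sub>R (\<theta> powr (-a) *\<^sub>R E (r + R * (1 + \<theta>)) p)"
  have eq: "weighted_orbit r p (R + h) - weighted_orbit r p R - h *\<^sub>R - ?D = integral {0<..} ?f"
  proof -
    have "(?f has_integral (weighted_orbit r p (R + h) - weighted_orbit r p R + h *\<^sub>R ?D)) {0<..}"
      unfolding weighted_orbit_def
      by (rule has_integral_add[OF has_integral_diff[OF integrable_integral[OF weighted_orbit_integrable]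
            integrable_integral[OF weighted_orbit_integrable]] has_integral_cmul[OF integrable_integral[OF intD]]])
         (use h r R in auto)
    from integral_unique[OF this] show ?thesis by simp
  qed
  have pos: "0 < r + R * (1 + t)" "0 < r + (R + h) * (1 + t)" if "t > 0" for t
  proof -
    have "0 < R * (1 + t)" "0 < (R + h) * (1 + t)" using R h that by (intro mult_pos_pos; linarith)+
    then show "0 < r + R * (1 + t)" "0 < r + (R + h) * (1 + t)" using r by linarith+
  qed
  have "powr_dominated (-a) (-1-a) (?M * h\<^sup>2) ?f"
  proof (rule weight_dominated)
    show "continuous_on {0<..} ?f"
      by (intro continuous_intros continuous_on_compose2[OF E_continuous_on] continuous_on_compose2[OF T_continuous_on])
         (use pos pos[THEN less_imp_le] in auto)
    fix t :: real assume t: "t > 0"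
    let ?\<rho> = "r + R * (1 + t)" and ?\<rho>' = "r + (R + h) * (1 + t)"
    have "R/2 * (1 + t) \<le> R * (1 + t)" "R/2 * (1 + t) \<le> (R + h) * (1 + t)"
      using R h t by (auto intro!: mult_right_mono)
    then have "R/2 * (1 + t) \<le> ?\<rho>" "R/2 * (1 + t) \<le> ?\<rho>'" using r by linarith+
    then have "norm (T ?\<rho>' p - T ?\<rho> p + (?\<rho>' - ?\<rho>) *\<^sub>R E ?\<rho> p)
        \<le> (2 * C / (R/2 * (1 + t)))\<^sup>2 * norm p * (?\<rho>' - ?\<rho>)\<^sup>2"
      using R r t by (intro T_taylor) auto
    \<comment> \<open>For |h| < R/2 both times are at least (R/2)(1 + t), and they differ by h (1 +
      t). The factors (1 + t)^2 cancel, so the remainder is uniform in t.\<close>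
    also have "\<dots> = ?M * h\<^sup>2"
    proof -
      have "?\<rho>' - ?\<rho> = h * (1 + t)" by (simp add: algebra_simps)
      then show ?thesis using R t by (simp add: power_mult_distrib power_divide)
    qed
    finally have le: "norm (T ?\<rho>' p - T ?\<rho> p + (?\<rho>' - ?\<rho>) *\<^sub>R E ?\<rho> p) \<le> ?M * h\<^sup>2" .
    have "?f t = ?w t *\<^sub>R (T ?\<rho>' p - T ?\<rho> p + (?\<rho>' - ?\<rho>) *\<^sub>R E ?\<rho> p)"
    proof -
      have "?w t * (?\<rho>' - ?\<rho>) = h * t powr (-a)" using t by (simp add: field_simps)
      then show ?thesis by (simp add: scaleR_add_right scaleR_diff_right)
    qed
    then have "norm (?f t) = ?w t * norm (T ?\<rho>' p - T ?\<rho> p + (?\<rho>' - ?\<rho>) *\<^sub>R E ?\<rho> p)"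
      using t by simp
    also have "\<dots> \<le> ?w t * (?M * h\<^sup>2)" using t by (intro mult_left_mono le) auto
    finally show "norm (?f t) \<le> ?M * h\<^sup>2 * ?w t" by (simp add: mult_ac)
  qed
  from powr_dominated_norm_integral[OF this]
  show "norm (weighted_orbit r p (R + h) - weighted_orbit r p R - h *\<^sub>R - (R powr (a - 1) *\<^sub>R smoothed_frac (r + R) p)) \<le> (?M * ?c) * h\<^sup>2"
    unfolding D eq by (simp add: mult_ac)
qed

lemma weighted_orbit_at_top: "(weighted_orbit r p \<longlongrightarrow> 0) at_top" if r: "r > 0"
proof (rule Lim_null_comparison)
  let ?c = "1 / (1-a) + 1 / a"
  have "norm (weighted_orbit r p R) \<le> C * norm p * ?c * (1 / R)" if R: "R \<ge> 1" for R
  proof -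
    have "powr_dominated (-a) (-1-a) (C * norm p * (1 / R)) (\<lambda>\<theta>. (\<theta> powr (-a) / (1 + \<theta>)) *\<^sub>R T (r + R * (1 + \<theta>)) p)"
    proof (rule weighted_orbit_dominated[OF r])
      fix t :: real assume t: "t > 0"
      have Rt: "R \<le> r + R * (1 + t)" using r R t by (simp add: algebra_simps)
      then have "R * 1 \<le> (r + R * (1 + t)) * (r + R * (1 + t))" using R by (intro mult_mono) auto
      then have "C / (r + R * (1 + t))\<^sup>2 \<le> C / R"
        using R C_pos Rt by (intro divide_left_mono) (auto simp: power2_eq_square intro!: mult_pos_pos)
      then have "C / (r + R * (1 + t))\<^sup>2 * norm p \<le> C / R * norm p" by (rule mult_right_mono) simp
      then show "norm (T (r + R * (1 + t)) p) \<le> C * norm p * (1 / R)"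
        using T_decay[of "r + R * (1 + t)" p] Rt R by (simp add: mult_ac)
    qed (use R in auto)
    from powr_dominated_norm_integral[OF this] show ?thesis by (simp add: weighted_orbit_def mult_ac)
  qed
  then show "\<forall>\<^sub>F R in at_top. norm (weighted_orbit r p R) \<le> C * norm p * ?c * (1 / R)"
    by (auto intro: eventually_mono[OF eventually_ge_at_top[of 1]])
  have "((\<lambda>R::real. 1 / R) \<longlongrightarrow> 0) at_top"
    using tendsto_inverse_0_at_top[OF filterlim_ident] by (simp add: inverse_eq_divide)
  then show "((\<lambda>R. C * norm p * ?c * (1 / R)) \<longlongrightarrow> 0) at_top"
    by (rule tendsto_mult_right_zero)
qed

text \<open>The time shift R (1 + \<theta>) is unbounded in \<theta>, so convergence is not read off
  pointwise. A Hoelder bound of order a/2 gives a rate R^(a/2) and costs (1 + \<theta>)^(a/2); the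
  decay exponent -1-a becomes -1-a/2, still integrable.\<close>

lemma weighted_orbit_at_0: "(weighted_orbit r p \<longlongrightarrow> weighted_orbit r p 0) (at_right 0)" if r: "r > 0"
proof -
  let ?w = "\<lambda>\<theta>. \<theta> powr (-a) / (1 + \<theta>)"
  let ?c = "1 / (1-a) + 1 / (a/2)"
  let ?M = "2 * C / r powr (a/2) * norm p"
  have "norm (weighted_orbit r p R - weighted_orbit r p 0) \<le> ?M * ?c * R powr (a/2)" if R: "R > 0" for R
  proof -
    let ?f = "\<lambda>\<theta>. ?w \<theta> *\<^sub>R T (r + R * (1 + \<theta>)) p - ?w \<theta> *\<^sub>R T (r + 0 * (1 + \<theta>)) p"
    have eq: "weighted_orbit r p R - weighted_orbit r p 0 = integral {0<..} ?f"
      unfolding weighted_orbit_def by (rule integral_diff[symmetric]) (use r R in \<open>auto intro!: weighted_orbit_integrable[of r R] weighted_orbit_integrable[of r 0, simplified]\<close>)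
    have n: "norm (?f t) \<le> ?M * R powr (a/2) * ((1 + t) powr (a/2) * ?w t)" if t: "t > 0" for t
    proof -
      let ?x = "R * (1 + t)"
      have x: "?x > 0" using R t by auto
      have "norm (T (r + ?x) p - T r p) \<le> ?M * ?x powr (a/2)"
        using T_hoelder[of r ?x "a/2" p] r x a by (simp add: powr_divide mult_ac)
      then have "?w t * norm (T (r + ?x) p - T r p) \<le> ?w t * (?M * ?x powr (a/2))"
        using t by (intro mult_left_mono) auto
      moreover have "norm (?f t) = ?w t * norm (T (r + ?x) p - T r p)"
        using t by (simp flip: scaleR_diff_right)
      moreover have "?x powr (a/2) = R powr (a/2) * (1 + t) powr (a/2)" using R t by (simp add: powr_mult)
      ultimately show ?thesis by (simp add: mult_ac)
    qed
    have "powr_dominated (-a) (-1-a/2) (?M * R powr (a/2)) ?f"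
      unfolding powr_dominated_def
    proof (intro conjI ballI allI impI)
      show "continuous_on {0<..} ?f"
        by (intro continuous_intros continuous_on_compose2[OF T_continuous_on])
           (use r R in \<open>auto intro!: add_nonneg_nonneg mult_nonneg_nonneg\<close>)
      have M: "?M * R powr (a/2) \<ge> 0" using C_pos r by auto
      have e: "(1 + t) powr (a/2) * ?w t = t powr (-a) * (1 + t) powr (a/2 - 1)" if "t > 0" for t
        using that by (simp add: powr_diff)
      fix t :: real
      {
        assume t: "t \<in> {0<..1}"
        have "(1 + t) powr (a/2 - 1) \<le> 1" using powr_mono2'[of "a/2 - 1" 1 "1 + t"] t a by simp
        then have "t powr (-a) * (1 + t) powr (a/2 - 1) \<le> t powr (-a)" by (simp add: mult_left_le)
        then show "norm (?f t) \<le> ?M * R powr (a/2) * t powr (-a)"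
          using n[of t] mult_left_mono[OF _ M] e[of t] t by (smt (verit) greaterThanAtMost_iff)
      next
        assume t: "t \<ge> 1"
        have "(1 + t) powr (a/2 - 1) \<le> t powr (a/2 - 1)" using t a by (intro powr_mono2') auto
        then have "t powr (-a) * (1 + t) powr (a/2 - 1) \<le> t powr (-a) * t powr (a/2 - 1)"
          by (rule mult_left_mono) simp
        also have "\<dots> = t powr (-a + (a/2 - 1))" by (simp only: powr_add)
        also have "-a + (a/2 - 1) = -1 - a/2" by simp
        finally show "norm (?f t) \<le> ?M * R powr (a/2) * t powr (-1-a/2)"
          using n[of t] mult_left_mono[OF _ M] e[of t] t by (smt (verit))
      }
    qed (use a in auto)
    moreover have "1 / (-a + 1) + 1 / (-(-1-a/2) - 1) = ?c" by simp
    ultimately show ?thesis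
      using powr_dominated_norm_integral[of "-a" "-1-a/2" "?M * R powr (a/2)" ?f]
      unfolding eq by (simp only: mult_ac)
  qed
  then have "\<forall>\<^sub>F R in at_right 0. norm (weighted_orbit r p R - weighted_orbit r p 0) \<le> ?M * ?c * R powr (a/2)"
    by (auto simp: eventually_at_right_field intro!: exI[of _ 1])
  moreover have "((\<lambda>R. ?M * ?c * R powr (a/2)) \<longlongrightarrow> 0) (at_right 0)"
  proof (rule tendsto_mult_right_zero)
    have "((\<lambda>R. R powr (a/2)) \<longlongrightarrow> 0 powr (a/2)) (at_right 0)"
      using a by (intro tendsto_intros) (auto simp: eventually_at_right_field intro!: exI[of _ 1])
    then show "((\<lambda>R. R powr (a/2)) \<longlongrightarrow> 0) (at_right 0)" by simp
  qed
  ultimately have "((\<lambda>R. weighted_orbit r p R - weighted_orbit r p 0) \<longlongrightarrow> 0) (at_right 0)" by (rule Lim_null_comparison)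
  then show ?thesis by (simp add: LIM_zero_iff)
qed

text \<open>One integral evaluated twice. The bounded operator \<open>smoothed_frac r\<close> passes
  under the integral that defines A^-a p; the resulting integrand is minus the derivative of
  \<open>weighted_orbit\<close>, so the integral is the value of that orbit at 0, namely
  \<open>weight_mass *\<^sub>R T r p\<close>.\<close>

lemma smoothed_frac_neg_frac_power: "smoothed_frac r (neg_frac_power T a p) = (weight_mass / Gamma a) *\<^sub>R T r p" if r: "r > 0"
proof -
  let ?I = "integral {0<..} (\<lambda>t. t powr (a - 1) *\<^sub>R T t p)"
  have "((\<lambda>R. R powr (a - 1) *\<^sub>R smoothed_frac (r + R) p) has_integral (- 0 - - weighted_orbit r p 0)) {0<..}"
  proof (rule has_integral_improper[where F = "\<lambda>R. - weighted_orbit r p R"])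
    show "((\<lambda>R. - weighted_orbit r p R) has_vector_derivative R powr (a - 1) *\<^sub>R smoothed_frac (r + R) p) (at R)" if "R > 0" for R
      using has_vector_derivative_minus[OF weighted_orbit_deriv[OF r that, of p]] by simp
  qed (intro tendsto_minus weighted_orbit_at_0 weighted_orbit_at_top r)+
  then have i: "((\<lambda>R. R powr (a - 1) *\<^sub>R smoothed_frac (r + R) p) has_integral weight_mass *\<^sub>R T r p) {0<..}"
    by (simp add: weighted_orbit_0)
  have "((\<lambda>t. t powr (a - 1) *\<^sub>R T t p) has_integral ?I) {0<..}"
    by (rule integrable_integral[OF powr_dominated_integrable[OF neg_frac_power_dominated]]) (use a in auto)
  from has_integral_linear[OF this smoothed_frac_bounded_linear[OF r]]
  have "((\<lambda>R. smoothed_frac r (R powr (a - 1) *\<^sub>R T R p)) has_integral smoothed_frac r ?I) {0<..}" by (simp add: o_def)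
  then have "((\<lambda>R. R powr (a - 1) *\<^sub>R smoothed_frac (r + R) p) has_integral smoothed_frac r ?I) {0<..}"
    by (rule has_integral_eq[rotated]) (use r in \<open>simp add: linear_simps(5)[OF smoothed_frac_bounded_linear] smoothed_frac_T\<close>)
  then have "smoothed_frac r ?I = weight_mass *\<^sub>R T r p" using i by (rule has_integral_unique)
  then show ?thesis using a by (simp add: neg_frac_power_def linear_simps(5)[OF smoothed_frac_bounded_linear[OF r]])
qed

end

text \<open>\<open>S r\<close> is \<open>A\<^sup>\<alpha> T(r)\<close>; the last property says so without mentioning \<open>A\<^sup>\<alpha>\<close>, and yields
  injectivity of \<open>A\<^sup>-\<^sup>\<alpha>\<close>.\<close>

lemma frac_power_semigroup:
  assumes "0 \<le> a" "a < 1"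
  shows "\<exists>S M. 0 < M \<and> (\<forall>r>0. bounded_linear (S r)) \<and> (\<forall>r>0. \<forall>s\<ge>0. \<forall>y. S r (T s y) = S (r + s) y) \<and>
    (\<forall>r>0. \<forall>y. norm (S r y) \<le> M * r powr (-a) * norm y) \<and>
    (\<forall>r>0. \<forall>p. S r (neg_frac_power T a p) = T r p)"
proof (cases "a = 0")
  case True
  show ?thesis
    by (rule exI[of _ T], rule exI[of _ C])
       (use True C_pos T_bounded_linear T_bound in \<open>auto simp: neg_frac_power_def T_add\<close>)
next
  case False
  then have a: "0 < a" "a < 1" using assms by auto
  \<comment> \<open>The factor that turns \<open>smoothed_frac\<close> into A^a T(r); by the
    reflection formula it is 1 / Gamma(1 - a).\<close>
  define k where "k = Gamma a / weight_mass a"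
  have k: "k > 0" using weight_mass_pos[OF a] a by (simp add: k_def Gamma_real_pos)
  show ?thesis
  proof (intro exI conjI allI impI)
    show "k * (C * (1/(1-a) + 1/a)) > 0"
      using k C_pos a by (intro mult_pos_pos add_pos_pos) auto
    fix r :: real assume r: "r > 0"
    show "bounded_linear (\<lambda>y. k *\<^sub>R smoothed_frac a r y)"
      by (rule bounded_linear_compose[OF bounded_linear_scaleR_right smoothed_frac_bounded_linear[OF a r]])
    show "k *\<^sub>R smoothed_frac a r (T s y) = k *\<^sub>R smoothed_frac a (r + s) y" if "s \<ge> 0" for s y
      using smoothed_frac_T[OF a r that] by simp
    show "norm (k *\<^sub>R smoothed_frac a r y) \<le> k * (C * (1/(1-a) + 1/a)) * r powr (-a) * norm y" for y
      using mult_left_mono[OF smoothed_frac_bound[OF a r, of y], of k] k by (simp add: mult.assoc)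
    show "k *\<^sub>R smoothed_frac a r (neg_frac_power T a p) = T r p" for p
      using smoothed_frac_neg_frac_power[OF a r, of p] weight_mass_pos[OF a] Gamma_real_pos[OF a(1)] by (simp add: k_def)
  qed
qed

end

section \<open>Regularity of mild solutions\<close>

text \<open>The mild formula describes u(t) - u(s) only for s \<le> t. Letting both points move near
  x covers left and right difference quotients by one estimate.\<close>

lemma has_vector_derivative_strict:
  fixes f :: "real \<Rightarrow> 'a::real_normed_vector"
  assumes "\<And>e. e > 0 \<Longrightarrow> \<exists>d>0. \<forall>s t. \<bar>s - x\<bar> < d \<and> \<bar>t - x\<bar> < d \<and> s \<le> t \<longrightarrow>
      norm (f t - f s - (t - s) *\<^sub>R f') \<le> e * (t - s)"
  shows "(f has_vector_derivative f') (at x)"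
  unfolding has_vector_derivative_def has_derivative_within_alt
proof (intro conjI bounded_linear_scaleR_left allI impI)
  fix e :: real assume "e > 0"
  then obtain d where d: "d > 0" "\<And>s t. \<bar>s - x\<bar> < d \<Longrightarrow> \<bar>t - x\<bar> < d \<Longrightarrow> s \<le> t \<Longrightarrow>
      norm (f t - f s - (t - s) *\<^sub>R f') \<le> e * (t - s)" using assms by meson
  show "\<exists>d>0. \<forall>y\<in>UNIV. norm (y - x) < d \<longrightarrow> norm (f y - f x - (y - x) *\<^sub>R f') \<le> e * norm (y - x)"
  proof (intro exI[of _ d] conjI ballI impI d(1))
    fix y assume y: "norm (y - x) < d"
    show "norm (f y - f x - (y - x) *\<^sub>R f') \<le> e * norm (y - x)"
    proof (cases "x \<le> y")
      case True then show ?thesis using d(2)[of x y] d(1) y by simp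
    next
      case False
      have "f y - f x - (y - x) *\<^sub>R f' = - (f x - f y - (x - y) *\<^sub>R f')" by (simp add: algebra_simps)
      then show ?thesis using d(2)[of y x] d(1) y False by (metis abs_minus_commute abs_of_nonneg
        abs_zero diff_self less_eq_real_def linorder_not_le diff_ge_0_iff_ge norm_minus_cancel real_norm_def)
    qed
  qed
qed

lemma has_integral_reflect_shift:
  fixes f :: "real \<Rightarrow> 'a::banach"
  assumes "(f has_integral i) {a..b}"
  shows "((\<lambda>s. f (t - s)) has_integral i) {t - b..t - a}"
proof -
  have "(\<lambda>x. - x + t) ` {a..b} = {t - b..t - a}" by (auto simp: image_iff intro!: bexI[of _ "t - x" for x])
  then show ?thesis using has_integral_affinity[of f i a b "-1" t] assms by simp
qed

text \<open>The shift e > 0 keeps the integrand smooth up to r = t, while the value stays bounded as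
  e -> 0 because 1 - \<gamma> > 0.\<close>

lemma has_integral_powr_shift:
  fixes e s t \<gamma> :: real
  assumes "e > 0" "s \<le> t" "\<gamma> < 1"
  shows "((\<lambda>r. (e + t - r) powr (-\<gamma>)) has_integral
    ((e + t - s) powr (1 - \<gamma>) - e powr (1 - \<gamma>)) / (1 - \<gamma>)) {s..t}"
proof -
  let ?F = "\<lambda>r. - ((e + t - r) powr (1 - \<gamma>) / (1 - \<gamma>))"
  have "((\<lambda>r. (e + t - r) powr (-\<gamma>)) has_integral (?F t - ?F s)) {s..t}"
  proof (rule fundamental_theorem_of_calculus)
    fix r assume r: "r \<in> {s..t}"
    have "(?F has_real_derivative (e + t - r) powr (-\<gamma>)) (at r within {s..t})"
    proof -
      have "((\<lambda>r. e + t - r) has_real_derivative -1) (at r within {s..t})"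
        by (auto intro!: derivative_eq_intros)
      from DERIV_chain2[OF has_real_derivative_powr[of "e + t - r" "1 - \<gamma>"] this]
      have "((\<lambda>r. (e + t - r) powr (1 - \<gamma>)) has_real_derivative
          - ((1 - \<gamma>) * (e + t - r) powr (-\<gamma>))) (at r within {s..t})"
        using assms r by simp
      from DERIV_cmult[OF this, of "- 1 / (1 - \<gamma>)"] show ?thesis using assms by simp
    qed
    then show "(?F has_vector_derivative (e + t - r) powr (-\<gamma>)) (at r within {s..t})"
      by (simp add: has_real_derivative_iff_has_vector_derivative)
  qed (use assms in auto)
  moreover have "?F t - ?F s = ((e + t - s) powr (1 - \<gamma>) - e powr (1 - \<gamma>)) / (1 - \<gamma>)"
    by (simp add: diff_divide_distrib)
  ultimately show ?thesis by simp
qed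

context decaying_analytic
begin

text \<open>T is only strongly continuous, so the vector is frozen first; the error of freezing it
  is handled by the uniform bound on T.\<close>

lemma T_continuous_on_compose:
  assumes f: "continuous_on X f" and g: "continuous_on X g" and nonneg: "\<And>r. r \<in> X \<Longrightarrow> f r \<ge> 0"
  shows "continuous_on X (\<lambda>r. T (f r) (g r))"
  unfolding continuous_on_def
proof
  fix r assume r: "r \<in> X"
  have "((\<lambda>s. T (f s) (g r)) \<longlongrightarrow> T (f r) (g r)) (at r within X)"
    using continuous_on_compose2[OF T_continuous_on[of "g r"] f] nonneg r
    by (auto simp: continuous_on_def)
  moreover have "((\<lambda>s. T (f s) (g s - g r)) \<longlongrightarrow> 0) (at r within X)"
  proof (rule Lim_null_comparison)
    show "\<forall>\<^sub>F s in at r within X. norm (T (f s) (g s - g r)) \<le> C * norm (g s - g r)"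
      using nonneg T_bound by (auto simp: eventually_at_filter)
    have "((\<lambda>s. norm (g s - g r)) \<longlongrightarrow> norm (g r - g r)) (at r within X)"
      using g r by (intro tendsto_intros) (auto simp: continuous_on_def)
    then show "((\<lambda>s. C * norm (g s - g r)) \<longlongrightarrow> 0) (at r within X)"
      by (intro tendsto_mult_right_zero) simp
  qed
  ultimately have "((\<lambda>s. T (f s) (g r) + T (f s) (g s - g r)) \<longlongrightarrow> T (f r) (g r) + 0) (at r within X)"
    by (rule tendsto_add)
  then show "((\<lambda>s. T (f s) (g s)) \<longlongrightarrow> T (f r) (g r)) (at r within X)"
  proof (rule Lim_transform_eventually[of _ _ _, OF tendsto_eq_rhs])
    show "\<forall>\<^sub>F s in at r within X. T (f s) (g r) + T (f s) (g s - g r) = T (f s) (g s)"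
      using nonneg by (auto simp: eventually_at_filter linear_simps(2)[OF T_bounded_linear])
  qed simp
qed

text \<open>S(r) inverts A^-a up to the factor T(r), and T(r) tends strongly to the
  identity.\<close>

lemma inj_neg_frac_power:
  assumes "0 \<le> a" "a < 1"
  shows "inj (neg_frac_power T a)"
proof (rule injI)
  fix p q assume eq: "neg_frac_power T a p = neg_frac_power T a q"
  obtain S where "\<And>r p. r > 0 \<Longrightarrow> S r (neg_frac_power T a p) = T r p"
    using frac_power_semigroup[OF assms] by metis
  then have "T r p = T r q" if "r > 0" for r using eq that by metis
  then have "\<forall>\<^sub>F r in at_right 0. T r q = T r p"
    by (auto simp: eventually_at_right_field intro!: exI[of _ 1])
  then have "((\<lambda>r. T r p) \<longlongrightarrow> q) (at_right 0)"
    by (rule Lim_transform_eventually[OF T_tendsto])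
  then show "p = q" using T_tendsto[of p] tendsto_unique trivial_limit_at_right_real by blast
qed

lemma mild_integrable:
  assumes "continuous_on {s..t} g"
  shows "(\<lambda>r. T (t - r) (g r)) integrable_on {s..t}"
  by (intro integrable_continuous_interval T_continuous_on_compose continuous_intros assms) auto

text \<open>Any s becomes a new initial time. This moves the problem away from \<sigma>, where only
  w0 is known, and gives the increments of u.\<close>

lemma mild_restart:
  assumes "\<sigma> \<le> s" "s \<le> t" and g: "continuous_on {\<sigma>..t} g"
    and u: "\<And>t'. t' \<in> {\<sigma>..t} \<Longrightarrow> u t' = T (t' - \<sigma>) w0 + integral {\<sigma>..t'} (\<lambda>r. T (t' - r) (g r))"
  shows "u t = T (t - s) (u s) + integral {s..t} (\<lambda>r. T (t - r) (g r))"
proof -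
  have gs: "continuous_on {\<sigma>..s} g" by (rule continuous_on_subset[OF g]) (use assms in auto)
  have "T (t - s) (u s) = T (t - s) (T (s - \<sigma>) w0) + T (t - s) (integral {\<sigma>..s} (\<lambda>r. T (s - r) (g r)))"
    using u[of s] assms by (simp add: linear_simps(1)[OF T_bounded_linear])
  also have "T (t - s) (T (s - \<sigma>) w0) = T (t - \<sigma>) w0"
    using T_add[of "t - s" "s - \<sigma>" w0] assms by simp
  also have "T (t - s) (integral {\<sigma>..s} (\<lambda>r. T (s - r) (g r))) =
      integral {\<sigma>..s} (\<lambda>r. T (t - s) (T (s - r) (g r)))"
    using integral_linear[OF mild_integrable[OF gs] T_bounded_linear[of "t - s"]] assms by (simp add: o_def)
  also have "\<dots> = integral {\<sigma>..s} (\<lambda>r. T (t - r) (g r))"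
  proof (rule integral_cong)
    fix r assume "r \<in> {\<sigma>..s}"
    then show "T (t - s) (T (s - r) (g r)) = T (t - r) (g r)"
      using T_add[of "t - s" "s - r" "g r"] assms by simp
  qed
  finally show ?thesis
    using u[of t] assms Henstock_Kurzweil_Integration.integral_combine[OF assms(1,2) mild_integrable[OF g]]
    by (simp add: add.assoc)
qed

text \<open>Here p = A^a u. The increment has three parts: the orbit of w0, smooth only away from
  \<sigma> (hence c > \<sigma>); the integral up to s, with singularity x^-\<gamma> for \<gamma> = a
  + \<beta> < 1; and the integral from s to t, of size h^(1-a).\<close>

lemma mild_hoelder:
  assumes a: "0 \<le> a" and \<beta>: "0 < \<beta>" "a + \<beta> < 1" and c: "\<sigma> < c"
    and g: "continuous_on {\<sigma>..b} g" and G: "\<And>s. s \<in> {\<sigma>..b} \<Longrightarrow> norm (g s) \<le> G"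
    and u: "\<And>t. t \<in> {\<sigma>..b} \<Longrightarrow> u t = T (t - \<sigma>) w0 + integral {\<sigma>..t} (\<lambda>r. T (t - r) (g r))"
    and p: "\<And>t. t \<in> {\<sigma>..b} \<Longrightarrow> u t = neg_frac_power T a (p t)"
  shows "\<exists>L. \<forall>s t. c \<le> s \<and> s \<le> t \<and> t \<le> b \<longrightarrow> norm (p t - p s) \<le> L * (t - s) powr \<beta>"
proof -
  define \<gamma> where "\<gamma> = a + \<beta>"
  have \<gamma>: "0 < \<gamma>" "\<gamma> < 1" "a < 1" using a \<beta> by (auto simp: \<gamma>_def)
  obtain S M where M: "M > 0" and S: "\<And>r. r > 0 \<Longrightarrow> bounded_linear (S r)"
    "\<And>r s y. r > 0 \<Longrightarrow> s \<ge> 0 \<Longrightarrow> S r (T s y) = S (r + s) y"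
    "\<And>r y. r > 0 \<Longrightarrow> norm (S r y) \<le> M * r powr (-a) * norm y"
    "\<And>r p. r > 0 \<Longrightarrow> S r (neg_frac_power T a p) = T r p"
    using frac_power_semigroup[OF a \<gamma>(3)] by metis
  \<comment> \<open>S(x + h) - S(x) = S(x/2) (T(x/2 + h) - T(x/2)): the bound on S at x/2 gives M
    2^a, \<open>T_hoelder\<close> at x/2 gives 2 C 2^\<beta>.\<close>
  define N where "N = M * 2 powr a * (2 * C) * 2 powr \<beta>"
  have N: "N > 0" using M C_pos by (simp add: N_def)
  have diff: "norm (S (x + h) y - S x y) \<le> N * h powr \<beta> * x powr (-\<gamma>) * norm y"
    if "x > 0" "h \<ge> 0" for x h y
  proof -
    have "S (x + h) y - S x y = S (x/2) (T (x/2 + h) y) - S (x/2) (T (x/2) y)"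
      using S(2)[of "x/2" "x/2 + h" y] S(2)[of "x/2" "x/2" y] that by (simp add: add.assoc[symmetric])
    also have "\<dots> = S (x/2) (T (x/2 + h) y - T (x/2) y)"
      using S(1)[of "x/2"] that by (simp add: linear_simps)
    also have "norm \<dots> \<le> M * (x/2) powr (-a) * norm (T (x/2 + h) y - T (x/2) y)"
      using S(3) that by simp
    also have "\<dots> \<le> M * (x/2) powr (-a) * (2 * C * (h / (x/2)) powr \<beta> * norm y)"
      using that a \<beta> M by (intro mult_left_mono T_hoelder) auto
    also have "\<dots> = N * h powr \<beta> * (x powr (-a) * x powr (-\<beta>)) * norm y"
      using that by (simp add: N_def powr_divide powr_mult powr_minus field_simps)
    also have "x powr (-a) * x powr (-\<beta>) = x powr (-\<gamma>)" by (simp add: \<gamma>_def flip: powr_add)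
    finally show ?thesis .
  qed
  \<comment> \<open>\<open>L1\<close> collects the two parts of order h^\<beta>; the 1 in 1 + b -
    \<sigma> allows for e \<le> 1. \<open>L2\<close> belongs to the integral from s to t.\<close>
  define L1 where "L1 = N * (c - \<sigma>) powr (-\<gamma>) * norm w0 + N * G * ((1 + b - \<sigma>) powr (1 - \<gamma>) / (1 - \<gamma>))"
  define L2 where "L2 = M * G / (1 - a)"
  define L where "L = L1 + L2 * (b - \<sigma>) powr (1 - \<gamma>)"
  show ?thesis
  proof (intro exI[of _ L] allI impI)
    fix s t assume "c \<le> s \<and> s \<le> t \<and> t \<le> b"
    then have st: "c \<le> s" "s \<le> t" "t \<le> b" by auto
    define h where "h = t - s"
    have h: "h \<ge> 0" "t = s + h" using st by (auto simp: h_def)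
    have G0: "G \<ge> 0" by (rule order_trans[OF norm_ge_zero G[of s]]) (use st c in auto)
    have gsub: "continuous_on X g" if "X \<subseteq> {\<sigma>..b}" for X
      by (rule continuous_on_subset[OF g that])
    have Su: "S e (u x) = S (e + (x - \<sigma>)) w0 + integral {\<sigma>..x} (\<lambda>r. S (e + x - r) (g r))"
      and Si: "(\<lambda>r. S (e + x - r) (g r)) integrable_on {\<sigma>..x}" if "e > 0" "x \<in> {\<sigma>..b}" for e x
    proof -
      have gx: "continuous_on {\<sigma>..x} g" by (rule gsub) (use that in auto)
      have ST: "S e (T (x - r) (g r)) = S (e + x - r) (g r)" if "r \<in> {\<sigma>..x}" for r
        using S(2)[OF \<open>e > 0\<close>, of "x - r"] that by (simp add: add_diff_eq)
      have "(S e \<circ> (\<lambda>r. T (x - r) (g r))) integrable_on {\<sigma>..x}"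
        by (rule integrable_linear[OF mild_integrable[OF gx] S(1)[OF that(1)]])
      then show "(\<lambda>r. S (e + x - r) (g r)) integrable_on {\<sigma>..x}"
        by (rule integrable_eq) (simp add: ST)
      have "S e (integral {\<sigma>..x} (\<lambda>r. T (x - r) (g r))) = integral {\<sigma>..x} (\<lambda>r. S e (T (x - r) (g r)))"
        using integral_linear[OF mild_integrable[OF gx] S(1)[OF that(1)]] by (simp add: o_def)
      also have "\<dots> = integral {\<sigma>..x} (\<lambda>r. S (e + x - r) (g r))"
        by (rule integral_cong) (rule ST)
      finally show "S e (u x) = S (e + (x - \<sigma>)) w0 + integral {\<sigma>..x} (\<lambda>r. S (e + x - r) (g r))"
        using u[OF that(2)] S(1,2) that by (simp add: linear_simps)
    qed
    \<comment> \<open>T(e) p = S(e) u, so the estimate is made on the mild formula itself. No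
      constant depends on e, which tends to 0 afterwards.\<close>
    have bound: "norm (T e (p t - p s)) \<le> L1 * h powr \<beta> + L2 * (e + h) powr (1 - a)"
      if e: "0 < e" "e \<le> 1" for e
    proof -
      have mem: "s \<in> {\<sigma>..b}" "t \<in> {\<sigma>..b}" using st c by auto
      let ?i = "\<lambda>r. S (e + t - r) (g r)" and ?j = "\<lambda>r. S (e + s - r) (g r)"
      have int: "?i integrable_on {\<sigma>..s}" "?i integrable_on {s..t}"
        using integrable_subinterval_real[OF Si[OF e(1) mem(2)]] st c by auto
      have TS: "T e (p t - p s) = S e (u t) - S e (u s)"
        using p S(4) e mem T_bounded_linear[of e] by (simp add: linear_simps)
      have arg: "e + (s - \<sigma>) + h = e + (t - \<sigma>)" by (simp add: h_def)
      have "integral {\<sigma>..t} ?i = integral {\<sigma>..s} ?i + integral {s..t} ?i"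
        using Henstock_Kurzweil_Integration.integral_combine[OF _ _ Si[OF e(1) mem(2)], of s] st c by simp
      then have "S e (u t) - S e (u s) = (S (e + (s - \<sigma>) + h) w0 - S (e + (s - \<sigma>)) w0)
          + integral {\<sigma>..s} (\<lambda>r. ?i r - ?j r) + integral {s..t} ?i"
        unfolding Su[OF e(1) mem(1)] Su[OF e(1) mem(2)] arg integral_diff[OF int(1) Si[OF e(1) mem(1)]]
        by simp
      with TS have eq: "T e (p t - p s) = (S (e + (s - \<sigma>) + h) w0 - S (e + (s - \<sigma>)) w0)
          + integral {\<sigma>..s} (\<lambda>r. ?i r - ?j r) + integral {s..t} ?i" by simp
      have "norm (S (e + (s - \<sigma>) + h) w0 - S (e + (s - \<sigma>)) w0)
          \<le> N * h powr \<beta> * (e + (s - \<sigma>)) powr (-\<gamma>) * norm w0"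
        by (rule diff) (use e st c h in auto)
      also have "\<dots> \<le> N * h powr \<beta> * (c - \<sigma>) powr (-\<gamma>) * norm w0"
        using N c st e \<gamma> by (intro mult_right_mono mult_left_mono powr_mono2') auto
      finally have 1: "norm (S (e + (s - \<sigma>) + h) w0 - S (e + (s - \<sigma>)) w0)
          \<le> N * (c - \<sigma>) powr (-\<gamma>) * norm w0 * h powr \<beta>" by (simp add: mult_ac)
      have "norm (integral {\<sigma>..s} (\<lambda>r. ?i r - ?j r)) \<le>
          integral {\<sigma>..s} (\<lambda>r. (N * h powr \<beta> * G) * (e + s - r) powr (-\<gamma>))"
      proof (rule integral_norm_bound_integral)
        show "(\<lambda>r. ?i r - ?j r) integrable_on {\<sigma>..s}"
          by (rule integrable_diff[OF int(1) Si[OF e(1) mem(1)]])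
        show "(\<lambda>r. (N * h powr \<beta> * G) * (e + s - r) powr (-\<gamma>)) integrable_on {\<sigma>..s}"
          using has_integral_powr_shift[OF e(1), of \<sigma> s \<gamma>] st c \<gamma> by (intro integrable_on_mult_right) auto
        fix r assume r: "r \<in> {\<sigma>..s}"
        have "norm (?i r - ?j r) \<le> N * h powr \<beta> * (e + s - r) powr (-\<gamma>) * norm (g r)"
          using diff[of "e + s - r" h "g r"] r e h by (simp add: algebra_simps)
        also have "\<dots> \<le> N * h powr \<beta> * (e + s - r) powr (-\<gamma>) * G"
          using G[of r] r st N by (intro mult_left_mono) auto
        finally show "norm (?i r - ?j r) \<le> (N * h powr \<beta> * G) * (e + s - r) powr (-\<gamma>)" by (simp add: mult_ac)
      qed
      also have "\<dots> = (N * h powr \<beta> * G) * (((e + s - \<sigma>) powr (1 - \<gamma>) - e powr (1 - \<gamma>)) / (1 - \<gamma>))"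
        using has_integral_powr_shift[OF e(1), of \<sigma> s \<gamma>] st c \<gamma> by (simp add: integral_unique)
      also have "\<dots> \<le> (N * h powr \<beta> * G) * ((1 + b - \<sigma>) powr (1 - \<gamma>) / (1 - \<gamma>))"
      proof (intro mult_left_mono divide_right_mono)
        have "(e + s - \<sigma>) powr (1 - \<gamma>) \<le> (1 + b - \<sigma>) powr (1 - \<gamma>)"
          using e st c \<gamma> by (intro powr_mono2) auto
        then show "(e + s - \<sigma>) powr (1 - \<gamma>) - e powr (1 - \<gamma>) \<le> (1 + b - \<sigma>) powr (1 - \<gamma>)"
          using powr_ge_zero[of e "1 - \<gamma>"] by linarith
      qed (use N G0 \<gamma> in auto)
      finally have 2: "norm (integral {\<sigma>..s} (\<lambda>r. ?i r - ?j r)) \<le>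
          N * G * ((1 + b - \<sigma>) powr (1 - \<gamma>) / (1 - \<gamma>)) * h powr \<beta>" by (simp add: mult_ac)
      have "norm (integral {s..t} ?i) \<le> integral {s..t} (\<lambda>r. (M * G) * (e + t - r) powr (-a))"
      proof (rule integral_norm_bound_integral[OF int(2)])
        show "(\<lambda>r. (M * G) * (e + t - r) powr (-a)) integrable_on {s..t}"
          using has_integral_powr_shift[OF e(1), of s t a] st \<gamma> by (intro integrable_on_mult_right) auto
        fix r assume r: "r \<in> {s..t}"
        have "norm (?i r) \<le> M * (e + t - r) powr (-a) * norm (g r)"
          using S(3)[of "e + t - r" "g r"] r e by simp
        also have "\<dots> \<le> M * (e + t - r) powr (-a) * G"
          using G[of r] r st c M by (intro mult_left_mono) auto
        finally show "norm (?i r) \<le> (M * G) * (e + t - r) powr (-a)" by (simp add: mult_ac)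
      qed
      also have "\<dots> = (M * G) * (((e + t - s) powr (1 - a) - e powr (1 - a)) / (1 - a))"
        using has_integral_powr_shift[OF e(1), of s t a] st \<gamma> by (simp add: integral_unique)
      also have "\<dots> \<le> (M * G) * ((e + t - s) powr (1 - a) / (1 - a))"
        using M G0 \<gamma> by (intro mult_left_mono divide_right_mono) auto
      also have "\<dots> = L2 * (e + h) powr (1 - a)" by (simp add: L2_def h_def add_diff_eq)
      finally have 3: "norm (integral {s..t} ?i) \<le> L2 * (e + h) powr (1 - a)" .
      have "norm (T e (p t - p s)) \<le> norm (S (e + (s - \<sigma>) + h) w0 - S (e + (s - \<sigma>)) w0)
          + norm (integral {\<sigma>..s} (\<lambda>r. ?i r - ?j r)) + norm (integral {s..t} ?i)"
        unfolding eq by (intro order_trans[OF norm_triangle_ineq] add_mono norm_triangle_ineq order_refl)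
      with 1 2 3 show ?thesis unfolding L1_def by (simp add: algebra_simps)
    qed
    have "norm (p t - p s) \<le> L1 * h powr \<beta> + L2 * (0 + h) powr (1 - a)"
    proof (rule tendsto_le[of "at_right 0"])
      show "((\<lambda>e. norm (T e (p t - p s))) \<longlongrightarrow> norm (p t - p s)) (at_right 0)"
        by (intro tendsto_norm T_tendsto)
      show "((\<lambda>e. L1 * h powr \<beta> + L2 * (e + h) powr (1 - a)) \<longlongrightarrow> L1 * h powr \<beta> + L2 * (0 + h) powr (1 - a)) (at_right 0)"
        using h \<gamma> by (intro tendsto_intros tendsto_powr2) (auto simp: eventually_at_right_field intro!: exI[of _ 1])
      show "\<forall>\<^sub>F e in at_right 0. norm (T e (p t - p s)) \<le> L1 * h powr \<beta> + L2 * (e + h) powr (1 - a)"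
        using bound by (auto simp: eventually_at_right_field intro!: exI[of _ 1])
    qed simp
    \<comment> \<open>1 - a = \<beta> + (1 - \<gamma>): the last part has order better than \<beta>,
      and the surplus power is bounded on the interval.\<close>
    also have "(0 + h) powr (1 - a) = h powr \<beta> * h powr (1 - \<gamma>)" by (simp add: \<gamma>_def flip: powr_add)
    also have "L1 * h powr \<beta> + L2 * (h powr \<beta> * h powr (1 - \<gamma>)) \<le> L1 * h powr \<beta> + L2 * (h powr \<beta> * (b - \<sigma>) powr (1 - \<gamma>))"
      using M G0 \<gamma> st c h by (intro add_left_mono mult_left_mono powr_mono2) (auto simp: L2_def)
    also have "\<dots> = L * h powr \<beta>" by (simp add: L_def algebra_simps)
    finally show "norm (p t - p s) \<le> L * (t - s) powr \<beta>" by (simp add: h_def)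
  qed
qed

section \<open>Membership in the domain of A and differentiability of mild solutions\<close>

lemma has_integral_E:
  assumes "e > 0" "a \<le> t - e"
  shows "((\<lambda>s. E (t - s) x) has_integral (T e x - T (t - a) x)) {a..t - e}"
proof -
  have "((\<lambda>s. E (t - s) x) has_integral (T (t - (t - e)) x - T (t - a) x)) {a..t - e}"
  proof (rule fundamental_theorem_of_calculus[OF assms(2)])
    fix s assume s: "s \<in> {a..t - e}"
    have "((\<lambda>s. t - s) has_vector_derivative -1) (at s)"
      by (auto intro!: derivative_eq_intros)
    from vector_diff_chain_at[OF this T_deriv[of "t - s" x]] s assms
    have "((\<lambda>s. T (t - s) x) has_vector_derivative E (t - s) x) (at s)" by (simp add: o_def)
    then show "((\<lambda>s. T (t - s) x) has_vector_derivative E (t - s) x) (at s within {a..t - e})"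
      by (rule has_vector_derivative_at_within)
  qed
  then show ?thesis by simp
qed

text \<open>The hypothesis is y in D(A) with z = A y, expressed by the semigroup. It is stated for r
  > 0 only, so the primitive T(t - r) y is differentiated inside the interval and is merely
  continuous at r = t.\<close>

lemma has_integral_T_domain:
  assumes y: "\<And>r. r > 0 \<Longrightarrow> E r y = T r z" and "s \<le> t"
  shows "((\<lambda>r. T (t - r) z) has_integral (y - T (t - s) y)) {s..t}"
proof -
  have "((\<lambda>r. T (t - r) z) has_integral (T (t - t) y - T (t - s) y)) {s..t}"
  proof (rule fundamental_theorem_of_calculus_interior[OF assms(2)])
    show "continuous_on {s..t} (\<lambda>r. T (t - r) y)"
      by (intro T_continuous_on_compose continuous_intros) auto
    fix r assume r: "r \<in> {s<..<t}"
    have "((\<lambda>r. t - r) has_vector_derivative -1) (at r)"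
      by (auto intro!: derivative_eq_intros)
    from vector_diff_chain_at[OF this T_deriv[of "t - r" y]] r
    show "((\<lambda>r. T (t - r) y) has_vector_derivative T (t - r) z) (at r)" by (simp add: o_def y)
  qed
  then show ?thesis by (simp add: T_0)
qed

text \<open>\<open>w\<close> stands for A u. By \<open>has_integral_T_domain\<close>, u(s) - T(t -
  s) u(s) is the integral of T(t - r) w(s), so u(t) - u(s) is the integral of T(t - r)(g(r) - w(s)),
  whose integrand is close to g(t0) - w(t0) near t0.\<close>

lemma mild_derivative:
  assumes t0: "c < t0" "t0 < b" and g: "continuous_on {c..b} g" and w: "continuous_on {c..b} w"
    and u: "\<And>s t. c \<le> s \<Longrightarrow> s \<le> t \<Longrightarrow> t \<le> b \<Longrightarrow>
      u t = T (t - s) (u s) + integral {s..t} (\<lambda>r. T (t - r) (g r))"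
    and dom: "\<And>t r. t \<in> {c..b} \<Longrightarrow> r > 0 \<Longrightarrow> E r (u t) = T r (w t)"
  shows "(u has_vector_derivative (g t0 - w t0)) (at t0)"
proof (rule has_vector_derivative_strict)
  fix e :: real assume e: "e > 0"
  define L where "L = g t0 - w t0"
  \<comment> \<open>The integrand is finally off by at most C (2 e') + e'.\<close>
  define e' where "e' = e / (2 * C + 1)"
  have e': "e' > 0" "e = (2 * C + 1) * e'" using e C_pos by (auto simp: e'_def)
  have "t0 \<in> {c..b}" using t0 by auto
  then obtain d1 d2 where d: "d1 > 0" "\<And>r. r \<in> {c..b} \<Longrightarrow> \<bar>r - t0\<bar> < d1 \<Longrightarrow> norm (g r - g t0) < e'"
    "d2 > 0" "\<And>r. r \<in> {c..b} \<Longrightarrow> \<bar>r - t0\<bar> < d2 \<Longrightarrow> norm (w r - w t0) < e'"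
    using g w e' unfolding continuous_on_iff dist_norm real_norm_def by metis
  have "\<exists>d>0. \<forall>h\<in>{0..}. dist h 0 < d \<longrightarrow> dist (T h L) (T 0 L) < e'"
    using T_continuous_on[of L] e'(1) unfolding continuous_on_iff by (metis atLeast_iff order_refl)
  then obtain d3 where d3: "d3 > 0" "\<And>h. 0 \<le> h \<Longrightarrow> h < d3 \<Longrightarrow> norm (T h L - L) < e'"
    by (auto simp: dist_norm T_0)
  \<comment> \<open>d3 is halved because t - r \<le> t - s < 2 d; the last two terms keep s and t
    inside [c, b].\<close>
  define d where "d = min (min d1 d2) (min (d3/2) (min (t0 - c) (b - t0)))"
  show "\<exists>d>0. \<forall>s t. \<bar>s - t0\<bar> < d \<and> \<bar>t - t0\<bar> < d \<and> s \<le> t \<longrightarrow>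
      norm (u t - u s - (t - s) *\<^sub>R (g t0 - w t0)) \<le> e * (t - s)"
  proof (intro exI[of _ d] conjI allI impI)
    show "d > 0" using d d3 t0 by (simp add: d_def)
    fix s t assume "\<bar>s - t0\<bar> < d \<and> \<bar>t - t0\<bar> < d \<and> s \<le> t"
    then have st: "\<bar>s - t0\<bar> < d" "\<bar>t - t0\<bar> < d" "s \<le> t" by auto
    have cb: "c \<le> s" "t \<le> b"
      using st unfolding d_def min_less_iff_conj abs_less_iff by linarith+
    have gst: "continuous_on {s..t} g" by (rule continuous_on_subset[OF g]) (use cb in auto)
    let ?q = "\<lambda>r. T (t - r) (g r) - T (t - r) (w s) - L"
    have "(?q has_integral (integral {s..t} (\<lambda>r. T (t - r) (g r)) - (u s - T (t - s) (u s)) - (t - s) *\<^sub>R L)) {s..t}"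
      using has_integral_const_real[of L s t] st cb
      by (intro has_integral_diff integrable_integral mild_integrable gst has_integral_T_domain dom) auto
    then have i: "(?q has_integral (u t - u s - (t - s) *\<^sub>R L)) {s..t}"
      using u[OF cb(1) st(3) cb(2)] by (simp add: algebra_simps)
    have "norm (u t - u s - (t - s) *\<^sub>R L) \<le> integral {s..t} (\<lambda>_. e)"
      unfolding integral_unique[OF i, symmetric]
    proof (rule integral_norm_bound_integral)
      show "?q integrable_on {s..t}" using i by (rule has_integral_integrable)
      fix r assume r: "r \<in> {s..t}"
      have tr: "t - r < d3"
        using r st unfolding d_def min_less_iff_conj abs_less_iff atLeastAtMost_iff by linarith
      have "\<bar>r - t0\<bar> < d" using r st by auto
      then have "norm (g r - g t0) < e'" "norm (w s - w t0) < e'"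
        using d r st cb by (auto simp: d_def)
      then have q: "norm (g r - w s - L) \<le> 2 * e'"
        using norm_triangle_ineq4[of "g r - g t0" "w s - w t0"] by (simp add: L_def algebra_simps)
      have "?q r = T (t - r) (g r - w s - L) + (T (t - r) L - L)"
        using T_bounded_linear[of "t - r"] r by (simp add: linear_simps)
      also have "norm \<dots> \<le> norm (T (t - r) (g r - w s - L)) + norm (T (t - r) L - L)"
        by (rule norm_triangle_ineq)
      also have "\<dots> \<le> C * norm (g r - w s - L) + e'"
        using r d3(2)[OF _ tr] by (intro add_mono T_bound) auto
      also have "\<dots> \<le> C * (2 * e') + e'" using q C_pos by (intro add_right_mono mult_left_mono) auto
      also have "\<dots> = e" by (simp add: e'(2) algebra_simps)
      finally show "norm (?q r) \<le> e" .
    qed auto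
    then show "norm (u t - u s - (t - s) *\<^sub>R (g t0 - w t0)) \<le> e * (t - s)"
      using st by (simp add: L_def mult.commute)
  qed
qed

text \<open>T(e) v(t - e) is the integral stopped at t - e; it lies in D and tends to v(t). Its
  image under A is the truncated singular integral plus explicit terms and converges uniformly in t
  by Dini's condition. Closedness of A gives v(t) in D, uniformity gives continuity of A v.\<close>

lemma mild_domain:
  fixes D :: "'a set" and A :: "'a \<Rightarrow> 'a" and m :: "real \<Rightarrow> real"
  assumes clo: "closed_operator D A" and dom: "\<And>t x. t > 0 \<Longrightarrow> T t x \<in> D \<and> A (T t x) = E t x"
    and c: "a < c" "c \<le> b" and g: "continuous_on {a..b} g" and v: "continuous_on {a..b} v"
    and v_eq: "\<And>t. t \<in> {a..b} \<Longrightarrow> v t = integral {a..t} (\<lambda>s. T (t - s) (g s))"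
    and m: "\<And>s t. s \<in> {a..b} \<Longrightarrow> t \<in> {a..b} \<Longrightarrow> norm (g s - g t) \<le> m \<bar>t - s\<bar>"
    and m0: "\<And>r. r \<ge> 0 \<Longrightarrow> m r \<ge> 0"
    and k: "(\<lambda>r. m r / r) integrable_on {0..b - a}"
  shows "(\<forall>t\<in>{c..b}. v t \<in> D) \<and> continuous_on {c..b} (\<lambda>t. A (v t))"
proof -
  \<comment> \<open>\<open>Y e t\<close> is the integral of E(t - s)(g(s) - g(t)) up to t - e,
    written so that its first term is A T(e) v(t - e) and its continuity in t is evident.\<close>
  define Y where "Y e t = E e (v (t - e)) - T e (g t) + T (t - a) (g t)" for e t
  have Y: "((\<lambda>s. E (t - s) (g s - g t)) has_integral Y e t) {a..t - e}"
    if e: "0 < e" "e \<le> c - a" and t: "t \<in> {c..b}" for e t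
  proof -
    have te: "a \<le> t - e" "t - e \<in> {a..b}" using e t c by auto
    have gs: "continuous_on {a..t - e} g" by (rule continuous_on_subset[OF g]) (use te in auto)
    have "((E e \<circ> (\<lambda>s. T (t - e - s) (g s))) has_integral E e (v (t - e))) {a..t - e}"
      unfolding v_eq[OF te(2)]
      by (rule has_integral_linear[OF integrable_integral[OF mild_integrable[OF gs]] E_bounded_linear[OF e(1)]])
    then have "((\<lambda>s. E (t - s) (g s)) has_integral E e (v (t - e))) {a..t - e}"
    proof (rule has_integral_eq[rotated])
      fix s assume "s \<in> {a..t - e}"
      then show "(E e \<circ> (\<lambda>s. T (t - e - s) (g s))) s = E (t - s) (g s)"
        using E_T[of e "t - e - s" "g s"] e by simp
    qed
    from has_integral_diff[OF this has_integral_E[OF e(1) te(1), of "g t"]]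
    have "((\<lambda>s. E (t - s) (g s) - E (t - s) (g t)) has_integral Y e t) {a..t - e}"
      by (simp add: Y_def algebra_simps)
    then show ?thesis
      by (rule has_integral_eq[rotated]) (use e in \<open>simp add: linear_simps(2)[OF E_bounded_linear]\<close>)
  qed
  \<comment> \<open>The Dini tail: it bounds the change under further truncation independently of t,
    and vanishes as e -> 0 because an indefinite integral is continuous.\<close>
  define \<kappa> where "\<kappa> e = integral {0..e} (\<lambda>r. m r / r)" for e
  have est: "norm (Y e' t - Y e t) \<le> C * \<kappa> e"
    if e: "0 < e'" "e' \<le> e" "e \<le> c - a" and t: "t \<in> {c..b}" for e e' t
  proof -
    have ord: "a \<le> t - e" "t - e \<le> t - e'" using e t by auto
    note Y' = Y[of e' t] and Y = Y[of e t]
    have "integral {a..t - e} (\<lambda>s. E (t - s) (g s - g t)) + integral {t - e..t - e'} (\<lambda>s. E (t - s) (g s - g t))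
        = integral {a..t - e'} (\<lambda>s. E (t - s) (g s - g t))"
      by (rule Henstock_Kurzweil_Integration.integral_combine[OF ord])
         (use Y' e t in \<open>auto intro: has_integral_integrable\<close>)
    then have "Y e' t - Y e t = integral {t - e..t - e'} (\<lambda>s. E (t - s) (g s - g t))"
      using integral_unique[OF Y] integral_unique[OF Y'] e t by (simp add: algebra_simps)
    also have "norm \<dots> \<le> integral {t - e..t - e'} (\<lambda>s. C * (m (t - s) / (t - s)))"
    proof (rule integral_norm_bound_integral)
      show "(\<lambda>s. E (t - s) (g s - g t)) integrable_on {t - e..t - e'}"
        by (rule integrable_subinterval_real[OF has_integral_integrable[OF Y']]) (use e t c in auto)
      have "(\<lambda>r. m r / r) integrable_on {e'..e}"
        by (rule integrable_subinterval_real[OF k]) (use e t c in auto)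
      then show "(\<lambda>s. C * (m (t - s) / (t - s))) integrable_on {t - e..t - e'}"
        using has_integral_reflect_shift[of "\<lambda>r. m r / r" _ e' e t]
        by (intro integrable_on_mult_right) (auto simp: integrable_on_def)
      fix s assume s: "s \<in> {t - e..t - e'}"
      have "norm (E (t - s) (g s - g t)) \<le> C / (t - s) * norm (g s - g t)"
        using s e by (intro E_bound) auto
      also have "\<dots> \<le> C / (t - s) * m \<bar>t - s\<bar>"
        using s e t c C_pos by (intro mult_left_mono m) auto
      finally show "norm (E (t - s) (g s - g t)) \<le> C * (m (t - s) / (t - s))"
        using s e by simp
    qed
    also have "\<dots> = C * integral {e'..e} (\<lambda>r. m r / r)"
    proof -
      have "(\<lambda>r. m r / r) integrable_on {e'..e}"
        by (rule integrable_subinterval_real[OF k]) (use e t c in auto)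
      then show ?thesis
        by (rule integral_unique[OF has_integral_mult_right[OF has_integral_reflect_shift[OF integrable_integral]]])
    qed
    also have "\<dots> \<le> C * \<kappa> e"
      unfolding \<kappa>_def
    proof (intro mult_left_mono integral_subset_le)
      show "(\<lambda>r. m r / r) integrable_on {e'..e}" "(\<lambda>r. m r / r) integrable_on {0..e}"
        by (rule integrable_subinterval_real[OF k], use e t c in auto)+
    qed (use e C_pos m0 in auto)
    finally show ?thesis .
  qed
  have \<kappa>: "\<exists>d>0. \<forall>e. 0 \<le> e \<and> e < d \<longrightarrow> C * \<kappa> e < \<epsilon>" if "\<epsilon> > 0" for \<epsilon>
  proof -
    have "continuous_on {0..b - a} \<kappa>"
      unfolding \<kappa>_def[abs_def] by (rule indefinite_integral_continuous_1[OF k])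
    moreover have "0 \<in> {0..b - a}" "\<epsilon> / C > 0" using c that C_pos by auto
    ultimately obtain d where d: "d > 0" "\<And>e. e \<in> {0..b - a} \<Longrightarrow> dist e 0 < d \<Longrightarrow> dist (\<kappa> e) (\<kappa> 0) < \<epsilon> / C"
      unfolding continuous_on_iff by meson
    show ?thesis
    proof (intro exI[of _ "min d (b - a)"] conjI allI impI)
      fix e assume "0 \<le> e \<and> e < min d (b - a)"
      then have "dist (\<kappa> e) (\<kappa> 0) < \<epsilon> / C" by (intro d) auto
      then have "\<kappa> e < \<epsilon> / C" by (simp add: \<kappa>_def dist_real_def)
      then show "C * \<kappa> e < \<epsilon>" using C_pos by (simp add: field_simps)
    qed (use d c in auto)
  qed
  \<comment> \<open>A decreasing null sequence inside (0, c - a], so that t - e n \<ge> a for all t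
    \<ge> c.\<close>
  define e where "e n = (c - a) / real (Suc (Suc n))" for n
  have e: "0 < e n" "e n \<le> c - a" for n
    using c divide_left_mono[of 1 "real (Suc (Suc n))" "c - a"] by (simp_all add: e_def)
  have e_anti: "e n \<le> e l" if "l \<le> n" for l n
    unfolding e_def using that c by (intro divide_left_mono) auto
  have e_lim: "e \<longlonglongrightarrow> 0"
    unfolding e_def by (rule LIMSEQ_Suc[OF LIMSEQ_Suc[OF lim_const_over_n]])
  have "uniformly_Cauchy_on {c..b} (\<lambda>n. Y (e n))"
  proof (rule uniformly_Cauchy_onI')
    fix \<epsilon> :: real assume "\<epsilon> > 0"
    then obtain d where d: "d > 0" "\<And>e. 0 \<le> e \<Longrightarrow> e < d \<Longrightarrow> C * \<kappa> e < \<epsilon>" using \<kappa> by meson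
    have "eventually (\<lambda>n. e n < d) sequentially" using order_tendstoD(2)[OF e_lim d(1)] .
    then obtain N where N: "\<And>n. n \<ge> N \<Longrightarrow> e n < d" by (auto simp: eventually_sequentially)
    show "\<exists>M. \<forall>x\<in>{c..b}. \<forall>l\<ge>M. \<forall>n>l. dist (Y (e l) x) (Y (e n) x) < \<epsilon>"
    proof (intro exI[of _ N] ballI allI impI)
      fix x l n assume x: "x \<in> {c..b}" "N \<le> l" "l < n"
      have "norm (Y (e n) x - Y (e l) x) \<le> C * \<kappa> (e l)"
        by (rule est[OF e(1) e_anti e(2) x(1)]) (use x in auto)
      also have "\<dots> < \<epsilon>" using d(2)[of "e l"] N[OF x(2)] e(1)[of l] by auto
      finally show "dist (Y (e l) x) (Y (e n) x) < \<epsilon>" by (simp add: dist_norm norm_minus_commute)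
    qed
  qed
  then obtain Z where Z: "uniform_limit {c..b} (\<lambda>n. Y (e n)) Z sequentially"
    using Cauchy_uniformly_convergent uniformly_convergent_on_def by blast
  have gc: "continuous_on {c..b} g" by (rule continuous_on_subset[OF g]) (use c in auto)
  have Tg: "continuous_on {c..b} (\<lambda>t. T (t - a) (g t))"
    by (intro T_continuous_on_compose continuous_intros gc) (use c in auto)
  have contY: "continuous_on {c..b} (Y (e n))" for n
    unfolding Y_def
  proof (intro continuous_intros Tg)
    have "continuous_on {c..b} (\<lambda>t. v (t - e n))"
      by (rule continuous_on_compose2[OF v]) (use c e[of n] in \<open>auto intro!: continuous_intros\<close>)
    then show "continuous_on {c..b} (\<lambda>t. E (e n) (v (t - e n)))"
      by (rule bounded_linear.continuous_on[OF E_bounded_linear[OF e(1)]])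
    show "continuous_on {c..b} (\<lambda>t. T (e n) (g t))"
      by (rule bounded_linear.continuous_on[OF T_bounded_linear gc]) (use e(1)[of n] in auto)
  qed
  have contZ: "continuous_on {c..b} Z"
    by (rule uniform_limit_theorem[OF _ Z]) (auto intro!: contY always_eventually)
  have main: "v t \<in> D \<and> A (v t) = Z t + g t - T (t - a) (g t)" if t: "t \<in> {c..b}" for t
  proof -
    have YZ: "(\<lambda>n. Y (e n) t) \<longlonglongrightarrow> Z t" by (rule tendsto_uniform_limitI[OF Z t])
    have lim: "(\<lambda>n. T (e n) (h (e n))) \<longlonglongrightarrow> h 0" if h: "continuous_on {0..t - a} h" for h
    proof -
      have "continuous_on {0..t - a} (\<lambda>r. T r (h r))"
        by (intro T_continuous_on_compose h continuous_intros) auto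
      moreover have "e n \<in> {0..t - a}" for n using e[of n] t by auto
      ultimately have "(\<lambda>n. T (e n) (h (e n))) \<longlonglongrightarrow> T 0 (h 0)"
        using continuous_on_tendsto_compose[of "{0..t - a}" "\<lambda>r. T r (h r)" e 0] e_lim t c by auto
      then show ?thesis by (simp add: T_0)
    qed
    have "continuous_on {0..t - a} (\<lambda>r. v (t - r))"
      by (rule continuous_on_compose2[OF v]) (use t in \<open>auto intro!: continuous_intros\<close>)
    from lim[OF this] have 1: "(\<lambda>n. T (e n) (v (t - e n))) \<longlonglongrightarrow> v t" by simp
    have "(\<lambda>n. Y (e n) t + T (e n) (g t) - T (t - a) (g t)) \<longlonglongrightarrow> Z t + g t - T (t - a) (g t)"
      by (intro tendsto_intros YZ lim[of "\<lambda>_. g t"]) auto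
    then have 2: "(\<lambda>n. A (T (e n) (v (t - e n)))) \<longlonglongrightarrow> Z t + g t - T (t - a) (g t)"
      using dom e(1) by (simp add: Y_def)
    have "(v t, Z t + g t - T (t - a) (g t)) \<in> {(x, A x) |x. x \<in> D}"
    proof (rule closed_sequentially)
      show "closed {(x, A x) |x. x \<in> D}" using clo by (simp add: closed_operator_def)
      show "(T (e n) (v (t - e n)), A (T (e n) (v (t - e n)))) \<in> {(x, A x) |x. x \<in> D}" for n
        using dom e(1) by auto
      show "(\<lambda>n. (T (e n) (v (t - e n)), A (T (e n) (v (t - e n))))) \<longlonglongrightarrow> (v t, Z t + g t - T (t - a) (g t))"
        by (intro tendsto_Pair 1 2)
    qed
    then show ?thesis by auto
  qed
  have "continuous_on {c..b} (\<lambda>t. Z t + g t - T (t - a) (g t))"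
    by (intro continuous_intros contZ gc Tg)
  then have "continuous_on {c..b} (\<lambda>t. A (v t))"
    by (rule continuous_on_eq) (simp add: main)
  then show ?thesis using main by blast
qed

end

section \<open>Analytic semigroups given on a sector\<close>

lemma exp_minus_le:
  fixes x :: real
  assumes "x > 0"
  shows "exp (- x) \<le> 1 / x" and "exp (- x) \<le> 2 / x\<^sup>2"
proof -
  have "1 + x + x\<^sup>2 / 2 \<le> exp x" using assms by (intro exp_lower_Taylor_quadratic) auto
  moreover have "x\<^sup>2 > 0" using assms by simp
  ultimately have "x \<le> exp x" "x\<^sup>2 / 2 \<le> exp x" using assms by linarith+
  then have "1 / exp x \<le> 1 / x" "1 / exp x \<le> 1 / (x\<^sup>2 / 2)"
    using assms by (intro divide_left_mono; simp)+
  then show "exp (- x) \<le> 1 / x" "exp (- x) \<le> 2 / x\<^sup>2" by (simp_all add: exp_minus inverse_eq_divide)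
qed

text \<open>Continuity of \<open>Arg\<close> at 1 provides a ball around 1, and positive dilations
  preserve the sector; radii proportional to t are what turns Cauchy's estimate into C/t.\<close>

lemma open_sector_contains_balls:
  assumes "0 < \<theta>"
  shows "\<exists>\<kappa>. 0 < \<kappa> \<and> \<kappa> \<le> 1 \<and> (\<forall>t>0. ball (complex_of_real t) (\<kappa> * t) \<subseteq> open_sector \<theta>)"
proof -
  have "continuous (at 1) Arg" by (rule continuous_at_Arg) simp
  then obtain d where d: "d > 0" "\<And>z. dist z 1 < d \<Longrightarrow> dist (Arg z) (Arg 1) < \<theta>"
    using assms unfolding continuous_at_eps_delta by metis
  show ?thesis
  proof (intro exI[of _ "min d 1"] conjI allI impI subsetI)
    fix t :: real and z assume t: "t > 0" and z: "z \<in> ball (complex_of_real t) (min d 1 * t)"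
    have "norm (z / of_real t - 1) = norm (z - of_real t) / t"
    proof -
      have "z / of_real t - 1 = (z - of_real t) / of_real t" using t by (simp add: diff_divide_distrib)
      then show ?thesis using t by (simp add: norm_divide)
    qed
    also have "\<dots> < min d 1"
      unfolding pos_divide_less_eq[OF t] using z by (simp only: mem_ball dist_norm norm_minus_commute)
    finally have n: "norm (z / of_real t - 1) < min d 1" .
    then have "\<bar>Arg (z / of_real t)\<bar> < \<theta>" using d(2)[of "z / of_real t"] by (simp add: dist_norm)
    moreover have "Arg z = Arg (z / of_real t)"
      using Arg_times_of_real2[OF t, of "z / of_real t"] t by simp
    moreover have "z \<noteq> 0" using n by auto
    ultimately show "z \<in> open_sector \<theta>" by (simp add: open_sector_def)
  qed (use d in auto)
qed

text \<open>For small t, uniform boundedness near 0 and Cauchy's estimate bound the derivative by a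
  multiple of 1/t. For larger t it factors through a fixed small time t0, and exponential decay
  supplies 1/t.\<close>

lemma analytic_semigroup_decaying:
  fixes T :: "real \<Rightarrow> 'a::complex_banach \<Rightarrow> 'a"
  assumes ana: "analytic_semigroup T" and gen: "generator D (\<lambda>x. - A x) T"
    and decay: "exponentially_decaying T"
  shows "(\<exists>C. decaying_analytic T (\<lambda>t x. A (T t x)) C) \<and> (\<forall>t>0. \<forall>x. T t x \<in> D)"
proof -
  have bl: "bounded_linear (T t)" if "t \<ge> 0" for t
    using ana that by (auto simp: analytic_semigroup_def C0_semigroup_def bounded_clinear_def)
  have T0: "T 0 x = x" for x using ana by (auto simp: analytic_semigroup_def C0_semigroup_def)
  have add: "T (s + t) x = T s (T t x)" if "s \<ge> 0" "t \<ge> 0" for s t x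
    using ana that by (auto simp: analytic_semigroup_def C0_semigroup_def)
  have lim: "((\<lambda>t. T t x) \<longlongrightarrow> x) (at_right 0)" for x
    using ana by (auto simp: analytic_semigroup_def C0_semigroup_def)
  from ana[unfolded analytic_semigroup_def, THEN conjunct2] obtain \<theta> S where \<theta>: "0 < \<theta>"
    and S_T': "\<forall>t\<ge>0. S (complex_of_real t) = T t"
    and S_cl: "\<forall>z\<in>open_sector \<theta>. bounded_clinear (S z)"
    and S_add': "\<forall>z\<in>open_sector \<theta>. \<forall>z'\<in>open_sector \<theta>. \<forall>x. S (z + z') x = S z (S z' x)"
    and S_diff: "\<forall>x. \<forall>z\<in>open_sector \<theta>. \<exists>d. ((\<lambda>\<zeta>. S \<zeta> x) has_derivative (\<lambda>h. h *\<^sub>C d)) (at z)"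
    and S_lim': "\<forall>x. ((\<lambda>z. S z x) \<longlongrightarrow> x) (at 0 within open_sector \<theta>)"
    by (elim exE conjE) (rule that; assumption)
  have S_T: "S (complex_of_real t) = T t" if "t \<ge> 0" for t using S_T' that by blast
  have S_bl: "bounded_linear (S z)" and S_C: "S z (c *\<^sub>C x) = c *\<^sub>C S z x" if "z \<in> open_sector \<theta>" for z c x
    using S_cl that by (auto simp: bounded_clinear_def)
  have S_add: "S (z + z') x = S z (S z' x)" if "z \<in> open_sector \<theta>" "z' \<in> open_sector \<theta>" for z z' x
    using S_add' that by blast
  have S_lim: "((\<lambda>z. S z x) \<longlongrightarrow> x) (at 0 within open_sector \<theta>)" for x using S_lim' by blast
  obtain d where S_der: "\<And>x z. z \<in> open_sector \<theta> \<Longrightarrow> ((\<lambda>\<zeta>. S \<zeta> x) has_derivative (\<lambda>h. h *\<^sub>C d x z)) (at z)"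
    using S_diff by metis
  obtain \<kappa> where \<kappa>: "0 < \<kappa>" "\<kappa> \<le> 1" and ball: "\<And>t. t > 0 \<Longrightarrow> ball (complex_of_real t) (\<kappa> * t) \<subseteq> open_sector \<theta>"
    using open_sector_contains_balls[OF \<theta>] by metis
  have pos_sector: "complex_of_real t \<in> open_sector \<theta>" if "t > 0" for t
    using ball[OF that] \<kappa> that by auto
  have T_der: "((\<lambda>s. T s x) has_vector_derivative d x (complex_of_real t)) (at t)" if "t > 0" for t x
  proof -
    have "(complex_of_real has_derivative complex_of_real) (at t)"
      by (intro bounded_linear_imp_has_derivative bounded_linear_of_real)
    from has_derivative_compose[OF this S_der[OF pos_sector[OF that], of x]]
    have "((\<lambda>s. S (complex_of_real s) x) has_vector_derivative d x (complex_of_real t)) (at t)"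
      by (simp add: has_vector_derivative_def scaleC_of_real)
    then show ?thesis
      by (rule has_vector_derivative_transform_within_open[where S = "{0<..}"]) (use that S_T in auto)
  qed
  \<comment> \<open>The right difference quotient of h |-> T(h) at the point T(t) x is that of the
    orbit of x at time t, so the equivalence in \<open>generator\<close> yields membership and value
    together.\<close>
  have dom: "T t x \<in> D \<and> d x (complex_of_real t) = - A (T t x)" if "t > 0" for t x
  proof -
    let ?d = "d x (complex_of_real t)"
    have "((\<lambda>h. norm (T (t + h) x - T t x - h *\<^sub>R ?d) / norm h) \<longlongrightarrow> 0) (at 0)"
      using T_der[OF that, of x] unfolding has_vector_derivative_def has_derivative_at by blast
    then have "((\<lambda>h. norm ((1 / h) *\<^sub>R (T (h + t) x - T t x) - ?d)) \<longlongrightarrow> 0) (at 0)"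
    proof (rule Lim_transform_eventually)
      have "norm (T (t + h) x - T t x - h *\<^sub>R ?d) / norm h = norm ((1 / h) *\<^sub>R (T (h + t) x - T t x) - ?d)"
        if "h \<noteq> 0" for h
      proof -
        have "(1 / h) *\<^sub>R (T (h + t) x - T t x) - ?d = (1 / h) *\<^sub>R (T (t + h) x - T t x - h *\<^sub>R ?d)"
          using that by (simp add: scaleR_diff_right add.commute)
        then show ?thesis by simp
      qed
      then show "\<forall>\<^sub>F h in at 0. norm (T (t + h) x - T t x - h *\<^sub>R ?d) / norm h =
          norm ((1 / h) *\<^sub>R (T (h + t) x - T t x) - ?d)"
        by (auto simp: eventually_at_filter)
    qed
    then have "((\<lambda>h. (1 / h) *\<^sub>R (T (h + t) x - T t x)) \<longlongrightarrow> ?d) (at 0)"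
      by (rule LIM_zero_cancel[OF tendsto_norm_zero_cancel])
    then have "((\<lambda>h. (1 / h) *\<^sub>R (T (h + t) x - T t x)) \<longlongrightarrow> ?d) (at_right 0)"
      by (rule tendsto_mono[OF at_le[OF subset_UNIV]])
    moreover have "\<forall>\<^sub>F h in at_right 0. (1 / h) *\<^sub>R (T (h + t) x - T t x) = (1 / h) *\<^sub>R (T h (T t x) - T t x)"
      using add that by (auto simp: eventually_at_right_field intro!: exI[of _ 1])
    ultimately have "((\<lambda>h. (1 / h) *\<^sub>R (T h (T t x) - T t x)) \<longlongrightarrow> d x (complex_of_real t)) (at_right 0)"
      by (rule Lim_transform_eventually)
    then show ?thesis using gen unfolding generator_def by blast
  qed
  obtain C0 \<omega> where C0: "C0 > 0" "\<omega> > 0" and on: "\<And>t. t \<ge> 0 \<Longrightarrow> onorm (T t) \<le> C0 * exp (- \<omega> * t)"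
    using decay unfolding exponentially_decaying_def by metis
  have Tn: "norm (T t x) \<le> C0 * exp (- \<omega> * t) * norm x" if "t \<ge> 0" for t x
    using onorm[OF bl[OF that], of x] mult_right_mono[OF on[OF that] norm_ge_zero[of x]] by linarith
  have Tn1: "norm (T t x) \<le> C0 * norm x" if "t \<ge> 0" for t x
  proof -
    have "exp (- \<omega> * t) \<le> 1" using C0 that by simp
    then have "C0 * exp (- \<omega> * t) * norm x \<le> C0 * 1 * norm x"
      using C0 by (intro mult_right_mono mult_left_mono) auto
    then show ?thesis using Tn[OF that, of x] by simp
  qed
  \<comment> \<open>Differentiating the semigroup law in its second factor shows the derivative at z
    + t to be S(z) applied to a fixed vector. This gives the continuity of the derivative that
    Cauchy's estimate requires, and the factorisation at large times.\<close>
  have S_add_der: "d x (z + of_real t) = S z (d x (of_real t))"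
    if z: "z \<in> open_sector \<theta>" "z + of_real t \<in> open_sector \<theta>" and t: "t > 0" for x z t
  proof -
    have "((\<lambda>\<zeta>. z + \<zeta>) has_derivative (\<lambda>h. h)) (at (of_real t))"
      by (auto intro!: derivative_eq_intros)
    from has_derivative_compose[OF this S_der[OF z(2), of x]]
    have "((\<lambda>\<zeta>. S (z + \<zeta>) x) has_derivative (\<lambda>h. h *\<^sub>C d x (z + of_real t))) (at (of_real t))" by simp
    then have "((\<lambda>\<zeta>. S z (S \<zeta> x)) has_derivative (\<lambda>h. h *\<^sub>C d x (z + of_real t))) (at (of_real t))"
    proof (rule has_derivative_transform_within_open[where s = "ball (of_real t) (\<kappa> * t)"])
      show "S (z + \<zeta>) x = S z (S \<zeta> x)" if "\<zeta> \<in> ball (of_real t) (\<kappa> * t)" for \<zeta>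
        using ball[OF t] that z by (intro S_add) auto
    qed (use \<kappa> t in auto)
    moreover have "((\<lambda>\<zeta>. S z (S \<zeta> x)) has_derivative (\<lambda>h. S z (h *\<^sub>C d x (of_real t)))) (at (of_real t))"
      by (rule bounded_linear.has_derivative[OF S_bl[OF z(1)] S_der[OF pos_sector[OF t]]])
    ultimately have "(\<lambda>h. h *\<^sub>C d x (z + of_real t)) = (\<lambda>h. S z (h *\<^sub>C d x (of_real t)))"
      by (rule has_derivative_unique)
    from fun_cong[OF this, of 1] show ?thesis by (simp add: S_C[OF z(1)] scaleC_one)
  qed
  \<comment> \<open>The n chosen exceeds both |x| + 1 and the inverse of the radius on which S(z) x
    is within 1 of x, so radius 1/(n + 1) and bound n are valid together.\<close>
  have "\<exists>n. \<forall>z\<in>open_sector \<theta> \<inter> ball 0 (1 / real (Suc n)). norm (S z x) \<le> real n" for x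
  proof -
    have "\<forall>\<^sub>F z in at 0 within open_sector \<theta>. dist (S z x) x < 1"
      using tendstoD[OF S_lim[of x], of 1] by simp
    then obtain \<delta> where \<delta>: "\<delta> > 0" "\<And>z. z \<in> open_sector \<theta> \<Longrightarrow> z \<noteq> 0 \<Longrightarrow> dist z 0 < \<delta> \<Longrightarrow> dist (S z x) x < 1"
      unfolding eventually_at by metis
    obtain n :: nat where n: "real n \<ge> max (norm x + 1) (1 / \<delta>)" using real_arch_simple by blast
    have "norm (S z x) \<le> real n" if z: "z \<in> open_sector \<theta> \<inter> ball 0 (1 / real (Suc n))" for z
    proof -
      have "1 / \<delta> < real (Suc n)" using n by linarith
      then have "1 / real (Suc n) < \<delta>" using \<delta>(1) by (simp add: field_simps del: of_nat_Suc)
      then have "dist (S z x) x < 1" using z by (intro \<delta>(2)) (auto simp: open_sector_def)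
      then have "norm (S z x) \<le> norm x + 1" using norm_triangle_sub[of "S z x" x] by (simp add: dist_norm)
      then show ?thesis using n by linarith
    qed
    then show ?thesis by blast
  qed
  then obtain n0 C1 where C1: "\<And>z x. z \<in> open_sector \<theta> \<inter> ball 0 (1 / real (Suc n0)) \<Longrightarrow> norm (S z x) \<le> C1 * norm x"
    using uniform_boundedness_decreasing[of "\<lambda>n. open_sector \<theta> \<inter> ball 0 (1 / real (Suc n))" S] S_bl by (metis IntD1)
  define \<delta> where "\<delta> = 1 / real (Suc n0)"
  have \<delta>: "\<delta> > 0" by (simp add: \<delta>_def)
  define C2 where "C2 = 2 * \<bar>C1\<bar> / \<kappa>"
  have C2: "C2 \<ge> 0" using \<kappa> by (simp add: C2_def)
  have small: "norm (d x (of_real t)) \<le> C2 / t * norm x" if t: "t > 0" "t < \<delta> / 2" for t x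
  proof -
    \<comment> \<open>Half of the admissible radius: after subtracting \<kappa> t / 2, points of the
      smaller ball remain in the ball of radius \<kappa> t, hence in the sector.\<close>
    let ?R = "\<kappa> * t / 2" let ?t2 = "\<kappa> * t / 2"
    have sub: "ball (complex_of_real t) ?R \<subseteq> ball (complex_of_real t) (\<kappa> * t)"
      using \<kappa> t by (intro subset_ball) auto
    have sec: "z \<in> open_sector \<theta>" "z - of_real ?t2 \<in> open_sector \<theta>" if "z \<in> ball (complex_of_real t) ?R" for z
    proof -
      show "z \<in> open_sector \<theta>" using that sub ball[OF t(1)] by blast
      have "norm (complex_of_real t - (z - of_real ?t2)) \<le> norm (complex_of_real t - z) + norm (complex_of_real ?t2)"
        using norm_triangle_ineq[of "complex_of_real t - z" "of_real ?t2"] by (simp add: algebra_simps)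
      also have "norm (complex_of_real ?t2) = \<kappa> * t / 2" using \<kappa> t by (simp del: of_real_divide of_real_mult)
      finally have "z - of_real ?t2 \<in> ball (complex_of_real t) (\<kappa> * t)"
        using that by (simp add: dist_norm del: of_real_divide of_real_mult)
      then show "z - of_real ?t2 \<in> open_sector \<theta>" using ball[OF t(1)] by blast
    qed
    have "norm (d x (of_real t)) \<le> (\<bar>C1\<bar> * norm x) / ?R"
    proof (rule cauchy_estimate_scaleC)
      show "?R > 0" using \<kappa> t by simp
      fix z assume z: "z \<in> ball (complex_of_real t) ?R"
      show "((\<lambda>\<zeta>. S \<zeta> x) has_derivative (\<lambda>h. h *\<^sub>C d x z)) (at z)" by (rule S_der[OF sec(1)[OF z]])
      have "norm z \<le> norm (complex_of_real t) + norm (z - of_real t)"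
        using norm_triangle_sub by blast
      also have "\<dots> < t + \<kappa> * t" using z sub t by (auto simp: dist_norm norm_minus_commute)
      also have "\<dots> \<le> 2 * t" using \<kappa> t by (simp add: mult_le_cancel_right1)
      also have "\<dots> < \<delta>" using t by simp
      finally have "z \<in> open_sector \<theta> \<inter> ball 0 (1 / real (Suc n0))" using sec(1)[OF z] by (simp add: \<delta>_def)
      then have "norm (S z x) \<le> C1 * norm x" by (rule C1)
      also have "\<dots> \<le> \<bar>C1\<bar> * norm x" by (intro mult_right_mono) auto
      finally show "norm (S z x) \<le> \<bar>C1\<bar> * norm x" .
    next
      have t2: "?t2 > 0" using \<kappa> t by simp
      have contS: "continuous_on (open_sector \<theta>) (\<lambda>z. S z y)" for y
        using S_der by (meson continuous_at_imp_continuous_on has_derivative_continuous)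
      have "continuous_on (ball (complex_of_real t) ?R) (\<lambda>z. S (z - of_real ?t2) (d x (of_real ?t2)))"
        by (rule continuous_on_compose2[OF contS])
           (use sec in \<open>auto intro!: continuous_intros simp del: of_real_divide of_real_mult\<close>)
      then show "continuous_on (ball (complex_of_real t) ?R) (d x)"
      proof (rule continuous_on_eq)
        fix z assume z: "z \<in> ball (complex_of_real t) ?R"
        show "S (z - of_real ?t2) (d x (of_real ?t2)) = d x z"
          using S_add_der[OF sec(2)[OF z] _ t2, of x] sec(1)[OF z] by simp
      qed
    qed
    also have "\<dots> = C2 / t * norm x" using \<kappa> t by (simp add: C2_def field_simps)
    finally show ?thesis .
  qed
  \<comment> \<open>t0 < \<delta>/2 makes \<open>small\<close> applicable at t0, and t \<ge>
    \<delta>/2 gives t - t0 \<ge> t/2.\<close>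
  define t0 where "t0 = \<delta> / 4"
  have t0: "t0 > 0" "t0 < \<delta> / 2" using \<delta> by (auto simp: t0_def)
  define C3 where "C3 = C0 * (2 / \<omega>) * (C2 / t0)"
  have C3: "C3 \<ge> 0" using C0 C2 t0 by (simp add: C3_def)
  have large: "norm (d x (of_real t)) \<le> C3 / t * norm x" if t: "t \<ge> \<delta> / 2" for t x
  proof -
    have tt: "t - t0 > 0" "t - t0 \<ge> t / 2" "t > 0" using t \<delta> by (auto simp: t0_def)
    have "d x (of_real (t - t0) + of_real t0) = S (of_real (t - t0)) (d x (of_real t0))"
      by (rule S_add_der) (use pos_sector[OF tt(1)] pos_sector[OF tt(3)] t0 in auto)
    then have "d x (of_real t) = T (t - t0) (d x (of_real t0))" using S_T[of "t - t0"] tt by simp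
    then have "norm (d x (of_real t)) \<le> C0 * exp (- \<omega> * (t - t0)) * norm (d x (of_real t0))"
      using Tn[of "t - t0"] tt by simp
    also have "\<dots> \<le> C0 * (2 / (\<omega> * t)) * (C2 / t0 * norm x)"
    proof (intro mult_mono mult_left_mono small t0)
      have "exp (- (\<omega> * (t - t0))) \<le> 1 / (\<omega> * (t - t0))" using C0 tt by (intro exp_minus_le) auto
      also have "\<dots> \<le> 1 / (\<omega> * (t / 2))" using C0 tt by (intro divide_left_mono mult_left_mono mult_pos_pos) auto
      finally show "exp (- \<omega> * (t - t0)) \<le> 2 / (\<omega> * t)" by simp
    qed (use C0 tt in auto)
    also have "\<dots> = C3 / t * norm x" by (simp add: C3_def mult_ac)
    finally show ?thesis .
  qed
  define C where "C = C0 + C0 * (2 / \<omega>\<^sup>2) + C2 + C3"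
  have C: "C > 0" "C0 \<le> C" "C0 * (2 / \<omega>\<^sup>2) \<le> C" "C2 \<le> C" "C3 \<le> C"
    using C0 C2 C3 by (auto simp: C_def intro!: add_pos_nonneg add_nonneg_nonneg)
  have "decaying_analytic T (\<lambda>t x. A (T t x)) C"
  proof (rule decaying_analytic.intro)
    show "bounded_linear (T t)" if "t \<ge> 0" for t by (rule bl[OF that])
    show "norm (T t x) \<le> C * norm x" if "t \<ge> 0" for t x
      using Tn1[OF that, of x] mult_right_mono[OF C(2) norm_ge_zero[of x]] by linarith
    show "norm (T t x) \<le> C / t\<^sup>2 * norm x" if "t > 0" for t x
    proof -
      have "exp (- \<omega> * t) \<le> 2 / (\<omega> * t)\<^sup>2" using exp_minus_le(2)[of "\<omega> * t"] C0 that by simp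
      then have "C0 * exp (- \<omega> * t) * norm x \<le> C0 * (2 / (\<omega> * t)\<^sup>2) * norm x"
        using C0 by (intro mult_right_mono mult_left_mono) auto
      also have "\<dots> = C0 * (2 / \<omega>\<^sup>2) / t\<^sup>2 * norm x" by (simp add: power_mult_distrib)
      also have "\<dots> \<le> C / t\<^sup>2 * norm x" using C by (intro mult_right_mono divide_right_mono) auto
      finally show ?thesis using Tn[of t x] that by simp
    qed
    show "((\<lambda>s. T s x) has_vector_derivative - A (T t x)) (at t)" if "t > 0" for t x
      using T_der[OF that, of x] dom[OF that, of x] by simp
    show "norm (A (T t x)) \<le> C / t * norm x" if t: "t > 0" for t x
    proof -
      have eq: "norm (A (T t x)) = norm (d x (of_real t))" using dom[OF t, of x] by simp
      have "C2 / t * norm x \<le> C / t * norm x" "C3 / t * norm x \<le> C / t * norm x"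
        using C t by (auto intro!: mult_right_mono divide_right_mono)
      then show ?thesis
        unfolding eq using small[OF t, of x] large[of t x] by linarith
    qed
  qed (use T0 add lim C in auto)
  then show ?thesis using dom by blast
qed

section \<open>The initial value problem\<close>

context decaying_analytic
begin

section \<open>The space X^a and continuity in its norm\<close>

lemma frac_power_neg_frac_power:
  assumes "0 \<le> a" "a < 1"
  shows "frac_power T a (neg_frac_power T a p) = p"
  by (simp add: frac_power_def inv_f_f[OF inj_neg_frac_power[OF assms]])

lemma frac_norm_diff:
  assumes "0 \<le> a" "a < 1"
  shows "frac_norm T a (neg_frac_power T a p - neg_frac_power T a q) = norm (p - q)"
proof -
  have "neg_frac_power T a p - neg_frac_power T a q = neg_frac_power T a (p - q)"
    using neg_frac_power_bounded_linear[of a] assms by (simp add: linear_simps)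
  then show ?thesis by (simp add: frac_norm_def frac_power_neg_frac_power[OF assms])
qed

text \<open>The type \<open>metric\<close> returns the intended carrier and distance only for a
  genuine metric space. Symmetry is demanded of all points, also when x - y lies outside the range
  of A^-a.\<close>

lemma Metric_space_frac:
  assumes a: "0 \<le> a" "a < 1"
  shows "Metric_space (frac_dom T a) (\<lambda>x y. frac_norm T a (x - y))"
proof
  have bl: "bounded_linear (neg_frac_power T a)" by (rule neg_frac_power_bounded_linear) (use a in auto)
  fix x y z :: 'a
  show "0 \<le> frac_norm T a (x - y)" by (simp add: frac_norm_def)
  show "frac_norm T a (x - y) = frac_norm T a (y - x)"
  proof (cases "x - y \<in> frac_dom T a")
    case True
    then obtain p where p: "x - y = neg_frac_power T a p" by (auto simp: frac_dom_def)
    then have "y - x = neg_frac_power T a (- p)" using bl by (simp add: linear_simps flip: p)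
    then show ?thesis using p by (simp add: frac_norm_def frac_power_neg_frac_power[OF a])
  next
    case False
    \<comment> \<open>Off the range of \<open>A\<^sup>-\<^sup>\<alpha>\<close>, its inverse returns the same junk value at both points.\<close>
    have "y - x \<notin> frac_dom T a"
    proof
      assume "y - x \<in> frac_dom T a"
      then obtain p where p: "y - x = neg_frac_power T a p" by (auto simp: frac_dom_def)
      have "neg_frac_power T a (- p) = x - y" using bl by (simp add: linear_simps flip: p)
      then show False using False by (metis frac_dom_def rangeI)
    qed
    then have "(\<lambda>p. neg_frac_power T a p = x - y) = (\<lambda>p. neg_frac_power T a p = y - x)"
      using False by (intro ext) (metis frac_dom_def rangeI)
    then have "frac_power T a (x - y) = frac_power T a (y - x)"
      by (simp add: frac_power_def inv_into_def)
    then show ?thesis by (simp add: frac_norm_def)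
  qed
  assume "x \<in> frac_dom T a" "y \<in> frac_dom T a"
  then obtain p q where x: "x = neg_frac_power T a p" and y: "y = neg_frac_power T a q"
    by (auto simp: frac_dom_def)
  show "frac_norm T a (x - y) = 0 \<longleftrightarrow> x = y"
    unfolding x y frac_norm_diff[OF a] using inj_neg_frac_power[OF a] by (auto dest: injD)
  assume "z \<in> frac_dom T a"
  then obtain r where z: "z = neg_frac_power T a r" by (auto simp: frac_dom_def)
  show "frac_norm T a (x - z) \<le> frac_norm T a (x - y) + frac_norm T a (y - z)"
    unfolding x y z frac_norm_diff[OF a] using norm_triangle_ineq[of "p - q" "q - r"] by simp
qed

lemma frac_space_mspace:
  assumes "0 \<le> a" "a < 1"
  shows "mspace (frac_space T a) = frac_dom T a"
    and "mtopology_of (frac_space T a) = Metric_space.mtopology (frac_dom T a) (\<lambda>x y. frac_norm T a (x - y))"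
  using Metric_space_frac[OF assms]
  by (simp_all add: frac_space_def mtopology_of_def Metric_space.mspace_metric Metric_space.mdist_metric)

text \<open>Continuity into X^a is traded for norm continuity of t |-> A^a u(t), the function p of
  the Hoelder estimate.\<close>

lemma frac_power_continuous_on:
  fixes X :: "real set"
  assumes a: "0 \<le> a" "a < 1" and u: "continuous_map (top_of_set X) (mtopology_of (frac_space T a)) u"
  shows "continuous_on X (\<lambda>t. frac_power T a (u t))"
    and "t \<in> X \<Longrightarrow> u t = neg_frac_power T a (frac_power T a (u t))"
proof -
  interpret M: Metric_space "frac_dom T a" "\<lambda>x y. frac_norm T a (x - y)" by (rule Metric_space_frac[OF a])
  have u': "continuous_map (top_of_set X) M.mtopology u" using u by (simp add: frac_space_mspace[OF a])
  have range: "u t = neg_frac_power T a (frac_power T a (u t))" if "t \<in> X" for t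
  proof -
    have "u t \<in> frac_dom T a"
      using continuous_map_funspace[OF u'] that by (auto simp: Pi_iff)
    then show ?thesis by (simp add: frac_dom_def frac_power_def f_inv_into_f)
  qed
  show "t \<in> X \<Longrightarrow> u t = neg_frac_power T a (frac_power T a (u t))" by (rule range)
  have norm_eq: "frac_norm T a (u t - u s) = norm (frac_power T a (u t) - frac_power T a (u s))"
    if "t \<in> X" "s \<in> X" for s t
    using frac_norm_diff[OF a, of "frac_power T a (u t)" "frac_power T a (u s)"]
      range[OF that(1)] range[OF that(2)] by simp
  show "continuous_on X (\<lambda>t. frac_power T a (u t))"
    unfolding continuous_on_iff
  proof (intro ballI allI impI)
    fix t e :: real assume t: "t \<in> X" and "e > 0"
    then have "\<exists>U. openin (top_of_set X) U \<and> t \<in> U \<and> (\<forall>s\<in>U. u s \<in> M.mball (u t) e)"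
      using u'[unfolded M.continuous_map_to_metric] by simp
    then obtain U where U: "openin (top_of_set X) U" "t \<in> U" "\<And>s. s \<in> U \<Longrightarrow> u s \<in> M.mball (u t) e"
      by blast
    then obtain d where d: "d > 0" "\<And>s. s \<in> X \<Longrightarrow> dist s t < d \<Longrightarrow> s \<in> U"
      unfolding openin_euclidean_subtopology_iff by blast
    show "\<exists>d>0. \<forall>s\<in>X. dist s t < d \<longrightarrow> dist (frac_power T a (u s)) (frac_power T a (u t)) < e"
    proof (intro exI[of _ d] conjI ballI impI d(1))
      fix s assume s: "s \<in> X" "dist s t < d"
      then have "frac_norm T a (u t - u s) < e" using U(3)[OF d(2)] by (simp add: M.in_mball)
      then show "dist (frac_power T a (u s)) (frac_power T a (u t)) < e"
        using norm_eq[OF t s(1)] by (simp add: dist_norm norm_minus_commute)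
    qed
  qed
qed

end

theorem theorem2p6:
  fixes D :: "'a::complex_banach set"
    and A :: "'a \<Rightarrow> 'a"
    and T :: "real \<Rightarrow> 'a \<Rightarrow> 'a"
    and f :: "real \<Rightarrow> 'a \<Rightarrow> (real \<Rightarrow> 'a) \<Rightarrow> 'a"
    and w :: "real \<Rightarrow> real"
    and \<sigma> \<tau> \<alpha> \<beta> t\<^sub>1 :: real
    and w\<^sub>0 :: 'a
    and u :: "real \<Rightarrow> 'a"
  assumes "sectorial D A"
    and "\<forall>c\<in>resolvent_set D (\<lambda>x. - A x). compact_operator (resolvent D (\<lambda>x. - A x) c)"
    and "analytic_semigroup T"
    and "generator D (\<lambda>x. - A x) T"
    and "exponentially_decaying T"
    and "\<tau> > 0" and "0 \<le> \<alpha>" and "\<alpha> \<le> 1" and "0 < \<beta>" and "\<beta> < 1 - \<alpha>"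
    and "continuous_map
           (prod_topology (top_of_set {\<sigma>..<\<sigma> + \<tau>})
             (prod_topology (mtopology_of (frac_space T \<alpha>)) (mtopology_of (path_space T \<alpha> \<sigma> \<tau>))))
           euclidean (\<lambda>(t, x, v). f t x v)"
    and "\<forall>v\<in>mspace (path_space T \<alpha> \<sigma> \<tau>). \<forall>t\<in>{\<sigma>..<\<sigma> + \<tau>}. \<forall>s\<in>{\<sigma>..<\<sigma> + \<tau>}.
           norm (f t (v t) (history \<sigma> \<tau> v t) - f s (v s) (history \<sigma> \<tau> v s))
             \<le> w (frac_norm T \<alpha> (v t - v s)) + w (\<bar>t - s\<bar> powr \<beta>)"
    and "w ` {0..} \<subseteq> {0..}" and "mono_on {0..} w" and "continuous_on {0..} w" and "w 0 = 0"
    and "\<forall>t>0. set_integrable lborel {0<..t} (\<lambda>r. w (r powr \<beta>) / r)"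
    and "w\<^sub>0 \<in> frac_dom T \<alpha>"
    and "0 < t\<^sub>1" and "t\<^sub>1 < \<tau>"
    and "continuous_map (top_of_set {\<sigma>..\<sigma> + t\<^sub>1}) (mtopology_of (frac_space T \<alpha>)) u"
    and "\<forall>t\<in>{\<sigma>..\<sigma> + t\<^sub>1}.
           u t = T (t - \<sigma>) w\<^sub>0 +
             integral {\<sigma>..t} (\<lambda>s. T (t - s) (f s (u s) (history \<sigma> \<tau> u s)))"
  shows "strong_solution D A f \<sigma> \<tau> w\<^sub>0 t\<^sub>1 u"
proof -
  note ana = assms(3) and gen = assms(4) and decay = assms(5)
  note \<alpha> = assms(7) and \<beta> = assms(9,10) and modulus = assms(12)
  note w_nonneg = assms(13) and w_mono = assms(14) and w_cont = assms(15) and w_0 = assms(16)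
  note dini = assms(17) and t\<^sub>1 = assms(19,20) and u_map = assms(21) and mild = assms(22)
  have \<alpha>1: "\<alpha> < 1" "\<alpha> \<le> 1" using \<beta> by auto
  define E where "E t x = A (T t x)" for t x
  obtain C where "decaying_analytic T E C" and TD: "\<And>t x. t > 0 \<Longrightarrow> T t x \<in> D"
    using analytic_semigroup_decaying[OF ana gen decay] unfolding E_def[abs_def] by blast
  then interpret decaying_analytic T E C by simp
  define b where "b = \<sigma> + t\<^sub>1"
  have b: "\<sigma> < b" "b < \<sigma> + \<tau>" using t\<^sub>1 by (auto simp: b_def)
  define p where "p t = frac_power T \<alpha> (u t)" for t
  have p_cont: "continuous_on {\<sigma>..b} p" and u_p: "\<And>t. t \<in> {\<sigma>..b} \<Longrightarrow> u t = neg_frac_power T \<alpha> (p t)"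
    using frac_power_continuous_on[OF \<alpha> \<alpha>1(1) u_map] by (auto simp: p_def[abs_def] b_def)
  have u_cont: "continuous_on {\<sigma>..b} u"
    by (rule continuous_on_eq[OF bounded_linear.continuous_on[OF neg_frac_power_bounded_linear[OF \<alpha> \<alpha>1(2)] p_cont]])
       (simp add: u_p)
  define g where "g s = f s (u s) (history \<sigma> \<tau> u s)" for s
  have u_mild: "u t = T (t - \<sigma>) w\<^sub>0 + integral {\<sigma>..t} (\<lambda>s. T (t - s) (g s))" if "t \<in> {\<sigma>..b}" for t
    using mild that by (simp add: g_def b_def)
  have w_le: "w x \<le> w y" if "0 \<le> x" "x \<le> y" for x y
    using w_mono that by (auto simp: mono_on_def)
  have w_ge: "w x \<ge> 0" if "0 \<le> x" for x using w_nonneg that by auto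

  \<comment> \<open>The modulus condition speaks of paths on the whole interval, while u is known up
    to b only. Freezing u at b gives such a path with the same values and histories at all t \<le>
    b.\<close>
  define v where "v = restrict (\<lambda>r. u (min r b)) {\<sigma>..\<sigma> + \<tau>}"
  have v_u: "v t = u t" "history \<sigma> \<tau> v t = history \<sigma> \<tau> u t" if "t \<in> {\<sigma>..b}" for t
  proof -
    show "v t = u t" using that b by (auto simp: v_def)
    show "history \<sigma> \<tau> v t = history \<sigma> \<tau> u t"
      unfolding history_def by (rule restrict_ext) (use that b in \<open>auto simp: v_def min_def\<close>)
  qed
  have "continuous_map (top_of_set {\<sigma>..\<sigma> + \<tau>}) (top_of_set {\<sigma>..b}) (\<lambda>r. min r b)"
    using b by (auto simp: continuous_map_in_subtopology intro!: continuous_intros)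
  from continuous_map_compose[OF this u_map[folded b_def]]
  have "continuous_map (top_of_set {\<sigma>..\<sigma> + \<tau>}) (mtopology_of (frac_space T \<alpha>)) v"
    by (rule continuous_map_eq) (simp add: v_def)
  moreover have "compactin (top_of_set {\<sigma>..\<sigma> + \<tau>}) (topspace (top_of_set {\<sigma>..\<sigma> + \<tau>}))"
    by (simp add: compactin_subtopology)
  ultimately have v: "v \<in> mspace (path_space T \<alpha> \<sigma> \<tau>)"
    unfolding path_space_def
    by (subst compactin_mspace_cfunspace)
       (auto simp: v_def dest!: continuous_map_funspace)
  have g_mod: "norm (g t - g s) \<le> w (norm (p t - p s)) + w (\<bar>t - s\<bar> powr \<beta>)"
    if "t \<in> {\<sigma>..b}" "s \<in> {\<sigma>..b}" for s t
  proof -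
    have "t \<in> {\<sigma>..<\<sigma> + \<tau>}" "s \<in> {\<sigma>..<\<sigma> + \<tau>}" using that b by auto
    then have "norm (f t (v t) (history \<sigma> \<tau> v t) - f s (v s) (history \<sigma> \<tau> v s))
        \<le> w (frac_norm T \<alpha> (v t - v s)) + w (\<bar>t - s\<bar> powr \<beta>)"
      using modulus v by blast
    moreover have "frac_norm T \<alpha> (u t - u s) = norm (p t - p s)"
      unfolding u_p[OF that(1)] u_p[OF that(2)] by (rule frac_norm_diff[OF \<alpha> \<alpha>1(1)])
    ultimately show ?thesis
      unfolding g_def by (simp only: v_u[OF that(1)] v_u[OF that(2)])
  qed
  \<comment> \<open>The modulus \<open>g_mod\<close> tends to 0 as s -> t, since p is continuous and
    w is continuous with w(0) = 0.\<close>
  have g_cont: "continuous_on {\<sigma>..b} g"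
    unfolding continuous_on_def
  proof
    fix t assume t: "t \<in> {\<sigma>..b}"
    let ?F = "at t within {\<sigma>..b}"
    have w_lim: "((\<lambda>s. w (h s)) \<longlongrightarrow> 0) ?F" if "(h \<longlongrightarrow> 0) ?F" "\<And>s. h s \<ge> 0" for h
      using continuous_on_tendsto_compose[OF w_cont that(1)] that(2) w_0 by simp
    have "((\<lambda>s. norm (p s - p t)) \<longlongrightarrow> norm (p t - p t)) ?F"
      using p_cont t by (intro tendsto_intros) (auto simp: continuous_on_def)
    then have 1: "((\<lambda>s. w (norm (p s - p t))) \<longlongrightarrow> 0) ?F" by (intro w_lim) auto
    have "((\<lambda>s. \<bar>s - t\<bar> powr \<beta>) \<longlongrightarrow> \<bar>t - t\<bar> powr \<beta>) ?F"
      using \<beta> by (intro tendsto_powr2 tendsto_intros) auto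
    then have 2: "((\<lambda>s. w (\<bar>s - t\<bar> powr \<beta>)) \<longlongrightarrow> 0) ?F" by (intro w_lim) auto
    have "((\<lambda>s. g s - g t) \<longlongrightarrow> 0) ?F"
    proof (rule Lim_null_comparison)
      show "\<forall>\<^sub>F s in ?F. norm (g s - g t) \<le> w (norm (p s - p t)) + w (\<bar>s - t\<bar> powr \<beta>)"
        using g_mod t by (auto simp: eventually_at_filter)
      show "((\<lambda>s. w (norm (p s - p t)) + w (\<bar>s - t\<bar> powr \<beta>)) \<longlongrightarrow> 0) ?F"
        using tendsto_add[OF 1 2] by simp
    qed
    then show "(g \<longlongrightarrow> g t) ?F" by (simp add: LIM_zero_iff)
  qed
  have "bounded (g ` {\<sigma>..b})"
    by (intro compact_imp_bounded compact_continuous_image g_cont) simp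
  then obtain G where G: "\<And>s. s \<in> {\<sigma>..b} \<Longrightarrow> norm (g s) \<le> G" unfolding bounded_iff by blast
  have restart: "u t = T (t - s) (u s) + integral {s..t} (\<lambda>r. T (t - r) (g r))"
    if "\<sigma> \<le> s" "s \<le> t" "t \<le> b" for s t
    by (rule mild_restart[OF that(1,2) continuous_on_subset[OF g_cont]]) (use that u_mild in auto)

  have regular: "(\<forall>t\<in>{c..b}. u t \<in> D) \<and> continuous_on {c..b} (\<lambda>t. A (u t))" if c: "\<sigma> < c" "c \<le> b" for c
  proof -
    \<comment> \<open>The Hoelder bound holds only away from \<sigma>, and
      \<open>mild_domain\<close> needs room to the left of c: the midpoint is the new initial
      time.\<close>
    define a where "a = (\<sigma> + c) / 2"
    have a: "\<sigma> < a" "a < c" using c by (auto simp: a_def)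
    obtain L0 where L0: "\<And>s t. a \<le> s \<Longrightarrow> s \<le> t \<Longrightarrow> t \<le> b \<Longrightarrow> norm (p t - p s) \<le> L0 * (t - s) powr \<beta>"
      using mild_hoelder[OF \<alpha> \<beta>(1) _ a(1) g_cont G u_mild u_p] \<beta> by auto
    \<comment> \<open>L \<ge> 1 lets w(L r^\<beta>) dominate both terms of the modulus, which merge
      into the factor 2 of m.\<close>
    define L where "L = max L0 1"
    have L: "L \<ge> 1" "L0 \<le> L" by (auto simp: L_def)
    \<comment> \<open>L r^\<beta> = (q r)^\<beta>, so Dini's condition for m is the given one after
      the dilation by q.\<close>
    define q where "q = L powr (1 / \<beta>)"
    have q: "q > 0" and qL: "q powr \<beta> = L" using L \<beta> by (auto simp: q_def powr_powr)
    define m where "m r = 2 * w (L * r powr \<beta>)" for r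
    have g_m: "norm (g s - g t) \<le> m \<bar>t - s\<bar>" if st: "s \<in> {a..b}" "t \<in> {a..b}" for s t
    proof -
      have "norm (p s - p t) \<le> L0 * \<bar>t - s\<bar> powr \<beta>"
        using L0[of s t] L0[of t s] st by (cases "s \<le> t") (auto simp: norm_minus_commute)
      also have "\<dots> \<le> L * \<bar>t - s\<bar> powr \<beta>" using L by (intro mult_right_mono) auto
      finally have "w (norm (p s - p t)) \<le> w (L * \<bar>t - s\<bar> powr \<beta>)" by (intro w_le) auto
      moreover have "w (\<bar>s - t\<bar> powr \<beta>) \<le> w (L * \<bar>t - s\<bar> powr \<beta>)"
        using L mult_right_mono[of 1 L "\<bar>t - s\<bar> powr \<beta>"] by (intro w_le) (auto simp: abs_minus_commute)
      ultimately show ?thesis using g_mod[of s t] st a by (simp add: m_def)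
    qed
    have k: "(\<lambda>r. m r / r) integrable_on {0..b - a}"
    proof -
      let ?h = "\<lambda>r. w (r powr \<beta>) / r"
      have "?h integrable_on {0<..q * (b - a)}"
        using dini q a c by (intro set_borel_integral_eq_integral(1)) auto
      then have "?h integrable_on {0..q * (b - a)}"
        by (rule integrable_spike_set)
           (rule negligible_subset[OF negligible_sing[of 0]], force)+
      then obtain i where i: "(?h has_integral i) (cbox 0 (q * (b - a)))" by auto
      have "((\<lambda>r. ?h (q * r + 0)) has_integral (1 / \<bar>q\<bar> ^ DIM(real)) *\<^sub>R i)
          ((\<lambda>x. (1 / q) *\<^sub>R x + - ((1 / q) *\<^sub>R 0)) ` cbox 0 (q * (b - a)))"
        using has_integral_affinity[OF i, of q 0] q by simp
      moreover have "(\<lambda>x. (1 / q) *\<^sub>R x + - ((1 / q) *\<^sub>R 0)) ` cbox 0 (q * (b - a)) = {0..b - a}"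
        using q a c by (simp add: image_divide_atLeastAtMost)
      ultimately have "(\<lambda>r. ?h (q * r)) integrable_on {0..b - a}" by (auto intro: has_integral_integrable)
      then have "(\<lambda>r. (2 * q) * ?h (q * r)) integrable_on {0..b - a}" by (rule integrable_on_mult_right)
      then show ?thesis
      proof (rule integrable_eq)
        fix r assume "r \<in> {0..b - a}"
        then show "2 * q * ?h (q * r) = m r / r" using q by (simp add: m_def powr_mult qL)
      qed
    qed
    \<comment> \<open>The orbit of u(a) lies in D for t > a, with A T(t - a) u(a) = E(t - a) u(a);
      what remains is the pure integral of \<open>mild_domain\<close>.\<close>
    define y where "y t = u t - T (t - a) (u a)" for t
    have y_eq: "y t = integral {a..t} (\<lambda>s. T (t - s) (g s))" if "t \<in> {a..b}" for t
      using restart[of a t] that a by (simp add: y_def)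
    have ab: "{a..b} \<subseteq> {\<sigma>..b}" using a by auto
    have y_cont: "continuous_on {a..b} y"
      unfolding y_def
      by (intro continuous_intros T_continuous_on_compose continuous_on_subset[OF u_cont ab]) auto
    have "closed_operator D A" using assms(1) by (simp add: sectorial_def)
    from mild_domain[OF this _ a(2) c(2) continuous_on_subset[OF g_cont ab] y_cont y_eq g_m _ k]
    have y: "\<forall>t\<in>{c..b}. y t \<in> D" "continuous_on {c..b} (\<lambda>t. A (y t))"
      using TD w_ge L by (auto simp: E_def m_def)
    have lin: "x + x' \<in> D \<and> A (x + x') = A x + A x'" if "x \<in> D" "x' \<in> D" for x x'
      using assms(1) that by (simp add: sectorial_def linear_operator_def)
    have u_y: "u t = y t + T (t - a) (u a)" for t by (simp add: y_def)
    have Au: "u t \<in> D \<and> A (u t) = A (y t) + E (t - a) (u a)" if "t \<in> {c..b}" for t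
      using lin[of "y t" "T (t - a) (u a)"] y(1) TD[of "t - a" "u a"] that a by (simp add: u_y[of t] E_def)
    have "continuous_on {c..b} (\<lambda>t. A (y t) + E (t - a) (u a))"
      by (intro continuous_intros y(2) continuous_on_compose2[OF E_continuous_on]) (use a in auto)
    then have "continuous_on {c..b} (\<lambda>t. A (u t))"
      by (rule continuous_on_eq) (simp add: Au)
    then show ?thesis using Au by blast
  qed

  \<comment> \<open>A commutes with T(r) on D: the bounded operator T(r) passes through the limit
    defining the generator. This is the hypothesis \<open>dom\<close> of
    \<open>mild_derivative\<close>.\<close>
  have E_T_A: "E r x = T r (A x)" if "x \<in> D" "r > 0" for r x
  proof -
    have "((\<lambda>h. (1 / h) *\<^sub>R (T h x - x)) \<longlongrightarrow> - A x) (at_right 0)"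
      using gen that unfolding generator_def by blast
    from bounded_linear.tendsto[OF T_bounded_linear this, of r] that
    have "((\<lambda>h. T r ((1 / h) *\<^sub>R (T h x - x))) \<longlongrightarrow> T r (- A x)) (at_right 0)" by simp
    moreover have "\<forall>\<^sub>F h in at_right 0. T r ((1 / h) *\<^sub>R (T h x - x)) = (1 / h) *\<^sub>R (T h (T r x) - T r x)"
    proof -
      have "T r ((1 / h) *\<^sub>R (T h x - x)) = (1 / h) *\<^sub>R (T h (T r x) - T r x)" if "h > 0" for h
        using T_add[of r h x] T_add[of h r x] T_bounded_linear[of r] \<open>r > 0\<close> that
        by (simp add: linear_simps add.commute)
      then show ?thesis by (auto simp: eventually_at_right_field intro!: exI[of _ 1])
    qed
    ultimately have "((\<lambda>h. (1 / h) *\<^sub>R (T h (T r x) - T r x)) \<longlongrightarrow> T r (- A x)) (at_right 0)"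
      by (rule Lim_transform_eventually)
    then have "T r (- A x) = - A (T r x)" using gen unfolding generator_def by blast
    then show ?thesis using T_bounded_linear[of r] that by (simp add: linear_simps E_def)
  qed
  have deriv: "(u has_vector_derivative (g t - A (u t))) (at t)" if t: "t \<in> {\<sigma><..<b}" for t
  proof -
    define c where "c = (\<sigma> + t) / 2"
    have c: "\<sigma> < c" "c < t" "t < b" using t by (auto simp: c_def)
    show ?thesis
    proof (rule mild_derivative[OF c(2,3)])
      show "continuous_on {c..b} g" by (rule continuous_on_subset[OF g_cont]) (use c in auto)
      show "continuous_on {c..b} (\<lambda>t. A (u t))" using regular[of c] c by auto
      show "E r (u s) = T r (A (u s))" if "s \<in> {c..b}" "r > 0" for s r
        using E_T_A regular[of c] c that by auto
    qed (use restart c in auto)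
  qed
  have Au_cont: "continuous_on {\<sigma><..<b} (\<lambda>t. A (u t))"
    unfolding continuous_on_eq_continuous_at[OF open_greaterThanLessThan]
  proof
    fix t assume t: "t \<in> {\<sigma><..<b}"
    define c where "c = (\<sigma> + t) / 2"
    have "continuous_on {c<..<b} (\<lambda>t. A (u t))"
      by (rule continuous_on_subset[OF conjunct2[OF regular[of c]]]) (use t in \<open>auto simp: c_def\<close>)
    then show "continuous (at t) (\<lambda>t. A (u t))"
      using t by (auto simp: continuous_on_eq_continuous_at c_def)
  qed
  show ?thesis
    unfolding strong_solution_def b_def[symmetric]
  proof (intro conjI ballI)
    show "continuous_on {\<sigma>..<b} u" by (rule continuous_on_subset[OF u_cont]) auto
    have "continuous_on {\<sigma><..<b} (\<lambda>t. g t - A (u t))"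
      by (intro continuous_intros Au_cont continuous_on_subset[OF g_cont]) auto
    then show "u C1_differentiable_on {\<sigma><..<b}"
      unfolding C1_differentiable_on_def
      by (intro exI[of _ "\<lambda>t. g t - A (u t)"] conjI ballI deriv)
    show "u \<sigma> = w\<^sub>0" using u_mild[of \<sigma>] b by (simp add: T_0)
    fix t assume t: "t \<in> {\<sigma><..<b}"
    show "u t \<in> D" using regular[of t] t by auto
    show "vector_derivative u (at t) + A (u t) = f t (u t) (history \<sigma> \<tau> u t)"
      using vector_derivative_at[OF deriv[OF t]] by (simp add: g_def)
  qed
qed

end
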